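(* Let $q\ge 2$, let $h\in C([0,1],\mathbb{R}^2)$ satisfy $\int_0^1 h(t)\,dt=0$, and let $H:[0,1]\to\mathbb{R}^2$ be a periodic $C^2$ function with $H''=-h$. Let $\Omega_1,\dots,\Omega_r$ be the bounded connected components of $\mathbb{R}^2\setminus \mathrm{Im}(H)$ (finitely many), and let $s$ be the cardinality of the set $\{j(\Omega_k,H): k=1,\dots,r\}$. Then there is $\lambda_0>0$ such that for every $\lambda\ge\lambda_0$ the repulsive problem $$u''(t)-\frac{u(t)}{|u(t)|^{q+1}}=\lambda h(t),\qquad u(0)=u(1),\quad u'(0)=u'(1)$$ has at least $r+s$ distinct solutions.
   Context: Solutions are $C^2$ functions $u:[0,1]\to\mathbb{R}^2\setminus\{0\}$. "Periodic" for $H$ means $H(0)=H(1)$ and $H'(0)=H'(1)$. For a closed continuous curve $\gamma:[0,1]\to\mathbb{R}^2$ and $x\in\mathbb{R}^2\setminus\mathrm{Im}(\gamma)$, $j(x,\gamma)\in\mathbb{Z}$ is the winding number of $\gamma$ around $x$; it is constant for $x$ in a connected component $\Omega$ of $\mathbb{R}^2\setminus\mathrm{Im}(\gamma)$, and the common value is denoted $j(\Omega,\gamma)$. *)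

theory Defs
  imports "HOL-Complex_Analysis.Complex_Analysis"
begin

text \<open>
  The plane \<open>\<real>\<^sup>2\<close> is the type \<^typ>\<open>complex\<close>: only its real vector space structure and its
  Euclidean norm are used, together with the library's \<^const>\<open>winding_number\<close>, which is defined
  for arbitrary continuous closed paths.
\<close>

text \<open>
  \<open>u\<close> is \<open>C\<^sup>2\<close> on \<open>[0,1]\<close> with first and second derivatives \<open>u'\<close> and \<open>u''\<close>, one-sided at the
  end points. Values outside \<open>[0,1]\<close> play no role.
\<close>

definition C2_derivs ::
  "(real \<Rightarrow> complex) \<Rightarrow> (real \<Rightarrow> complex) \<Rightarrow> (real \<Rightarrow> complex) \<Rightarrow> bool" where
  "C2_derivs u u' u'' \<longleftrightarrow>
     (\<forall>t\<in>{0..1}. (u has_vector_derivative u' t) (at t within {0..1})) \<and>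
     (\<forall>t\<in>{0..1}. (u' has_vector_derivative u'' t) (at t within {0..1})) \<and>
     continuous_on {0..1} u''"

definition repulsive_periodic_solution ::
  "real \<Rightarrow> (real \<Rightarrow> complex) \<Rightarrow> real \<Rightarrow> (real \<Rightarrow> complex) \<Rightarrow> bool" where
  "repulsive_periodic_solution q h lam u \<longleftrightarrow>
     (\<forall>t\<in>{0..1}. u t \<noteq> 0) \<and>
     (\<exists>u' u''. C2_derivs u u' u'' \<and>
        (\<forall>t\<in>{0..1}. u'' t - u t /\<^sub>R (norm (u t) powr (q + 1)) = lam *\<^sub>R h t) \<and>
        u 0 = u 1 \<and> u' 0 = u' 1)"

definition bounded_components :: "(real \<Rightarrow> complex) \<Rightarrow> complex set set" where
  "bounded_components \<gamma> = {\<Omega> \<in> components (- path_image \<gamma>). bounded \<Omega>}"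

text \<open>The common value of the winding number of \<open>\<gamma>\<close> around the points of \<open>\<Omega>\<close>.\<close>

definition component_winding :: "complex set \<Rightarrow> (real \<Rightarrow> complex) \<Rightarrow> int" where
  "component_winding \<Omega> \<gamma> = (THE k. \<forall>x\<in>\<Omega>. winding_number \<gamma> x = of_int k)"

lemma component_winding_eq:
  assumes "path \<gamma>" "pathfinish \<gamma> = pathstart \<gamma>"
    and "\<Omega> \<in> components (- path_image \<gamma>)" "x \<in> \<Omega>"
  shows "winding_number \<gamma> x = of_int (component_winding \<Omega> \<gamma>)"
proof -
  have "\<Omega> \<subseteq> - path_image \<gamma>" and con: "connected \<Omega>"
    using assms(3) by (auto dest: in_components_subset in_components_connected)
  then have disj: "\<Omega> \<inter> path_image \<gamma> = {}" by auto
  with assms(4) have "x \<notin> path_image \<gamma>" by auto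
  then have "winding_number \<gamma> x \<in> \<int>"
    using integer_winding_number_eq[OF assms(1)] assms(2) by simp
  then obtain k where k: "winding_number \<gamma> x = of_int k"
    by (auto elim: Ints_cases)
  obtain c where c: "\<And>y. y \<in> \<Omega> \<Longrightarrow> winding_number \<gamma> y = c"
    using winding_number_constant[OF assms(1,2) con disj] by (auto simp: constant_on_def)
  have "\<forall>y\<in>\<Omega>. winding_number \<gamma> y = of_int k"
    using c[OF assms(4)] c k by auto
  then have "component_winding \<Omega> \<gamma> = k"
    unfolding component_winding_def using assms(4) k by (intro the_equality) auto
  with k show ?thesis by simp
qed

end

theory Submission
  imports Defs
begin

text \<open>
  Integrating \<open>u'' = u / |u|\<^sup>q\<^sup>+\<^sup>1 + \<lambda> h\<close> from its initial data turns periodic solutions into zeros of a shooting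
  map on \<open>\<real>\<^sup>4\<close>. Two facts about its Brouwer degree give the count.

  First, for large \<open>\<lambda>\<close> the curves close to \<open>\<lambda> (x - H)\<close> with \<open>x\<close> in a bounded component \<open>\<Omega>\<close> are governed by the
  averaged force, which is minus the gradient (up to a positive factor) of the potential
  \<open>\<integral> |x - H(t)|\<^sup>1\<^sup>-\<^sup>q dt\<close>. As \<open>q \<ge> 2\<close>, the potential blows up at \<open>\<partial>\<Omega>\<close>, and it is strictly subharmonic, so a
  component \<open>N\<close> of a noncritical sublevel set is contractible and is mapped into itself by a small
  gradient step; hence the degree near \<open>N\<close> is \<open>1\<close>. This yields \<open>r\<close> solutions.

  Second, multiplying the equation by \<open>u\<close> and an energy estimate bound all periodic solutions away from
  \<open>0\<close> and \<open>\<infinity>\<close>, uniformly for forcing parameters in \<open>[0, \<lambda>]\<close>, and exclude them for parameter \<open>0\<close>. So the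
  degree over each class of solutions with a given winding number around \<open>0\<close> vanishes, whereas the
  components of that winding number contribute \<open>1\<close> each: every class contains one more solution.
\<close>

section \<open>Bounded support and derivatives along lines\<close>

text \<open>The singularity makes the true shooting map only partially defined, so the shooting map
  is built from a force truncated inside radius \<open>d\<close>. This force is globally Lipschitz;
  the price is spurious zeros whose curves enter the disc of radius \<open>d\<close>. The a priori
  bound \<open>c\<close> with \<open>2 * d \<le> c\<close> opens a gap: a zero whose curve stays
  beyond \<open>d\<close> is genuine and hence stays beyond \<open>c\<close>, so a winding class of
  genuine zeros can run neither into spurious zeros nor into another class. The homotopy in the
  forcing parameter therefore lives on an open set in the product of data and parameter, with slices
  that vary, rather than on a cylinder.

  The degree is an integral that is only ever compared with its positive value for a translation.
  The shooting map lists the velocity defect first, with the sign \<open>u'(0) - u'(1)\<close>: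
  after rescaling and averaging, its first component can be deformed into a positive multiple of
  \<open>x - (x + \<tau> *\<^sub>R field x)\<close>. In this fixed-point form the self-map of
  \<open>N\<close> and the contractibility of \<open>N\<close> lead to a translation.\<close>

lemma line_derivative_shift:
  fixes f g :: "'a::real_normed_vector \<Rightarrow> real"
  assumes "\<And>x. ((\<lambda>s. f (x + s *\<^sub>R e)) has_real_derivative g x) (at 0)"
  shows "((\<lambda>s. f (x + s *\<^sub>R e)) has_real_derivative g (x + s *\<^sub>R e)) (at s)"
proof -
  have "((\<lambda>r. f (x + (r + s) *\<^sub>R e)) has_real_derivative g (x + s *\<^sub>R e)) (at 0)"
    using assms[of "x + s *\<^sub>R e"] by (simp add: algebra_simps)
  then show ?thesis
    using DERIV_shift[of "\<lambda>s. f (x + s *\<^sub>R e)" "g (x + s *\<^sub>R e)" 0 s] by simp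
qed

lemma integral_translation:
  fixes f :: "'a::euclidean_space \<Rightarrow> real"
  assumes [measurable]: "f \<in> borel_measurable borel"
  shows "(LINT x|lborel. f (c + x)) = (LINT x|lborel. f x)"
proof -
  have "(LINT x|lborel. f x) = (LINT x|distr lborel borel ((+) c). f x)"
    by (simp add: lborel_distr_plus)
  also have "\<dots> = (LINT x|lborel. f (c + x))"
    by (subst integral_distr) auto
  finally show ?thesis by simp
qed

lemma integrable_continuous_bounded_support:
  fixes f :: "'a::euclidean_space \<Rightarrow> real"
  assumes "continuous_on UNIV f" "bounded {x. f x \<noteq> 0}"
  shows "integrable lborel f"
proof -
  obtain B where B: "\<And>x. f x \<noteq> 0 \<Longrightarrow> norm x \<le> B"
    using assms(2) by (auto simp: bounded_iff)
  have "integrable lborel (\<lambda>x. indicator (cball 0 B) x *\<^sub>R f x)"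
    by (rule borel_integrable_compact) (use assms continuous_on_subset in auto)
  moreover have "(\<lambda>x. indicator (cball 0 B) x *\<^sub>R f x) = f"
    using B by (auto simp: indicator_def fun_eq_iff)
  ultimately show ?thesis by simp
qed

text \<open>Translation invariance of Lebesgue measure gives every difference quotient along
  \<open>e\<close> the integral 0, and dominated convergence carries this over to the
  derivative.\<close>

lemma integral_line_derivative_zero:
  fixes f g :: "'a::euclidean_space \<Rightarrow> real"
  assumes der: "\<And>x. ((\<lambda>s. f (x + s *\<^sub>R e)) has_real_derivative g x) (at 0)"
    and contf: "continuous_on UNIV f" and contg: "continuous_on UNIV g"
    and bd: "bounded {x. f x \<noteq> 0}"
  shows "integrable lborel g" "(LINT x|lborel. g x) = 0"
proof -
  obtain B where B: "\<And>x. f x \<noteq> 0 \<Longrightarrow> norm x \<le> B"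
    using bd by (auto simp: bounded_iff)
  \<comment> \<open>\<open>f\<close> vanishes on a neighbourhood of such an \<open>x\<close>, so its
    derivative does too; hence \<open>g\<close> is bounded with bounded support.\<close>
  have g0: "g x = 0" if "norm x > B" for x
  proof -
    have "open (- cball (0::'a) B)" by auto
    then have "\<forall>\<^sub>F y in nhds x. y \<in> - cball 0 B"
      using that by (intro eventually_nhds_in_open) auto
    moreover have "((\<lambda>s. x + s *\<^sub>R e) \<longlongrightarrow> x + 0 *\<^sub>R e) (nhds 0)"
      by (intro tendsto_intros filterlim_ident)
    ultimately have "\<forall>\<^sub>F s in nhds 0. x + s *\<^sub>R e \<in> - cball 0 B"
      by (auto simp: filterlim_iff)
    then have ev: "\<forall>\<^sub>F s in nhds 0. f (x + s *\<^sub>R e) = 0"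
      by eventually_elim (use B in fastforce)
    have "((\<lambda>s. 0::real) has_real_derivative g x) (at 0)"
      using DERIV_cong_ev[OF refl ev refl] der[of x] by blast
    then show ?thesis by (metis DERIV_const DERIV_unique)
  qed
  then have gB: "norm x \<le> B" if "g x \<noteq> 0" for x using that by force
  then have bdg: "bounded {x. g x \<noteq> 0}" by (auto simp: bounded_iff)
  show ig: "integrable lborel g"
    by (rule integrable_continuous_bounded_support[OF contg bdg])
  have "bounded (g ` cball 0 B)"
    by (intro compact_imp_bounded compact_continuous_image continuous_on_subset[OF contg]) auto
  then obtain M0 where M0: "\<And>x. norm x \<le> B \<Longrightarrow> \<bar>g x\<bar> \<le> M0"
    unfolding bounded_iff by (metis imageI mem_cball_0 real_norm_def)
  define M where "M = max M0 0"
  have M: "\<bar>g x\<bar> \<le> M" for x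
    using M0[of x] g0[of x] unfolding M_def by (cases "norm x \<le> B") auto
  define \<epsilon> where "\<epsilon> n = inverse (real (Suc n))" for n
  have eps: "\<epsilon> n > 0" "\<epsilon> n \<le> 1" for n
    by (auto simp: \<epsilon>_def divide_simps)
  have epslim: "\<epsilon> \<longlonglongrightarrow> 0" unfolding \<epsilon>_def by (rule LIMSEQ_inverse_real_of_nat)
  define Q where "Q n x = (f (\<epsilon> n *\<^sub>R e + x) - f x) / \<epsilon> n" for n x
  have [measurable]: "f \<in> borel_measurable borel" "g \<in> borel_measurable borel"
    using contf contg by (auto intro: borel_measurable_continuous_onI)
  have intf: "integrable lborel f"
    by (rule integrable_continuous_bounded_support[OF contf bd])
  \<comment> \<open>Since \<open>\<epsilon> n \<le> 1\<close>, all quotients live in the ball of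
    radius \<open>B + norm e\<close>; there the mean value theorem bounds them by
    \<open>M\<close>.\<close>
  have "(\<lambda>n. LINT x|lborel. Q n x) \<longlonglongrightarrow> (LINT x|lborel. g x)"
  proof (rule integral_dominated_convergence[where w = "\<lambda>x. indicator (cball 0 (B + norm e)) x *\<^sub>R M"])
    show "integrable lborel (\<lambda>x. indicat_real (cball (0::'a) (B + norm e)) x *\<^sub>R M)"
      by (rule borel_integrable_compact) auto
    show "AE x in lborel. (\<lambda>n. Q n x) \<longlonglongrightarrow> g x"
    proof (rule AE_I2)
      fix x
      have "(\<lambda>s. (f (x + s *\<^sub>R e) - f x) / s) \<midarrow>0\<rightarrow> g x"
        using der[of x] by (simp add: DERIV_def)
      moreover have "filterlim \<epsilon> (at 0) sequentially"
        using epslim eps by (auto simp: filterlim_at less_imp_neq[symmetric])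
      ultimately show "(\<lambda>n. Q n x) \<longlonglongrightarrow> g x"
        using filterlim_compose[where g = "\<lambda>s. (f (x + s *\<^sub>R e) - f x) / s" and f = \<epsilon>]
        by (simp add: Q_def add.commute)
    qed
    show "AE x in lborel. norm (Q n x) \<le> indicator (cball 0 (B + norm e)) x *\<^sub>R M" for n
    proof (rule AE_I2)
      fix x
      show "norm (Q n x) \<le> indicator (cball 0 (B + norm e)) x *\<^sub>R M"
      proof (cases "norm x \<le> B + norm e")
        case True
        obtain z where "f (x + \<epsilon> n *\<^sub>R e) - f (x + 0 *\<^sub>R e) = (\<epsilon> n - 0) * g (x + z *\<^sub>R e)"
          using MVT2[of 0 "\<epsilon> n" "\<lambda>s. f (x + s *\<^sub>R e)" "\<lambda>s. g (x + s *\<^sub>R e)"]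
            line_derivative_shift[of f e g, OF der] eps[of n] by blast
        then have "Q n x = g (x + z *\<^sub>R e)"
          using eps[of n] by (simp add: Q_def add.commute)
        then show ?thesis using M True by simp
      next
        case False
        have "norm x \<le> norm (\<epsilon> n *\<^sub>R e + x) + norm (\<epsilon> n *\<^sub>R e)"
          using norm_triangle_ineq4[of "\<epsilon> n *\<^sub>R e + x" "\<epsilon> n *\<^sub>R e"] by simp
        moreover have "norm (\<epsilon> n *\<^sub>R e) \<le> norm e" using eps[of n] by (simp add: mult_left_le_one_le)
        ultimately have "f (\<epsilon> n *\<^sub>R e + x) = 0" "f x = 0"
          using False B[of x] B[of "\<epsilon> n *\<^sub>R e + x"] norm_ge_zero[of e] by linarith+
        then show ?thesis using False by (simp add: Q_def)
      qed
    qed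
  qed (auto simp: Q_def)
  moreover have "(LINT x|lborel. Q n x) = 0" for n
  proof -
    have i1: "integrable lborel (\<lambda>x. f (\<epsilon> n *\<^sub>R e + x))"
    proof (rule integrable_continuous_bounded_support)
      show "continuous_on UNIV (\<lambda>x. f (\<epsilon> n *\<^sub>R e + x))"
        by (rule continuous_on_compose2[OF contf]) (auto intro!: continuous_intros)
      have "norm x \<le> B + norm (\<epsilon> n *\<^sub>R e)" if "f (\<epsilon> n *\<^sub>R e + x) \<noteq> 0" for x
        using B[OF that] norm_triangle_ineq4[of "\<epsilon> n *\<^sub>R e + x" "\<epsilon> n *\<^sub>R e"] by simp
      then show "bounded {x. f (\<epsilon> n *\<^sub>R e + x) \<noteq> 0}" by (auto simp: bounded_iff)
    qed
    have "(LINT x|lborel. Q n x) = ((LINT x|lborel. f (\<epsilon> n *\<^sub>R e + x)) - (LINT x|lborel. f x)) / \<epsilon> n"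
      unfolding Q_def using i1 intf by simp
    then show ?thesis by (simp add: integral_translation)
  qed
  ultimately show "(LINT x|lborel. g x) = 0"
    by (simp add: LIMSEQ_const_iff)
qed

text \<open>\<open>U\<close> and the complement of \<open>K\<close> are open and cover the space,
  and on the second one the product is 0; continuity is glued from these two pieces.\<close>

lemma cutoff_continuous:
  fixes f :: "'a::euclidean_space \<Rightarrow> real"
  assumes "continuous_on UNIV f" "open U" "compact K" "K \<subseteq> U" "\<And>x. x \<in> U - K \<Longrightarrow> f x = 0"
  shows "continuous_on UNIV (\<lambda>x. indicator U x * f x)"
proof -
  have "continuous_on U (\<lambda>x. indicator U x * f x)"
    using continuous_on_subset[OF assms(1), of U] by (auto cong: continuous_on_cong)
  moreover have "continuous_on (- K) (\<lambda>x. indicator U x * f x)"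
  proof -
    have z: "indicator U x * f x = 0" if "x \<in> - K" for x
      using assms(5)[of x] that by (auto simp: indicator_def)
    show ?thesis by (rule continuous_on_eq[of _ "\<lambda>x. 0"]) (use z in auto)
  qed
  ultimately have "continuous_on (U \<union> - K) (\<lambda>x. indicator U x * f x)"
    using assms by (intro continuous_on_open_Un) (auto intro: compact_imp_closed)
  moreover have "U \<union> - K = UNIV" using assms by auto
  ultimately show ?thesis by simp
qed

text \<open>The functions met later are under control only inside \<open>U\<close>, where
  \<open>K\<close> keeps their support off the boundary. Multiplying by the indicator respects the
  derivative along \<open>e\<close> and reduces the claim to bounded support.\<close>

lemma integral_line_derivative_cutoff:
  fixes f g :: "'a::euclidean_space \<Rightarrow> real"
  assumes der: "\<And>x. ((\<lambda>s. f (x + s *\<^sub>R e)) has_real_derivative g x) (at 0)"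
    and contf: "continuous_on UNIV f" and contg: "continuous_on UNIV g"
    and U: "open U" "compact K" "K \<subseteq> U" "\<And>x. x \<in> U - K \<Longrightarrow> f x = 0"
  shows "integrable lborel (\<lambda>x. indicator U x * g x)" "(LINT x|lborel. indicator U x * g x) = 0"
proof -
  have near: "\<forall>\<^sub>F s in nhds 0. x + s *\<^sub>R e \<in> V" if "open V" "x \<in> V" for x V
  proof -
    have "\<forall>\<^sub>F y in nhds x. y \<in> V"
      using that by (intro eventually_nhds_in_open) auto
    moreover have "((\<lambda>s. x + s *\<^sub>R e) \<longlongrightarrow> x + 0 *\<^sub>R e) (nhds 0)"
      by (intro tendsto_intros filterlim_ident)
    ultimately show ?thesis
      by (auto simp: filterlim_iff)
  qed
  have op: "open (U - K)" using U by (simp add: compact_imp_closed open_Diff)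
  have g0: "g x = 0" if "x \<in> U - K" for x
  proof -
    have ev: "\<forall>\<^sub>F s in nhds 0. f (x + s *\<^sub>R e) = 0"
      using near[OF op that] by eventually_elim (use U in auto)
    have "((\<lambda>s. 0::real) has_real_derivative g x) (at 0)"
      using DERIV_cong_ev[OF refl ev refl] der[of x] by blast
    then show ?thesis by (metis DERIV_const DERIV_unique)
  qed
  let ?f = "\<lambda>x. indicator U x * f x" and ?g = "\<lambda>x. indicator U x * g x"
  have der': "((\<lambda>s. ?f (x + s *\<^sub>R e)) has_real_derivative ?g x) (at 0)" for x
  proof (cases "x \<in> U")
    case True
    have ev: "\<forall>\<^sub>F s in nhds 0. ?f (x + s *\<^sub>R e) = f (x + s *\<^sub>R e)"
      using near[OF U(1) True] by eventually_elim auto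
    show ?thesis using DERIV_cong_ev[OF refl ev refl] der[of x] True by auto
  next
    case False
    then have "x \<in> - K" using U by auto
    then have ev: "\<forall>\<^sub>F s in nhds 0. ?f (x + s *\<^sub>R e) = 0"
      using near[of "- K" x] U(2)
      by (auto elim!: eventually_mono simp: indicator_def U(4) compact_imp_closed open_Compl)
    have "((\<lambda>s. 0::real) has_real_derivative 0) (at 0)" by simp
    then show ?thesis using DERIV_cong_ev[OF refl ev refl] False by auto
  qed
  have bd: "bounded {x. ?f x \<noteq> 0}"
    by (rule bounded_subset[OF compact_imp_bounded[OF U(2)]]) (use U(4) in \<open>auto simp: indicator_def split: if_splits\<close>)
  show "integrable lborel ?g" "(LINT x|lborel. ?g x) = 0"
    using integral_line_derivative_zero[OF der' cutoff_continuous[OF contf U] cutoff_continuous[OF contg U(1-3) g0] bd]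
    by auto
qed

section \<open>Jacobians as null Lagrangians\<close>

text \<open>Symmetry of the mixed derivatives is built in because the pairwise cancellation in
  \<open>null_lagrangian\<close> rests on it.\<close>

definition has_C2 ::
  "('a::euclidean_space \<Rightarrow> real) \<Rightarrow> ('a \<Rightarrow> 'a \<Rightarrow> real) \<Rightarrow> ('a \<Rightarrow> 'a \<Rightarrow> 'a \<Rightarrow> real) \<Rightarrow> bool" where
  "has_C2 v v1 v2 \<longleftrightarrow> continuous_on UNIV v \<and>
     (\<forall>e\<in>Basis. continuous_on UNIV (v1 e) \<and>
        (\<forall>x. ((\<lambda>s. v (x + s *\<^sub>R e)) has_real_derivative v1 e x) (at 0))) \<and>
     (\<forall>e\<in>Basis. \<forall>e'\<in>Basis. v2 e e' = v2 e' e \<and> continuous_on UNIV (v2 e e') \<and>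
        (\<forall>x. ((\<lambda>s. v1 e (x + s *\<^sub>R e')) has_real_derivative v2 e e' x) (at 0)))"

text \<open>\<open>D i e\<close> stands for the derivative of the \<open>i\<close>-th component in direction \<open>e\<close>.\<close>

definition jdet :: "('a::euclidean_space \<Rightarrow> 'a \<Rightarrow> real) \<Rightarrow> real" where
  "jdet D = (\<Sum>\<sigma> | \<sigma> permutes Basis. of_int (sign \<sigma>) * (\<Prod>i\<in>Basis. D i (\<sigma> i)))"

lemma jdet_cong:
  assumes "\<And>i e. i \<in> Basis \<Longrightarrow> e \<in> Basis \<Longrightarrow> D i e = D' i e"
  shows "jdet D = jdet D'"
  unfolding jdet_def
  by (intro sum.cong refl arg_cong2[where f = "times"] prod.cong) (auto simp: assms permutes_in_image)

lemma jdet_zero_row: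
  assumes "i \<in> Basis" "\<And>e. e \<in> Basis \<Longrightarrow> D i e = 0"
  shows "jdet D = 0"
proof -
  have "(\<Prod>i\<in>Basis. D i (\<sigma> i)) = 0" if "\<sigma> permutes Basis" for \<sigma>
    using assms that by (intro prod_zero) (auto simp: permutes_in_image intro!: bexI[of _ i])
  then show ?thesis unfolding jdet_def by (intro sum.neutral) auto
qed

lemma jdet_row_diff:
  assumes k: "k \<in> Basis"
    and D: "\<And>e. e \<in> Basis \<Longrightarrow> D k e = D1 k e - D2 k e"
    and eq: "\<And>i e. i \<in> Basis - {k} \<Longrightarrow> e \<in> Basis \<Longrightarrow> D1 i e = D i e \<and> D2 i e = D i e"
  shows "jdet D = jdet D1 - jdet D2"
proof -
  have "(\<Prod>i\<in>Basis. D i (\<sigma> i)) = (\<Prod>i\<in>Basis. D1 i (\<sigma> i)) - (\<Prod>i\<in>Basis. D2 i (\<sigma> i))"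
    if s: "\<sigma> permutes Basis" for \<sigma>
  proof -
    have "(\<Prod>i\<in>Basis - {k}. D1 i (\<sigma> i)) = (\<Prod>i\<in>Basis - {k}. D i (\<sigma> i))"
      "(\<Prod>i\<in>Basis - {k}. D2 i (\<sigma> i)) = (\<Prod>i\<in>Basis - {k}. D i (\<sigma> i))"
      using s eq by (auto intro!: prod.cong simp: permutes_in_image)
    moreover have "D k (\<sigma> k) = D1 k (\<sigma> k) - D2 k (\<sigma> k)"
      using s k D by (simp add: permutes_in_image)
    ultimately show ?thesis using k by (simp add: prod.remove left_diff_distrib)
  qed
  then show ?thesis
    unfolding jdet_def sum_subtractf[symmetric]
    by (intro sum.cong) (auto simp: right_diff_distrib)
qed

lemma continuous_jdet:
  assumes "\<And>i e. i \<in> Basis \<Longrightarrow> e \<in> Basis \<Longrightarrow> continuous_on S (\<lambda>x. D i e x)"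
  shows "continuous_on S (\<lambda>x. jdet (\<lambda>i e. D i e x))"
  unfolding jdet_def
  by (intro continuous_on_sum continuous_on_mult continuous_on_const continuous_on_prod assms)
    (auto simp: permutes_in_image)

text \<open>Composing with the transposition of \<open>k\<close> and \<open>m\<close> reverses the
  sign of the permutation and swaps the two arguments of the symmetric \<open>C\<close>, so the sum
  equals its own negative.\<close>

lemma antisymmetric_permutation_sum:
  fixes A :: "'a \<Rightarrow> 'a \<Rightarrow> 'b \<Rightarrow> 'b \<Rightarrow> real"
  assumes fin: "finite S" and k: "k \<in> S" "m \<in> S" "k \<noteq> m"
    and sym: "\<And>e e'. e \<in> S \<Longrightarrow> e' \<in> S \<Longrightarrow> C e e' = C e' e"
  shows "(\<Sum>\<sigma> | \<sigma> permutes S. of_int (sign \<sigma>) * (C (\<sigma> m) (\<sigma> k) * (\<Prod>i\<in>S - {k} - {m}. D i (\<sigma> i)))) = (0::real)"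
proof -
  let ?f = "\<lambda>\<sigma>. of_int (sign \<sigma>) * (C (\<sigma> m) (\<sigma> k) * (\<Prod>i\<in>S - {k} - {m}. D i (\<sigma> i)))"
  let ?t = "Transposition.transpose k m"
  have t: "?t permutes S" using k by (simp add: permutes_swap_id)
  have "sum ?f {\<sigma>. \<sigma> permutes S} = sum (\<lambda>\<sigma>. ?f (\<sigma> \<circ> ?t)) {\<sigma>. \<sigma> permutes S}"
    by (rule sum_permutations_compose_right[OF t])
  also have "\<dots> = sum (\<lambda>\<sigma>. - ?f \<sigma>) {\<sigma>. \<sigma> permutes S}"
  proof (rule sum.cong[OF refl])
    fix \<sigma> assume "\<sigma> \<in> {\<sigma>. \<sigma> permutes S}"
    then have s: "\<sigma> permutes S" by simp
    have "sign (\<sigma> \<circ> ?t) = - sign \<sigma>"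
      using k permutes_imp_permutation[OF fin s] permutes_imp_permutation[OF fin t]
      by (simp add: sign_compose sign_swap_id)
    moreover have "(\<Prod>i\<in>S - {k} - {m}. D i ((\<sigma> \<circ> ?t) i)) = (\<Prod>i\<in>S - {k} - {m}. D i (\<sigma> i))"
      by (intro prod.cong) auto
    moreover have "C ((\<sigma> \<circ> ?t) m) ((\<sigma> \<circ> ?t) k) = C (\<sigma> m) (\<sigma> k)"
      using sym[of "\<sigma> k" "\<sigma> m"] s k by (simp add: permutes_in_image)
    ultimately show "?f (\<sigma> \<circ> ?t) = - ?f \<sigma>" by simp
  qed
  also have "\<dots> = - sum ?f {\<sigma>. \<sigma> permutes S}" by (simp add: sum_negf)
  finally show ?thesis by simp
qed

text \<open>
  The Jacobian is a sum of derivatives of \<open>v k\<close> times products of first derivatives of the other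
  components; the second derivatives cancel in pairs.
\<close>

lemma null_lagrangian:
  fixes v :: "'a::euclidean_space \<Rightarrow> 'a \<Rightarrow> real"
  assumes C2: "\<And>i. i \<in> Basis \<Longrightarrow> has_C2 (v i) (v1 i) (v2 i)"
    and k: "k \<in> Basis"
    and U: "open U" "compact K" "K \<subseteq> U"
    and van: "\<And>x. x \<in> U - K \<Longrightarrow>
      v k x = 0 \<or> (\<exists>i\<in>Basis - {k}. \<forall>e\<in>Basis. v1 i e x = 0)"
  shows "integrable lborel (\<lambda>x. indicator U x * jdet (\<lambda>i e. v1 i e x))"
    and "(LINT x|lborel. indicator U x * jdet (\<lambda>i e. v1 i e x)) = 0"
proof -
  define P where "P \<sigma> x = (\<Prod>i\<in>Basis - {k}. v1 i (\<sigma> i) x)" for \<sigma> x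
  define R where "R \<sigma> x = (\<Sum>m\<in>Basis - {k}. v2 m (\<sigma> m) (\<sigma> k) x * (\<Prod>i\<in>Basis - {k} - {m}. v1 i (\<sigma> i) x))" for \<sigma> x
  have cv: "continuous_on UNIV (v i)" if "i \<in> Basis" for i using C2[OF that] by (simp add: has_C2_def)
  have cv1: "continuous_on UNIV (v1 i e)" if "i \<in> Basis" "e \<in> Basis" for i e
    using C2[of i] that by (simp add: has_C2_def)
  have cv2: "continuous_on UNIV (v2 i e e')" if "i \<in> Basis" "e \<in> Basis" "e' \<in> Basis" for i e e'
    using C2[of i] that by (simp add: has_C2_def)
  \<comment> \<open>For each permutation the product of \<open>v k\<close> and
    \<open>P \<sigma>\<close> is differentiated in the direction \<open>\<sigma> k\<close>; by
    \<open>van\<close> it vanishes on \<open>U - K\<close>, so its derivative has integral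
    0.\<close>
  have *: "integrable lborel (\<lambda>x. indicator U x * (v1 k (\<sigma> k) x * P \<sigma> x + v k x * R \<sigma> x)) \<and>
      (LINT x|lborel. indicator U x * (v1 k (\<sigma> k) x * P \<sigma> x + v k x * R \<sigma> x)) = 0"
    if s: "\<sigma> permutes Basis" for \<sigma>
  proof -
    have sB: "\<sigma> i \<in> Basis" if "i \<in> Basis" for i using s that by (simp add: permutes_in_image)
    have d: "((\<lambda>s. v k (x + s *\<^sub>R \<sigma> k) * P \<sigma> (x + s *\<^sub>R \<sigma> k)) has_real_derivative
        (v1 k (\<sigma> k) x * P \<sigma> x + v k x * R \<sigma> x)) (at 0)" for x
    proof -
      have "((\<lambda>s. P \<sigma> (x + s *\<^sub>R \<sigma> k)) has_real_derivative
          (\<Sum>m\<in>Basis - {k}. v2 m (\<sigma> m) (\<sigma> k) x *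
            (\<Prod>i\<in>Basis - {k} - {m}. v1 i (\<sigma> i) (x + 0 *\<^sub>R \<sigma> k)))) (at 0)"
        unfolding P_def
        by (rule has_field_derivative_prod) (use C2 sB k in \<open>auto simp: has_C2_def\<close>)
      then have 1: "((\<lambda>s. P \<sigma> (x + s *\<^sub>R \<sigma> k)) has_real_derivative R \<sigma> x) (at 0)"
        by (simp add: R_def)
      have 2: "((\<lambda>s. v k (x + s *\<^sub>R \<sigma> k)) has_real_derivative v1 k (\<sigma> k) x) (at 0)"
        using C2[OF k] sB[OF k] by (simp add: has_C2_def)
      show ?thesis using DERIV_mult[OF 2 1] by (simp add: algebra_simps)
    qed
    have cP: "continuous_on UNIV (P \<sigma>)" unfolding P_def by (intro continuous_on_prod cv1) (auto simp: sB)
    have cR: "continuous_on UNIV (R \<sigma>)" unfolding R_def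
      by (intro continuous_on_sum continuous_on_mult continuous_on_prod cv1 cv2) (auto simp: sB k)
    have z: "v k x * P \<sigma> x = 0" if "x \<in> U - K" for x
      using van[OF that] sB by (auto simp: P_def)
    show ?thesis
      by (intro conjI integral_line_derivative_cutoff[where f = "\<lambda>x. v k x * P \<sigma> x" and e = "\<sigma> k" and K = K] d U z
          continuous_intros cv cv1 cP cR k sB)
  qed
  \<comment> \<open>Summed with signs, the terms containing \<open>R \<sigma>\<close> disappear: for
    fixed \<open>m\<close>, exchanging \<open>\<sigma> m\<close> and \<open>\<sigma> k\<close>
    leaves \<open>v2 m\<close> unchanged. What remains is the Leibniz expansion of the
    determinant.\<close>
  have eq: "jdet (\<lambda>i e. v1 i e x) = (\<Sum>\<sigma> | \<sigma> permutes Basis. of_int (sign \<sigma>) * (v1 k (\<sigma> k) x * P \<sigma> x + v k x * R \<sigma> x))" for x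
  proof -
    have "(\<Sum>\<sigma> | \<sigma> permutes Basis. of_int (sign \<sigma>) * R \<sigma> x) =
      (\<Sum>m\<in>Basis - {k}. \<Sum>\<sigma> | \<sigma> permutes Basis. of_int (sign \<sigma>) *
         (v2 m (\<sigma> m) (\<sigma> k) x * (\<Prod>i\<in>Basis - {k} - {m}. v1 i (\<sigma> i) x)))"
      unfolding R_def sum_distrib_left by (rule sum.swap)
    also have "\<dots> = 0"
    proof (rule sum.neutral, rule ballI)
      fix m assume m: "m \<in> Basis - {k}"
      then have "v2 m e e' x = v2 m e' e x" if "e \<in> Basis" "e' \<in> Basis" for e e'
        using C2[of m] that by (simp add: has_C2_def)
      then show "(\<Sum>\<sigma> | \<sigma> permutes Basis. of_int (sign \<sigma>) *
         (v2 m (\<sigma> m) (\<sigma> k) x * (\<Prod>i\<in>Basis - {k} - {m}. v1 i (\<sigma> i) x))) = 0"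
        using m k antisymmetric_permutation_sum[of Basis k m "\<lambda>e e'. v2 m e e' x" "\<lambda>i e. v1 i e x"] by auto
    qed
    finally have R0: "(\<Sum>\<sigma> | \<sigma> permutes Basis. of_int (sign \<sigma>) * R \<sigma> x) = 0" .
    have "(\<Sum>\<sigma> | \<sigma> permutes Basis. of_int (sign \<sigma>) * (v1 k (\<sigma> k) x * P \<sigma> x + v k x * R \<sigma> x)) =
      (\<Sum>\<sigma> | \<sigma> permutes Basis. of_int (sign \<sigma>) * (v1 k (\<sigma> k) x * P \<sigma> x)) +
      v k x * (\<Sum>\<sigma> | \<sigma> permutes Basis. of_int (sign \<sigma>) * R \<sigma> x)"
      by (simp add: sum.distrib sum_distrib_left algebra_simps)
    then show ?thesis using k by (simp add: R0 jdet_def P_def prod.remove)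
  qed
  have eqI: "(\<lambda>x. indicator U x * jdet (\<lambda>i e. v1 i e x)) = (\<lambda>x. \<Sum>\<sigma> | \<sigma> permutes Basis.
      of_int (sign \<sigma>) * (indicator U x * (v1 k (\<sigma> k) x * P \<sigma> x + v k x * R \<sigma> x)))"
    unfolding eq by (simp add: sum_distrib_left algebra_simps)
  show "integrable lborel (\<lambda>x. indicator U x * jdet (\<lambda>i e. v1 i e x))"
    unfolding eqI using * by auto
  show "(LINT x|lborel. indicator U x * jdet (\<lambda>i e. v1 i e x)) = 0"
    unfolding eqI using * by (subst Bochner_Integration.integral_sum) auto
qed

lemma has_C2_diff:
  assumes "has_C2 v v1 v2" "has_C2 w w1 w2"
  shows "has_C2 (\<lambda>x. v x - w x) (\<lambda>e x. v1 e x - w1 e x) (\<lambda>e e' x. v2 e e' x - w2 e e' x)"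
  using assms unfolding has_C2_def by (auto intro!: continuous_intros DERIV_diff)

text \<open>The rows of \<open>v\<close> are exchanged for those of \<open>w\<close> one at a time.
  Each exchange alters the determinant by one whose row \<open>k\<close> comes from
  \<open>w k - v k\<close>; on \<open>U - K\<close> either this difference or some other row
  vanishes, so \<open>null_lagrangian\<close> applies.\<close>

lemma jacobian_integral_unique:
  fixes v w :: "'a::euclidean_space \<Rightarrow> 'a \<Rightarrow> real"
  assumes v: "\<And>i. i \<in> Basis \<Longrightarrow> has_C2 (v i) (v1 i) (v2 i)"
    and w: "\<And>i. i \<in> Basis \<Longrightarrow> has_C2 (w i) (w1 i) (w2 i)"
    and U: "open U" "compact K" "K \<subseteq> U"
    and van: "\<And>x. x \<in> U - K \<Longrightarrow> \<exists>i\<in>Basis. v i x = w i x \<and> (\<forall>e\<in>Basis. v1 i e x = 0 \<and> w1 i e x = 0)"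
  shows "(LINT x|lborel. indicator U x * jdet (\<lambda>i e. v1 i e x)) =
         (LINT x|lborel. indicator U x * jdet (\<lambda>i e. w1 i e x))"
proof -
  define J where "J S x = jdet (\<lambda>i e. if i \<in> S then w1 i e x else v1 i e x)" for S x
  have cont: "continuous_on UNIV (J S)" for S
  proof -
    have "continuous_on UNIV (\<lambda>x. if i \<in> S then w1 i e x else v1 i e x)"
      if "i \<in> Basis" "e \<in> Basis" for i e :: 'a
      using v[of i] w[of i] that by (cases "i \<in> S") (auto simp: has_C2_def)
    then show ?thesis unfolding J_def by (rule continuous_jdet)
  qed
  have J0: "J S x = 0" if x: "x \<in> U - K" for S x
  proof -
    obtain i where "i \<in> Basis" "\<forall>e\<in>Basis. v1 i e x = 0 \<and> w1 i e x = 0" using van[OF x] by auto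
    then show ?thesis unfolding J_def by (intro jdet_zero_row[of i]) auto
  qed
  have int: "integrable lborel (\<lambda>x. indicator U x * J S x)" for S
  proof (rule integrable_continuous_bounded_support)
    show "continuous_on UNIV (\<lambda>x. indicator U x * J S x)"
      by (rule cutoff_continuous[OF cont U J0])
    show "bounded {x. indicator U x * J S x \<noteq> 0}"
      by (rule bounded_subset[OF compact_imp_bounded[OF U(2)]])
        (use J0 in \<open>auto simp: indicator_def split: if_splits\<close>)
  qed
  have "(LINT x|lborel. indicator U x * J S x) = (LINT x|lborel. indicator U x * J {} x)"
    if "finite S" "S \<subseteq> Basis" for S
    using that
  proof (induction S rule: finite_induct)
    case (insert k S)
    let ?z = "\<lambda>i. if i = k then (\<lambda>x. w k x - v k x) else if i \<in> S then w i else v i"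
    let ?z1 = "\<lambda>i. if i = k then (\<lambda>e x. w1 k e x - v1 k e x) else if i \<in> S then w1 i else v1 i"
    let ?z2 = "\<lambda>i. if i = k then (\<lambda>e e' x. w2 k e e' x - v2 k e e' x) else if i \<in> S then w2 i else v2 i"
    have k: "k \<in> Basis" using insert by auto
    have "(LINT x|lborel. indicator U x * jdet (\<lambda>i e. ?z1 i e x)) = 0"
    proof (rule null_lagrangian(2)[of ?z ?z1 ?z2 k U K])
      show "has_C2 (?z i) (?z1 i) (?z2 i)" if "i \<in> Basis" for i
        using v w that by (auto intro: has_C2_diff)
      show "?z k x = 0 \<or> (\<exists>i\<in>Basis - {k}. \<forall>e\<in>Basis. ?z1 i e x = 0)" if x: "x \<in> U - K" for x
      proof -
        obtain i where i: "i \<in> Basis" "v i x = w i x" "\<forall>e\<in>Basis. v1 i e x = 0 \<and> w1 i e x = 0"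
          using van[OF x] by auto
        show ?thesis
        proof (cases "i = k")
          case True then show ?thesis using i by auto
        next
          case False
          then show ?thesis using i by (intro disjI2 bexI[of _ i]) auto
        qed
      qed
    qed (use U k in auto)
    moreover have "jdet (\<lambda>i e. ?z1 i e x) = J (insert k S) x - J S x" for x
      unfolding J_def using insert.hyps by (intro jdet_row_diff[OF k]) auto
    ultimately have "(LINT x|lborel. indicator U x * J (insert k S) x - indicator U x * J S x) = 0"
      by (simp add: algebra_simps)
    then have "(LINT x|lborel. indicator U x * J (insert k S) x) = (LINT x|lborel. indicator U x * J S x)"
      using int by simp
    then show ?case using insert by simp
  qed simp
  from this[of Basis] show ?thesis
    by (simp add: J_def cong: jdet_cong)
qed

section \<open>A Brouwer degree for Euclidean spaces\<close>

text \<open>Squaring the positive part makes this a C1 function supported between -1 and 1, just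
  smooth enough for its primitive to produce functions with \<open>has_C2\<close>.\<close>

definition bump :: "real \<Rightarrow> real" where
  "bump s = (max 0 (1 - s\<^sup>2))\<^sup>2"

definition bump' :: "real \<Rightarrow> real" where
  "bump' s = - 4 * s * max 0 (1 - s\<^sup>2)"

lemma DERIV_max_0_squared: "((\<lambda>r::real. (max 0 r)\<^sup>2) has_real_derivative 2 * max 0 r) (at r)"
proof -
  consider "r > 0" | "r < 0" | "r = 0" by linarith
  then show ?thesis
  proof cases
    case 1
    have ev: "\<forall>\<^sub>F x in nhds r. (max 0 x)\<^sup>2 = x\<^sup>2"
      using eventually_nhds_in_open[of "{0<..}" r] 1 by (auto elim!: eventually_mono)
    have "((\<lambda>x. x\<^sup>2) has_real_derivative 2 * r) (at r)"
      by (auto intro!: derivative_eq_intros)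
    then show ?thesis using DERIV_cong_ev[OF refl ev refl] 1 by simp
  next
    case 2
    have ev: "\<forall>\<^sub>F x in nhds r. (max 0 x)\<^sup>2 = 0"
      using eventually_nhds_in_open[of "{..<0}" r] 2 by (auto elim!: eventually_mono)
    show ?thesis using DERIV_cong_ev[OF refl ev refl] 2 by simp
  next
    case 3
    have "(\<lambda>h. (max 0 h)\<^sup>2 / h) \<midarrow>0\<rightarrow> (0::real)"
    proof (rule Lim_null_comparison[where g = "\<lambda>h. \<bar>h\<bar>"])
      show "\<forall>\<^sub>F h in at 0. norm ((max 0 h)\<^sup>2 / h) \<le> \<bar>h::real\<bar>"
        by (auto simp: max_def power2_eq_square)
      show "(\<lambda>h. \<bar>h\<bar>) \<midarrow>0\<rightarrow> (0::real)" using tendsto_rabs_zero[of "\<lambda>x. x" "at 0"] by simp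
    qed
    then show ?thesis using 3 by (simp add: DERIV_def)
  qed
qed

lemma DERIV_bump: "(bump has_real_derivative bump' s) (at s)"
proof -
  have "((\<lambda>s. 1 - s\<^sup>2) has_real_derivative - (2 * s)) (at s)"
    by (auto intro!: derivative_eq_intros)
  from DERIV_chain2[OF DERIV_max_0_squared this] show ?thesis
    unfolding bump_def bump'_def by (simp add: mult_ac)
qed

lemma continuous_bump [continuous_intros]:
  "continuous_on S f \<Longrightarrow> continuous_on S (\<lambda>x. bump (f x))"
  "continuous_on S f \<Longrightarrow> continuous_on S (\<lambda>x. bump' (f x))"
  unfolding bump_def bump'_def by (intro continuous_intros; assumption)+

lemma bump_nonneg: "bump s \<ge> 0" and bump_0: "bump 0 = 1"
  by (auto simp: bump_def)

lemma bump_outside: "\<bar>s\<bar> \<ge> 1 \<Longrightarrow> bump s = 0"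
proof -
  assume "\<bar>s\<bar> \<ge> 1"
  then have "s\<^sup>2 \<ge> 1" using abs_le_square_iff[of 1 s] by simp
  then show ?thesis by (simp add: bump_def)
qed

text \<open>A C2 step, constant beyond -1 and beyond 1. Applied to a component of a map divided by
  \<open>\<rho>\<close>, it kills the gradient of that component wherever its size is at least
  \<open>\<rho>\<close>.\<close>

definition smooth_step :: "real \<Rightarrow> real" where
  "smooth_step = (SOME b. \<forall>s. (b has_real_derivative bump s) (at s))"

lemma DERIV_smooth_step: "(smooth_step has_real_derivative bump s) (at s)"
proof -
  have "isCont bump s" for s using DERIV_bump DERIV_isCont by blast
  then have "\<exists>F. \<forall>x. (F has_vector_derivative bump x) (at x)"
    using einterval_antiderivative[of "-\<infinity>" "\<infinity>" bump] by auto
  then have "\<exists>b. \<forall>s. (b has_real_derivative bump s) (at s)"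
    by (simp add: has_real_derivative_iff_has_vector_derivative)
  then show ?thesis unfolding smooth_step_def by (rule someI2_ex) auto
qed

lemma smooth_step_const: "s \<ge> 1 \<Longrightarrow> smooth_step s = smooth_step 1" "s \<le> -1 \<Longrightarrow> smooth_step s = smooth_step (-1)"
proof -
  have *: "smooth_step x = smooth_step y" if xy: "x \<le> y" and b0: "\<And>z. x \<le> z \<Longrightarrow> z \<le> y \<Longrightarrow> bump z = 0" for x y
  proof (cases "x = y")
    case False
    then obtain z where "x < z" "z < y" "smooth_step y - smooth_step x = (y - x) * bump z"
      using MVT2[of x y smooth_step bump] DERIV_smooth_step xy by force
    then show ?thesis using b0[of z] by simp
  qed simp
  show "s \<ge> 1 \<Longrightarrow> smooth_step s = smooth_step 1" using *[of 1 s] by (auto simp: bump_outside)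
  show "s \<le> -1 \<Longrightarrow> smooth_step s = smooth_step (-1)" using *[of s "-1"] by (auto simp: bump_outside)
qed

section \<open>The degree integral for polynomial maps\<close>

lemma has_C2_polynomial:
  assumes "real_polynomial_function p"
  shows "\<exists>p1 p2. has_C2 p p1 p2"
  using assms
proof (induction p rule: real_polynomial_function.induct)
  case (linear f)
  interpret bounded_linear f by fact
  have "has_C2 f (\<lambda>e x. f e) (\<lambda>e e' x. 0)"
    unfolding has_C2_def
    by (auto simp: add scaleR linear_continuous_on bounded_linear_axioms intro!: derivative_eq_intros)
  then show ?case by blast
next
  case (const c)
  have "has_C2 (\<lambda>x. c) (\<lambda>e x. 0) (\<lambda>e e' x. 0)" unfolding has_C2_def by auto
  then show ?case by blast
next
  case (add f g)
  then obtain f1 f2 g1 g2 where "has_C2 f f1 f2" "has_C2 g g1 g2" by blast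
  then have "has_C2 (\<lambda>x. f x + g x) (\<lambda>e x. f1 e x + g1 e x) (\<lambda>e e' x. f2 e e' x + g2 e e' x)"
    unfolding has_C2_def by (auto intro!: continuous_intros DERIV_add)
  then show ?case by blast
next
  case (mult f g)
  then obtain f1 f2 g1 g2 where *: "has_C2 f f1 f2" "has_C2 g g1 g2" by blast
  have "has_C2 (\<lambda>x. f x * g x) (\<lambda>e x. f1 e x * g x + g1 e x * f x)
     (\<lambda>e e' x. (f2 e e' x * g x + g1 e' x * f1 e x) + (g2 e e' x * f x + f1 e' x * g1 e x))"
    unfolding has_C2_def
  proof (intro conjI ballI allI)
    fix e e' :: 'a and x assume B: "e \<in> Basis" "e' \<in> Basis"
    note d = *[unfolded has_C2_def]
    have df: "((\<lambda>s. f (x + s *\<^sub>R e)) has_real_derivative f1 e x) (at 0)"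
      "((\<lambda>s. g (x + s *\<^sub>R e)) has_real_derivative g1 e x) (at 0)" if "e \<in> Basis" for e
      using d that by auto
    have df1: "((\<lambda>s. f1 e (x + s *\<^sub>R e')) has_real_derivative f2 e e' x) (at 0)"
      "((\<lambda>s. g1 e (x + s *\<^sub>R e')) has_real_derivative g2 e e' x) (at 0)"
      using d B by blast+
    show "((\<lambda>s. f (x + s *\<^sub>R e) * g (x + s *\<^sub>R e)) has_real_derivative f1 e x * g x + g1 e x * f x) (at 0)"
      using DERIV_mult[OF df(1)[OF B(1)] df(2)[OF B(1)]] by simp
    show "((\<lambda>s. f1 e (x + s *\<^sub>R e') * g (x + s *\<^sub>R e') + g1 e (x + s *\<^sub>R e') * f (x + s *\<^sub>R e'))
       has_real_derivative (f2 e e' x * g x + g1 e' x * f1 e x) + (g2 e e' x * f x + f1 e' x * g1 e x)) (at 0)"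
      using DERIV_add[OF DERIV_mult[OF df1(1) df(2)[OF B(2)]] DERIV_mult[OF df1(2) df(1)[OF B(2)]]] by simp
    show "(\<lambda>x. (f2 e e' x * g x + g1 e' x * f1 e x) + (g2 e e' x * f x + f1 e' x * g1 e x)) =
       (\<lambda>x. (f2 e' e x * g x + g1 e x * f1 e' x) + (g2 e' e x * f x + f1 e x * g1 e' x))"
    proof -
      have "f2 e e' = f2 e' e" "g2 e e' = g2 e' e" using d B by auto
      then show ?thesis by (simp add: fun_eq_iff)
    qed
    show "continuous_on UNIV (\<lambda>x. (f2 e e' x * g x + g1 e' x * f1 e x) + (g2 e e' x * f x + f1 e' x * g1 e x))"
      using d B by (intro continuous_intros) auto
    show "continuous_on UNIV (\<lambda>x. f1 e x * g x + g1 e x * f x)"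
      using d B by (intro continuous_intros) auto
  next
    show "continuous_on UNIV (\<lambda>x. f x * g x)"
      using * by (intro continuous_intros) (auto simp: has_C2_def)
  qed
  then show ?case by blast
qed

lemma has_C2_smooth_step:
  assumes "has_C2 p p1 p2"
  shows "has_C2 (\<lambda>x. smooth_step (p x / r)) (\<lambda>e x. bump (p x / r) * (p1 e x / r))
    (\<lambda>e e' x. bump' (p x / r) * (p1 e' x / r) * (p1 e x / r) + p2 e e' x / r * bump (p x / r))"
  unfolding has_C2_def
proof (intro conjI ballI allI)
  note d = assms[unfolded has_C2_def]
  have cdiv: "continuous_on UNIV (\<lambda>x. g x / r)" if "continuous_on UNIV g" for g :: "'a \<Rightarrow> real"
    using continuous_on_mult_right[OF that, of "inverse r"] by (simp add: field_class.field_divide_inverse)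
  have cp: "continuous_on UNIV (\<lambda>x. p x / r)" using d by (auto intro: cdiv)
  have "continuous_on UNIV smooth_step" using DERIV_smooth_step
    by (meson DERIV_isCont continuous_at_imp_continuous_on)
  then show "continuous_on UNIV (\<lambda>x. smooth_step (p x / r))"
    using cp by (rule continuous_on_compose2) auto
  fix e :: 'a assume e: "e \<in> Basis"
  have ce: "continuous_on UNIV (\<lambda>x. p1 e x / r)" if "e \<in> Basis" for e using d that by (auto intro: cdiv)
  have dp: "((\<lambda>s. p (x + s *\<^sub>R e) / r) has_real_derivative p1 e x / r) (at 0)" if "e \<in> Basis" for e x
    using d that by (auto intro: DERIV_cdivide)
  show "continuous_on UNIV (\<lambda>x. bump (p x / r) * (p1 e x / r))"
    by (intro continuous_on_mult continuous_bump cp ce e)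
  show "((\<lambda>s. smooth_step (p (x + s *\<^sub>R e) / r)) has_real_derivative bump (p x / r) * (p1 e x / r)) (at 0)" for x
    using DERIV_chain2[OF DERIV_smooth_step dp[OF e]] by (metis (no_types) add.right_neutral scaleR_zero_left)
  fix e' :: 'a assume e': "e' \<in> Basis"
  have p2: "p2 e e' = p2 e' e" using d e e' by auto
  show "(\<lambda>x. bump' (p x / r) * (p1 e' x / r) * (p1 e x / r) + p2 e e' x / r * bump (p x / r)) =
        (\<lambda>x. bump' (p x / r) * (p1 e x / r) * (p1 e' x / r) + p2 e' e x / r * bump (p x / r))"
    by (simp add: p2 mult_ac)
  have "continuous_on UNIV (\<lambda>x. p2 e e' x / r)" using d e e' by (auto intro: cdiv)
  then show "continuous_on UNIV (\<lambda>x. bump' (p x / r) * (p1 e' x / r) * (p1 e x / r) + p2 e e' x / r * bump (p x / r))"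
    by (intro continuous_on_add continuous_on_mult continuous_bump cp ce e e')
  fix x
  have 1: "((\<lambda>s. bump (p (x + s *\<^sub>R e') / r)) has_real_derivative bump' (p x / r) * (p1 e' x / r)) (at 0)"
    using DERIV_chain2[OF DERIV_bump dp[OF e']] by (metis (no_types) add.right_neutral scaleR_zero_left)
  have 2: "((\<lambda>s. p1 e (x + s *\<^sub>R e') / r) has_real_derivative p2 e e' x / r) (at 0)"
    using d e e' by (intro DERIV_cdivide) blast
  show "((\<lambda>s. bump (p (x + s *\<^sub>R e') / r) * (p1 e (x + s *\<^sub>R e') / r)) has_real_derivative
      bump' (p x / r) * (p1 e' x / r) * (p1 e x / r) + p2 e e' x / r * bump (p x / r)) (at 0)"
    using DERIV_mult[OF 1 2] by simp
qed

text \<open>By the chain rule the integrand is the Jacobian of \<open>p\<close> times the product of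
  \<open>bump (p x \<bullet> i / \<rho>) / \<rho>\<close> over the basis: the classical integral
  formula for the degree, written as a single Jacobian so that the null Lagrangian property
  applies.\<close>

definition poly_degree :: "real \<Rightarrow> 'a::euclidean_space set \<Rightarrow> ('a \<Rightarrow> 'a) \<Rightarrow> real" where
  "poly_degree \<rho> U p = (LINT x|lborel. indicator U x *
     jdet (\<lambda>i e. deriv (\<lambda>s. smooth_step ((p (x + s *\<^sub>R e) \<bullet> i) / \<rho>)) 0))"

text \<open>
  A multiple, depending on \<open>\<rho>\<close> only, of the Brouwer degree of \<open>f\<close> on \<open>U\<close> at \<open>0\<close>, for bounded open \<open>U\<close> and
  small \<open>\<rho>\<close>: the Jacobian is integrated against a product bump supported in the cube of radius \<open>\<rho>\<close>.
\<close>

definition cube_degree :: "real \<Rightarrow> 'a::euclidean_space set \<Rightarrow> ('a \<Rightarrow> 'a) \<Rightarrow> real" where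
  "cube_degree \<rho> U f = poly_degree \<rho> U
     (SOME p. polynomial_function p \<and> (\<forall>x\<in>closure U. norm (f x - p x) < \<rho> / 4))"

lemma has_C2_poly_step:
  fixes p :: "'a::euclidean_space \<Rightarrow> 'a"
  assumes "polynomial_function p" "\<rho> > 0"
  obtains v1 v2 where
    "\<And>i. i \<in> Basis \<Longrightarrow> has_C2 (\<lambda>x. smooth_step ((p x \<bullet> i) / \<rho>)) (v1 i) (v2 i)"
    "\<And>i e x. i \<in> Basis \<Longrightarrow> e \<in> Basis \<Longrightarrow> deriv (\<lambda>s. smooth_step ((p (x + s *\<^sub>R e) \<bullet> i) / \<rho>)) 0 = v1 i e x"
    "\<And>i e x. i \<in> Basis \<Longrightarrow> e \<in> Basis \<Longrightarrow> \<rho> \<le> \<bar>p x \<bullet> i\<bar> \<Longrightarrow> v1 i e x = 0"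
proof -
  have "\<exists>p1 p2. has_C2 (\<lambda>x. p x \<bullet> i) p1 p2" if "i \<in> Basis" for i
    using assms(1) by (intro has_C2_polynomial) (simp add: polynomial_function_iff_Basis_inner that)
  then obtain p1 p2 where p: "\<And>i. i \<in> Basis \<Longrightarrow> has_C2 (\<lambda>x. p x \<bullet> i) (p1 i) (p2 i)"
    by metis
  let ?v1 = "\<lambda>i e x. bump (p x \<bullet> i / \<rho>) * (p1 i e x / \<rho>)"
  let ?v2 = "\<lambda>i e e' x. bump' (p x \<bullet> i / \<rho>) * (p1 i e' x / \<rho>) * (p1 i e x / \<rho>) + p2 i e e' x / \<rho> * bump (p x \<bullet> i / \<rho>)"
  have C: "has_C2 (\<lambda>x. smooth_step ((p x \<bullet> i) / \<rho>)) (?v1 i) (?v2 i)" if "i \<in> Basis" for i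
    using has_C2_smooth_step[OF p[OF that]] .
  show ?thesis
  proof (rule that[of ?v1 ?v2])
    show "deriv (\<lambda>s. smooth_step ((p (x + s *\<^sub>R e) \<bullet> i) / \<rho>)) 0 = ?v1 i e x" if "i \<in> Basis" "e \<in> Basis" for i e x
      using C[OF that(1)] that(2) by (intro DERIV_imp_deriv) (auto simp: has_C2_def)
    show "?v1 i e x = 0" if "\<rho> \<le> \<bar>p x \<bullet> i\<bar>" for i e x
      using that assms(2) by (simp add: bump_outside)
  qed (use C in auto)
qed

lemma infnorm_attained:
  fixes x :: "'a::euclidean_space"
  obtains i where "i \<in> Basis" "infnorm x = \<bar>x \<bullet> i\<bar>"
proof -
  have "infnorm x \<in> (\<lambda>i. \<bar>x \<bullet> i\<bar>) ` Basis"
    unfolding infnorm_Max by (intro Max_in) auto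
  then show ?thesis using that by auto
qed

text \<open>Where \<open>infnorm (p x)\<close> is at least \<open>\<rho>\<close>, some component is
  beyond the step and its row in the determinant is zero.\<close>

lemma poly_degree_restrict:
  fixes p :: "'a::euclidean_space \<Rightarrow> 'a"
  assumes "polynomial_function p" "\<rho> > 0" "V \<subseteq> U"
    and "\<And>x. x \<in> U - V \<Longrightarrow> \<rho> \<le> infnorm (p x)"
  shows "poly_degree \<rho> U p = poly_degree \<rho> V p"
proof -
  obtain v1 v2 where v:
    "\<And>i e x. i \<in> Basis \<Longrightarrow> e \<in> Basis \<Longrightarrow> deriv (\<lambda>s. smooth_step ((p (x + s *\<^sub>R e) \<bullet> i) / \<rho>)) 0 = v1 i e x"
    "\<And>i e x. i \<in> Basis \<Longrightarrow> e \<in> Basis \<Longrightarrow> \<rho> \<le> \<bar>p x \<bullet> i\<bar> \<Longrightarrow> v1 i e x = 0"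
    by (rule has_C2_poly_step[OF assms(1,2)]) blast
  have "jdet (\<lambda>i e. v1 i e x) = 0" if "x \<in> U - V" for x
  proof -
    obtain i where "i \<in> Basis" "infnorm (p x) = \<bar>p x \<bullet> i\<bar>" by (rule infnorm_attained)
    then show ?thesis using v(2) assms(4)[OF that] by (intro jdet_zero_row[of i]) auto
  qed
  then have "indicator U x * jdet (\<lambda>i e. v1 i e x) = indicator V x * jdet (\<lambda>i e. v1 i e x)" for x
    using assms(3) by (auto simp: indicator_def)
  moreover have "poly_degree \<rho> S p = (LINT x|lborel. indicator S x * jdet (\<lambda>i e. v1 i e x))" for S
    unfolding poly_degree_def by (simp add: v(1) cong: jdet_cong)
  ultimately show ?thesis by (simp only:)
qed

text \<open>Restriction moves both integrals to \<open>U \<inter> V\<close>. There, off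
  \<open>K\<close>, a component that is beyond \<open>\<rho>\<close> with the same sign in both maps
  becomes the same constant under \<open>smooth_step\<close>, which is the boundary condition of
  \<open>jacobian_integral_unique\<close>.\<close>

lemma poly_degree_eq:
  fixes p q :: "'a::euclidean_space \<Rightarrow> 'a"
  assumes "polynomial_function p" "polynomial_function q" "\<rho> > 0"
    and U: "open U" "open V" "compact K" "K \<subseteq> U \<inter> V"
    and p: "\<And>x. x \<in> U - K \<Longrightarrow> \<rho> \<le> infnorm (p x)"
    and q: "\<And>x. x \<in> V - K \<Longrightarrow> \<rho> \<le> infnorm (q x)"
    and pq: "\<And>x. x \<in> U \<inter> V - K \<Longrightarrow>
      \<exists>i\<in>Basis. (\<rho> \<le> p x \<bullet> i \<and> \<rho> \<le> q x \<bullet> i) \<or> (p x \<bullet> i \<le> - \<rho> \<and> q x \<bullet> i \<le> - \<rho>)"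
  shows "poly_degree \<rho> U p = poly_degree \<rho> V q"
proof -
  obtain v1 v2 where v:
    "\<And>i. i \<in> Basis \<Longrightarrow> has_C2 (\<lambda>x. smooth_step ((p x \<bullet> i) / \<rho>)) (v1 i) (v2 i)"
    "\<And>i e x. i \<in> Basis \<Longrightarrow> e \<in> Basis \<Longrightarrow> deriv (\<lambda>s. smooth_step ((p (x + s *\<^sub>R e) \<bullet> i) / \<rho>)) 0 = v1 i e x"
    "\<And>i e x. i \<in> Basis \<Longrightarrow> e \<in> Basis \<Longrightarrow> \<rho> \<le> \<bar>p x \<bullet> i\<bar> \<Longrightarrow> v1 i e x = 0"
    by (rule has_C2_poly_step[OF assms(1,3)]) blast
  obtain w1 w2 where w:
    "\<And>i. i \<in> Basis \<Longrightarrow> has_C2 (\<lambda>x. smooth_step ((q x \<bullet> i) / \<rho>)) (w1 i) (w2 i)"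
    "\<And>i e x. i \<in> Basis \<Longrightarrow> e \<in> Basis \<Longrightarrow> deriv (\<lambda>s. smooth_step ((q (x + s *\<^sub>R e) \<bullet> i) / \<rho>)) 0 = w1 i e x"
    "\<And>i e x. i \<in> Basis \<Longrightarrow> e \<in> Basis \<Longrightarrow> \<rho> \<le> \<bar>q x \<bullet> i\<bar> \<Longrightarrow> w1 i e x = 0"
    by (rule has_C2_poly_step[OF assms(2,3)]) blast
  have "poly_degree \<rho> U p = poly_degree \<rho> (U \<inter> V) p"
    using U p by (intro poly_degree_restrict assms) auto
  also have "\<dots> = poly_degree \<rho> (U \<inter> V) q"
  proof -
    have "(LINT x|lborel. indicator (U \<inter> V) x * jdet (\<lambda>i e. v1 i e x)) =
        (LINT x|lborel. indicator (U \<inter> V) x * jdet (\<lambda>i e. w1 i e x))"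
    proof (rule jacobian_integral_unique[OF v(1) w(1) _ U(3,4)])
      fix x assume "x \<in> U \<inter> V - K"
      then obtain i where i: "i \<in> Basis" "(\<rho> \<le> p x \<bullet> i \<and> \<rho> \<le> q x \<bullet> i) \<or> (p x \<bullet> i \<le> - \<rho> \<and> q x \<bullet> i \<le> - \<rho>)"
        using pq by blast
      then have "smooth_step ((p x \<bullet> i) / \<rho>) = smooth_step ((q x \<bullet> i) / \<rho>)"
        using smooth_step_const(1)[of "(p x \<bullet> i) / \<rho>"] smooth_step_const(2)[of "(p x \<bullet> i) / \<rho>"]
          smooth_step_const(1)[of "(q x \<bullet> i) / \<rho>"] smooth_step_const(2)[of "(q x \<bullet> i) / \<rho>"] assms(3)
        by (auto simp: divide_simps)
      moreover have "\<rho> \<le> \<bar>p x \<bullet> i\<bar>" "\<rho> \<le> \<bar>q x \<bullet> i\<bar>" using i assms(3) by auto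
      ultimately show "\<exists>i\<in>Basis. smooth_step ((p x \<bullet> i) / \<rho>) = smooth_step ((q x \<bullet> i) / \<rho>) \<and>
          (\<forall>e\<in>Basis. v1 i e x = 0 \<and> w1 i e x = 0)"
        using v(3)[OF i(1)] w(3)[OF i(1)] i(1) by blast
    qed (use U in auto)
    then show ?thesis unfolding poly_degree_def by (simp add: v(2) w(2) cong: jdet_cong)
  qed
  also have "\<dots> = poly_degree \<rho> V q"
    using U q by (intro poly_degree_restrict[symmetric] assms) auto
  finally show ?thesis .
qed

lemma infnorm_diff_le:
  fixes x y :: "'a::euclidean_space"
  shows "infnorm x - norm (x - y) \<le> infnorm y"
proof -
  have "infnorm x \<le> infnorm (x - y) + infnorm y" using infnorm_triangle[of "x - y" y] by simp
  then show ?thesis using infnorm_le_norm[of "x - y"] by linarith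
qed

text \<open>Each passage in the chain \<open>p\<close>, \<open>f\<close>, \<open>g\<close>,
  \<open>q\<close> costs at most \<open>\<rho> / 4\<close>. A component of \<open>f\<close> of size
  at least \<open>2 * \<rho>\<close> thus keeps its sign, and a size of at least
  \<open>\<rho>\<close>, in \<open>p\<close> and in \<open>q\<close>.\<close>

lemma poly_degree_close:
  fixes p q f g :: "'a::euclidean_space \<Rightarrow> 'a"
  assumes "polynomial_function p" "polynomial_function q" "\<rho> > 0"
    and U: "open U" "open V" "compact K" "K \<subseteq> U \<inter> V"
    and f: "\<And>x. x \<in> U - K \<Longrightarrow> 2 * \<rho> \<le> infnorm (f x)"
    and g: "\<And>x. x \<in> V - K \<Longrightarrow> 2 * \<rho> \<le> infnorm (g x)"
    and fg: "\<And>x. x \<in> U \<inter> V \<Longrightarrow> norm (f x - g x) \<le> \<rho> / 4"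
    and fp: "\<And>x. x \<in> U \<Longrightarrow> norm (f x - p x) \<le> \<rho> / 4"
    and gq: "\<And>x. x \<in> V \<Longrightarrow> norm (g x - q x) \<le> \<rho> / 4"
  shows "poly_degree \<rho> U p = poly_degree \<rho> V q"
proof (rule poly_degree_eq[OF assms(1-3) U])
  show "\<rho> \<le> infnorm (p x)" if "x \<in> U - K" for x
    using infnorm_diff_le[of "f x" "p x"] f[OF that] fp[of x] that assms(3) by auto
  show "\<rho> \<le> infnorm (q x)" if "x \<in> V - K" for x
    using infnorm_diff_le[of "g x" "q x"] g[OF that] gq[of x] that assms(3) by auto
  fix x assume x: "x \<in> U \<inter> V - K"
  obtain i where i: "i \<in> Basis" "infnorm (f x) = \<bar>f x \<bullet> i\<bar>" by (rule infnorm_attained)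
  have "\<bar>f x \<bullet> i\<bar> \<ge> 2 * \<rho>" using f[of x] x i by auto
  moreover have "\<bar>f x \<bullet> i - p x \<bullet> i\<bar> \<le> \<rho> / 4"
    using Basis_le_norm[OF i(1), of "f x - p x"] fp[of x] x by (simp add: inner_diff_left)
  moreover have "\<bar>f x \<bullet> i - g x \<bullet> i\<bar> \<le> \<rho> / 4"
    using Basis_le_norm[OF i(1), of "f x - g x"] fg[of x] x by (simp add: inner_diff_left)
  moreover have "\<bar>g x \<bullet> i - q x \<bullet> i\<bar> \<le> \<rho> / 4"
    using Basis_le_norm[OF i(1), of "g x - q x"] gq[of x] x by (simp add: inner_diff_left)
  ultimately have "(\<rho> \<le> p x \<bullet> i \<and> \<rho> \<le> q x \<bullet> i) \<or> (p x \<bullet> i \<le> - \<rho> \<and> q x \<bullet> i \<le> - \<rho>)"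
    using assms(3) by linarith
  then show "\<exists>i\<in>Basis. (\<rho> \<le> p x \<bullet> i \<and> \<rho> \<le> q x \<bullet> i) \<or> (p x \<bullet> i \<le> - \<rho> \<and> q x \<bullet> i \<le> - \<rho>)"
    using i by blast
qed

lemma cube_degree_approx:
  fixes f :: "'a::euclidean_space \<Rightarrow> 'a"
  assumes "\<rho> > 0" "bounded U" "continuous_on (closure U) f"
  obtains p where "polynomial_function p" "\<And>x. x \<in> closure U \<Longrightarrow> norm (f x - p x) < \<rho> / 4"
    "cube_degree \<rho> U f = poly_degree \<rho> U p"
proof -
  have "\<exists>p. polynomial_function p \<and> (\<forall>x\<in>closure U. norm (f x - p x) < \<rho> / 4)"
    using assms by (intro Stone_Weierstrass_polynomial_function) auto
  then have "polynomial_function (SOME p. polynomial_function p \<and> (\<forall>x\<in>closure U. norm (f x - p x) < \<rho> / 4)) \<and>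
    (\<forall>x\<in>closure U. norm (f x - (SOME p. polynomial_function p \<and> (\<forall>x\<in>closure U. norm (f x - p x) < \<rho> / 4)) x) < \<rho> / 4)"
    by (rule someI_ex)
  then show ?thesis by (intro that[OF _ _ cube_degree_def]) auto
qed

text \<open>The polynomials picked for \<open>f\<close> on \<open>U\<close> and for \<open>g\<close>
  on \<open>V\<close> are unrelated, but their errors below \<open>\<rho> / 4\<close> fit
  \<open>poly_degree_close\<close>. Homotopy invariance and excision are reduced to this
  comparison.\<close>

lemma cube_degree_eq:
  fixes f g :: "'a::euclidean_space \<Rightarrow> 'a"
  assumes "\<rho> > 0" "open U" "bounded U" "open V" "bounded V"
    "continuous_on (closure U) f" "continuous_on (closure V) g"
    and K: "compact K" "K \<subseteq> U \<inter> V"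
    and f: "\<And>x. x \<in> U - K \<Longrightarrow> 2 * \<rho> \<le> infnorm (f x)"
    and g: "\<And>x. x \<in> V - K \<Longrightarrow> 2 * \<rho> \<le> infnorm (g x)"
    and fg: "\<And>x. x \<in> U \<inter> V \<Longrightarrow> norm (f x - g x) \<le> \<rho> / 4"
  shows "cube_degree \<rho> U f = cube_degree \<rho> V g"
proof -
  obtain p where p: "polynomial_function p" "\<And>x. x \<in> closure U \<Longrightarrow> norm (f x - p x) < \<rho> / 4"
    "cube_degree \<rho> U f = poly_degree \<rho> U p"
    using cube_degree_approx[of \<rho> U f] assms by metis
  obtain q where q: "polynomial_function q" "\<And>x. x \<in> closure V \<Longrightarrow> norm (g x - q x) < \<rho> / 4"
    "cube_degree \<rho> V g = poly_degree \<rho> V q"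
    using cube_degree_approx[of \<rho> V g] assms by metis
  have "poly_degree \<rho> U p = poly_degree \<rho> V q"
    by (rule poly_degree_close[OF p(1) q(1) assms(1,2,4) K f g fg])
      (use p(2) q(2) closure_subset in \<open>auto intro!: less_imp_le\<close>)
  then show ?thesis using p q by simp
qed

section \<open>Homotopy invariance, excision and additivity\<close>

lemma infnorm_pos_lower_bound:
  fixes f :: "'b::metric_space \<Rightarrow> 'a::euclidean_space"
  assumes "compact B" "continuous_on B f" "\<And>x. x \<in> B \<Longrightarrow> f x \<noteq> 0"
  obtains m where "m > 0" "\<And>x. x \<in> B \<Longrightarrow> m \<le> infnorm (f x)"
proof (cases "B = {}")
  case False
  have "continuous_on B (\<lambda>x. infnorm (f x))" by (intro continuous_on_infnorm assms)
  then obtain x where x: "x \<in> B" "\<forall>y\<in>B. infnorm (f x) \<le> infnorm (f y)"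
    using continuous_attains_inf[OF assms(1) False] by blast
  then show ?thesis using assms(3)[of x] that[of "infnorm (f x)"] infnorm_pos_lt by blast
qed (use that[of 1] in auto)

text \<open>\<open>m\<close> will bound a map from below on a compact set where it has no zero. The
  degree behaves well once the cube of radius \<open>2 * \<rho>\<close> misses these values, so its
  properties are phrased along \<open>at_right 0\<close>.\<close>

lemma eventually_small_cube:
  assumes "m > 0" "\<And>\<rho>. \<rho> > 0 \<Longrightarrow> 2 * \<rho> < m \<Longrightarrow> P \<rho>"
  shows "\<forall>\<^sub>F \<rho> in at_right (0::real). P \<rho>"
  using assms by (auto simp: eventually_at_right_field intro!: exI[of _ "m / 2"])

text \<open>The slices of \<open>W\<close> may vary with the parameter, as the solution classes in
  \<open>extra_periodic_datum\<close> do. The near-zeros form a compact subset of \<open>W\<close>,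
  hence persist in \<open>W\<close> for a short time, which makes the degree locally constant on a
  connected interval.\<close>

theorem cube_degree_homotopy:
  fixes f :: "'a::euclidean_space \<times> real \<Rightarrow> 'a"
  assumes W: "open W" "bounded W"
    and contf: "continuous_on (closure W \<inter> UNIV \<times> {0..1}) f"
    and nz: "\<And>z. z \<in> closure W \<inter> UNIV \<times> {0..1} \<Longrightarrow> f z = 0 \<Longrightarrow> z \<in> W"
  shows "\<forall>\<^sub>F \<rho> in at_right 0.
    cube_degree \<rho> {x. (x, 0) \<in> W} (\<lambda>x. f (x, 0)) = cube_degree \<rho> {x. (x, 1) \<in> W} (\<lambda>x. f (x, 1))"
proof -
  define C where "C = closure W \<inter> UNIV \<times> {0..1::real}"
  have "closed (UNIV \<times> {0..1::real} :: ('a \<times> real) set)" by (intro closed_Times) auto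
  then have C: "compact C" unfolding C_def using W(2) by (intro compact_Int_closed) auto
  have contC: "continuous_on C f" using contf C_def by simp
  have "compact (C - W)" using C W(1) by (simp add: compact_diff)
  then obtain m where m: "m > 0" "\<And>z. z \<in> C - W \<Longrightarrow> m \<le> infnorm (f z)"
    using infnorm_pos_lower_bound[of "C - W" f] contC nz continuous_on_subset[of C f "C - W"]
    unfolding C_def by blast
  show ?thesis
  proof (rule eventually_small_cube[OF m(1)])
    fix \<rho> :: real assume \<rho>: "\<rho> > 0" "2 * \<rho> < m"
    define A where "A = {z \<in> C. infnorm (f z) \<le> 2 * \<rho>}"
    have AW: "A \<subseteq> W" using m(2) \<rho> by (force simp: A_def)
    have "closed A" unfolding A_def
      using C contC by (intro continuous_on_closed_Collect_le continuous_on_infnorm) (auto simp: compact_imp_closed)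
    then have A: "compact A" using C by (metis (no_types, lifting) A_def compact_Int_closed inf.absorb2 mem_Collect_eq subsetI)
    \<comment> \<open>\<open>e1\<close> keeps a near-zero inside \<open>W\<close> when only its
      parameter moves; \<open>e2\<close> below keeps the change of \<open>f\<close> under the
      tolerance \<open>\<rho> / 4\<close>.\<close>
    obtain e1 where e1: "e1 > 0" "\<And>a b. a \<in> A \<Longrightarrow> dist a b < e1 \<Longrightarrow> b \<in> W"
    proof (cases "A = {} \<or> - W = {}")
      case True
      then show ?thesis using that[of 1] AW by auto
    next
      case False
      have "0 < setdist A (- W)"
        using A W(1) AW False by (subst setdist_gt_0_compact_closed) auto
      moreover have "b \<in> W" if "a \<in> A" "dist a b < setdist A (- W)" for a b
        using setdist_le_dist[of a A b "- W"] that by force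
      ultimately show ?thesis using that by blast
    qed
    have "uniformly_continuous_on C f" by (rule compact_uniformly_continuous[OF contC C])
    then obtain e2 where e2: "e2 > 0" "\<And>a b. a \<in> C \<Longrightarrow> b \<in> C \<Longrightarrow> dist a b < e2 \<Longrightarrow> dist (f a) (f b) < \<rho> / 4"
      unfolding uniformly_continuous_on_def using \<rho> by (metis dist_commute divide_pos_pos zero_less_numeral)
    define S where "S t = {x. (x, t) \<in> W}" for t
    have inC: "(x, t) \<in> C" if "x \<in> closure (S t)" "t \<in> {0..1}" for x t
    proof -
      have "closure (S t) \<subseteq> (\<lambda>x. (x, t)) -` closure W"
        by (rule closure_minimal)
          (use closure_subset in \<open>auto simp: S_def intro!: closed_vimage continuous_intros\<close>)
      then show ?thesis using that by (auto simp: C_def)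
    qed
    have oS: "open (S t)" for t
    proof -
      have "S t = (\<lambda>x. (x, t)) -` W" by (auto simp: S_def)
      then show ?thesis using W(1) by (simp add: open_vimage continuous_intros)
    qed
    have bS: "bounded (S t)" for t
    proof -
      have "S t \<subseteq> fst ` W" by (force simp: S_def)
      then show ?thesis using W(2) bounded_fst bounded_subset by blast
    qed
    have cS: "continuous_on (closure (S t)) (\<lambda>x. f (x, t))" if "t \<in> {0..1}" for t
      by (rule continuous_on_compose2[OF contC]) (use inC that in \<open>auto intro!: continuous_intros\<close>)
    have loc: "cube_degree \<rho> (S t) (\<lambda>x. f (x, t)) = cube_degree \<rho> (S t') (\<lambda>x. f (x, t'))"
      if t: "t \<in> {0..1}" "t' \<in> {0..1}" "dist t t' < min e1 e2" for t t'
    proof -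
      \<comment> \<open>The near-zeros at the two times, projected to space; by the choice of
        \<open>e1\<close> all of them lie in both slices.\<close>
      define K where "K = fst ` (A \<inter> UNIV \<times> {t, t'})"
      have "compact K" unfolding K_def
        by (rule compact_continuous_image[OF _ compact_Int_closed[OF A]])
          (auto intro!: continuous_intros closed_Times)
      have dst: "dist (x, s) (x, s') < min e1 e2" if "s \<in> {t, t'}" "s' \<in> {t, t'}" for x :: 'a and s s'
        using that t(3) e1(1) e2(1) by (auto simp: dist_Pair_Pair dist_commute)
      have "K \<subseteq> S t \<inter> S t'"
      proof
        fix x assume "x \<in> K"
        then obtain s where s: "(x, s) \<in> A" "s \<in> {t, t'}" by (force simp: K_def)
        have "(x, s') \<in> W" if "s' \<in> {t, t'}" for s'
          using e1(2)[OF s(1)] dst[OF s(2) that] by simp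
        then show "x \<in> S t \<inter> S t'" by (simp add: S_def)
      qed
      have far: "2 * \<rho> \<le> infnorm (f (x, s))" if "x \<in> S s - K" "s \<in> {t, t'}" for x s
      proof (rule ccontr)
        assume "\<not> ?thesis"
        then have "(x, s) \<in> A" using that t closure_subset[of "S s"] inC[of x s] by (auto simp: A_def)
        then show False using that by (force simp: K_def)
      qed
      show ?thesis
      proof (rule cube_degree_eq[OF \<rho>(1) oS bS oS bS cS[OF t(1)] cS[OF t(2)] \<open>compact K\<close> \<open>K \<subseteq> S t \<inter> S t'\<close>])
        show "2 * \<rho> \<le> infnorm (f (x, t))" if "x \<in> S t - K" for x using far[OF that] by simp
        show "2 * \<rho> \<le> infnorm (f (x, t'))" if "x \<in> S t' - K" for x using far[OF that] by simp
        show "norm (f (x, t) - f (x, t')) \<le> \<rho> / 4" if "x \<in> S t \<inter> S t'" for x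
        proof -
          have "(x, t) \<in> C" "(x, t') \<in> C"
            using that t(1,2) inC subsetD[OF closure_subset, of x "S t"] subsetD[OF closure_subset, of x "S t'"] by simp_all
          then show ?thesis using e2(2)[of "(x, t)" "(x, t')"] dst[of t t' x] by (simp add: dist_norm)
        qed
      qed
    qed
    have "cube_degree \<rho> (S 0) (\<lambda>x. f (x, 0)) = cube_degree \<rho> (S 1) (\<lambda>x. f (x, 1))"
    proof (rule connected_local_const[of "{0..1::real}" 0 1 "\<lambda>t. cube_degree \<rho> (S t) (\<lambda>x. f (x, t))"])
      show "\<forall>t\<in>{0..1}. \<forall>\<^sub>F t' in at t within {0..1}.
        cube_degree \<rho> (S t) (\<lambda>x. f (x, t)) = cube_degree \<rho> (S t') (\<lambda>x. f (x, t'))"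
      proof
        fix t :: real assume t: "t \<in> {0..1}"
        have "\<forall>\<^sub>F t' in at t within {0..1}. t' \<in> {0..1} \<and> dist t t' < min e1 e2"
          unfolding eventually_at using e1(1) e2(1)
          by (intro exI[of _ "min e1 e2"]) (auto simp: dist_commute)
        then show "\<forall>\<^sub>F t' in at t within {0..1}.
          cube_degree \<rho> (S t) (\<lambda>x. f (x, t)) = cube_degree \<rho> (S t') (\<lambda>x. f (x, t'))"
          by (rule eventually_mono) (use loc t in blast)
      qed
    qed simp_all
    then show "cube_degree \<rho> {x. (x, 0) \<in> W} (\<lambda>x. f (x, 0)) = cube_degree \<rho> {x. (x, 1) \<in> W} (\<lambda>x. f (x, 1))"
      by (simp add: S_def)
  qed
qed

corollary cube_degree_homotopy_cylinder:
  fixes f :: "'a::euclidean_space \<Rightarrow> real \<Rightarrow> 'a"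
  assumes U: "open U" "bounded U"
    and contf: "continuous_on (closure U \<times> {0..1}) (\<lambda>(x, t). f x t)"
    and nz: "\<And>x t. x \<in> closure U \<Longrightarrow> t \<in> {0..1} \<Longrightarrow> f x t = 0 \<Longrightarrow> x \<in> U"
  shows "\<forall>\<^sub>F \<rho> in at_right 0. cube_degree \<rho> U (\<lambda>x. f x 0) = cube_degree \<rho> U (\<lambda>x. f x 1)"
proof -
  let ?W = "U \<times> {-1<..<2::real}"
  have cl: "closure ?W \<inter> UNIV \<times> {0..1} = closure U \<times> {0..1}"
    by (auto simp: closure_Times)
  have "\<forall>\<^sub>F \<rho> in at_right 0. cube_degree \<rho> {x. (x, 0) \<in> ?W} (\<lambda>x. case (x, 0) of (x, t) \<Rightarrow> f x t) =
     cube_degree \<rho> {x. (x, 1) \<in> ?W} (\<lambda>x. case (x, 1) of (x, t) \<Rightarrow> f x t)"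
    by (rule cube_degree_homotopy) (use U contf nz in \<open>auto simp: cl open_Times bounded_Times\<close>)
  then show ?thesis by simp
qed

text \<open>The near-zeros of \<open>f\<close> in both closures are trapped in
  \<open>U \<inter> V\<close> and serve as the common compact set of
  \<open>cube_degree_eq\<close>.\<close>

lemma cube_degree_excision:
  fixes f :: "'a::euclidean_space \<Rightarrow> 'a"
  assumes U: "open U" "bounded U" "open V" "bounded V"
    and contf: "continuous_on (closure U) f" "continuous_on (closure V) f"
    and nz: "\<And>x. x \<in> closure U \<union> closure V \<Longrightarrow> f x = 0 \<Longrightarrow> x \<in> U \<inter> V"
  shows "\<forall>\<^sub>F \<rho> in at_right 0. cube_degree \<rho> U f = cube_degree \<rho> V f"
proof -
  define C where "C = closure U \<union> closure V"
  have C: "compact C" "continuous_on C f"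
    using U contf by (auto simp: C_def intro: continuous_on_closed_Un)
  have "compact (C - U \<inter> V)" using C U by (simp add: compact_diff open_Int)
  moreover have "continuous_on (C - U \<inter> V) f" using C(2) by (rule continuous_on_subset) auto
  moreover have "f x \<noteq> 0" if "x \<in> C - U \<inter> V" for x using that nz[of x] by (auto simp: C_def)
  ultimately obtain m where m: "m > 0" "\<And>x. x \<in> C - U \<inter> V \<Longrightarrow> m \<le> infnorm (f x)"
    by (rule infnorm_pos_lower_bound) blast+
  show ?thesis
  proof (rule eventually_small_cube[OF m(1)])
    fix \<rho> :: real assume \<rho>: "\<rho> > 0" "2 * \<rho> < m"
    let ?K = "{x \<in> C. infnorm (f x) \<le> 2 * \<rho>}"
    have "closed ?K"
      using C by (intro continuous_on_closed_Collect_le continuous_on_infnorm) (auto simp: compact_imp_closed)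
    then have K: "compact ?K" using C by (metis (no_types, lifting) compact_Int_closed inf.absorb2 mem_Collect_eq subsetI)
    have "?K \<subseteq> U \<inter> V" using m(2) \<rho> by force
    then show "cube_degree \<rho> U f = cube_degree \<rho> V f"
      using U contf \<rho> closure_subset[of U] closure_subset[of V]
      by (intro cube_degree_eq[OF _ _ _ _ _ _ _ K]) (auto simp: C_def)
  qed
qed

lemma poly_degree_integrable:
  fixes p :: "'a::euclidean_space \<Rightarrow> 'a"
  assumes "polynomial_function p" "\<rho> > 0" "open U" "compact K" "K \<subseteq> U"
    and "\<And>x. x \<in> U - K \<Longrightarrow> \<rho> \<le> infnorm (p x)"
  shows "integrable lborel (\<lambda>x. indicator U x *
     jdet (\<lambda>i e. deriv (\<lambda>s. smooth_step ((p (x + s *\<^sub>R e) \<bullet> i) / \<rho>)) 0))"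
proof -
  obtain v1 v2 where v:
    "\<And>i. i \<in> Basis \<Longrightarrow> has_C2 (\<lambda>x. smooth_step ((p x \<bullet> i) / \<rho>)) (v1 i) (v2 i)"
    "\<And>i e x. i \<in> Basis \<Longrightarrow> e \<in> Basis \<Longrightarrow> deriv (\<lambda>s. smooth_step ((p (x + s *\<^sub>R e) \<bullet> i) / \<rho>)) 0 = v1 i e x"
    "\<And>i e x. i \<in> Basis \<Longrightarrow> e \<in> Basis \<Longrightarrow> \<rho> \<le> \<bar>p x \<bullet> i\<bar> \<Longrightarrow> v1 i e x = 0"
    by (rule has_C2_poly_step[OF assms(1,2)]) blast
  have J0: "jdet (\<lambda>i e. v1 i e x) = 0" if "x \<in> U - K" for x
  proof -
    obtain i where "i \<in> Basis" "infnorm (p x) = \<bar>p x \<bullet> i\<bar>" by (rule infnorm_attained)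
    then show ?thesis using v(3) assms(6)[OF that] by (intro jdet_zero_row[of i]) auto
  qed
  have "integrable lborel (\<lambda>x. indicator U x * jdet (\<lambda>i e. v1 i e x))"
  proof (rule integrable_continuous_bounded_support)
    show "continuous_on UNIV (\<lambda>x. indicator U x * jdet (\<lambda>i e. v1 i e x))"
      using v(1) by (intro cutoff_continuous[OF continuous_jdet assms(3-5) J0]) (auto simp: has_C2_def)
    show "bounded {x. indicator U x * jdet (\<lambda>i e. v1 i e x) \<noteq> 0}"
      by (rule bounded_subset[OF compact_imp_bounded[OF assms(4)]])
        (use J0 in \<open>auto simp: indicator_def split: if_splits\<close>)
  qed
  then show ?thesis by (simp add: v(2) cong: jdet_cong)
qed

lemma closure_finite_UN:
  assumes "finite I"
  shows "closure (\<Union>i\<in>I. U i) = (\<Union>i\<in>I. closure (U i))"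
  using assms by induction simp_all

text \<open>The integral is additive over disjoint sets, but each \<open>cube_degree\<close> comes
  with its own polynomial. All of them are first compared with a single polynomial that is close to
  \<open>f\<close> on the closure of the union.\<close>

lemma cube_degree_additive:
  fixes f :: "'a::euclidean_space \<Rightarrow> 'a"
  assumes I: "finite I" "disjoint_family_on U I"
    and U: "\<And>i. i \<in> I \<Longrightarrow> open (U i)" "\<And>i. i \<in> I \<Longrightarrow> bounded (U i)"
    and contf: "\<And>i. i \<in> I \<Longrightarrow> continuous_on (closure (U i)) f"
    and nz: "\<And>i x. i \<in> I \<Longrightarrow> x \<in> closure (U i) \<Longrightarrow> f x = 0 \<Longrightarrow> x \<in> U i"
  shows "\<forall>\<^sub>F \<rho> in at_right 0. cube_degree \<rho> (\<Union>i\<in>I. U i) f = (\<Sum>i\<in>I. cube_degree \<rho> (U i) f)"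
proof -
  define V where "V = (\<Union>i\<in>I. U i)"
  have clV: "closure V = (\<Union>i\<in>I. closure (U i))"
    unfolding V_def using I(1) by (rule closure_finite_UN)
  have V: "open V" "bounded V" "continuous_on (closure V) f"
    using I U contf by (auto simp: V_def clV[unfolded V_def] intro: continuous_on_closed_Union)
  define B where "B = (\<Union>i\<in>I. closure (U i) - U i)"
  have "compact B" unfolding B_def using I(1) U by (intro compact_UN compact_diff) auto
  moreover have "continuous_on B f" using V(3) by (rule continuous_on_subset) (auto simp: B_def clV)
  moreover have "f x \<noteq> 0" if "x \<in> B" for x using that nz by (auto simp: B_def)
  ultimately obtain m where m: "m > 0" "\<And>x. x \<in> B \<Longrightarrow> m \<le> infnorm (f x)"
    by (rule infnorm_pos_lower_bound) blast+
  show ?thesis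
  proof (rule eventually_small_cube[OF m(1)])
    fix \<rho> :: real assume \<rho>: "\<rho> > 0" "2 * \<rho> < m"
    obtain p where p: "polynomial_function p" "\<And>x. x \<in> closure V \<Longrightarrow> norm (f x - p x) < \<rho> / 4"
      "cube_degree \<rho> V f = poly_degree \<rho> V p"
      using cube_degree_approx[OF \<rho>(1) V(2,3)] by metis
    define K where "K i = {x \<in> closure (U i). infnorm (f x) \<le> 2 * \<rho>}" for i
    have K: "compact (K i)" "K i \<subseteq> U i" if "i \<in> I" for i
    proof -
      have "closed (K i)" unfolding K_def
        using contf[OF that] by (intro continuous_on_closed_Collect_le continuous_on_infnorm) auto
      then show "compact (K i)"
        using U(2)[OF that] bounded_subset[of "closure (U i)" "K i"] by (auto simp: K_def compact_eq_bounded_closed)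
      show "K i \<subseteq> U i" using m(2) \<rho> that by (force simp: K_def B_def)
    qed
    have far: "2 * \<rho> \<le> infnorm (f x)" if "i \<in> I" "x \<in> U i - K i" for i x
      using that closure_subset[of "U i"] by (auto simp: K_def)
    have fp: "norm (f x - p x) \<le> \<rho> / 4" if "i \<in> I" "x \<in> U i" for i x
      using p(2)[of x] that closure_subset[of V] by (force simp: V_def)
    have eq: "cube_degree \<rho> (U i) f = poly_degree \<rho> (U i) p" if i: "i \<in> I" for i
    proof -
      obtain q where q: "polynomial_function q" "\<And>x. x \<in> closure (U i) \<Longrightarrow> norm (f x - q x) < \<rho> / 4"
        "cube_degree \<rho> (U i) f = poly_degree \<rho> (U i) q"
        using cube_degree_approx[OF \<rho>(1) U(2)[OF i] contf[OF i]] by metis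
      have "poly_degree \<rho> (U i) q = poly_degree \<rho> (U i) p"
      proof (rule poly_degree_close[OF q(1) p(1) \<rho>(1) U(1)[OF i] U(1)[OF i] K(1)[OF i], of f f])
        show "norm (f x - q x) \<le> \<rho> / 4" if "x \<in> U i" for x
          using q(2)[of x] closure_subset[of "U i"] that by force
      qed (use K i far fp \<rho> in auto)
      then show ?thesis using q(3) by simp
    qed
    let ?J = "\<lambda>x. jdet (\<lambda>i e. deriv (\<lambda>s. smooth_step ((p (x + s *\<^sub>R e) \<bullet> i) / \<rho>)) 0)"
    have int: "integrable lborel (\<lambda>x. indicator (U i) x * ?J x)" if "i \<in> I" for i
    proof (rule poly_degree_integrable[OF p(1) \<rho>(1) U(1) K])
      show "\<rho> \<le> infnorm (p x)" if "x \<in> U i - K i" for x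
        using infnorm_diff_le[of "f x" "p x"] far[of i x] fp[of i x] that \<open>i \<in> I\<close> \<rho> by auto
    qed (use that in auto)
    have ind: "indicator V x = (\<Sum>i\<in>I. indicator (U i) x :: real)" for x
      unfolding V_def using I by (intro indicator_UN_disjoint)
    have "poly_degree \<rho> V p = (LINT x|lborel. (\<Sum>i\<in>I. indicator (U i) x * ?J x))"
      unfolding poly_degree_def ind sum_distrib_right ..
    also have "\<dots> = (\<Sum>i\<in>I. poly_degree \<rho> (U i) p)"
      unfolding poly_degree_def using int by (intro Bochner_Integration.integral_sum) auto
    finally show "cube_degree \<rho> (\<Union>i\<in>I. U i) f = (\<Sum>i\<in>I. cube_degree \<rho> (U i) f)"
      using p(3) eq by (simp add: V_def)
  qed
qed

text \<open>The mass of the product bump. It is the value of the degree integral for a translation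
  and stands for degree 1; the type argument carries the dimension.\<close>

definition unit_degree :: "'a::euclidean_space itself \<Rightarrow> real \<Rightarrow> real" where
  "unit_degree _ \<rho> = (LINT x::'a|lborel. (\<Prod>i\<in>Basis. bump ((x \<bullet> i) / \<rho>) / \<rho>))"

lemma unit_degree_integrand:
  assumes "\<rho> > 0"
  shows "continuous_on UNIV (\<lambda>x::'a::euclidean_space. \<Prod>i\<in>Basis. bump ((x \<bullet> i) / \<rho>) / \<rho>)"
    and "infnorm (x::'a) \<ge> \<rho> \<Longrightarrow> (\<Prod>i\<in>Basis. bump ((x \<bullet> i) / \<rho>) / \<rho>) = 0"
    and "bounded {x::'a. (\<Prod>i\<in>Basis. bump ((x \<bullet> i) / \<rho>) / \<rho>) \<noteq> 0}"
proof -
  show "continuous_on UNIV (\<lambda>x::'a. \<Prod>i\<in>Basis. bump ((x \<bullet> i) / \<rho>) / \<rho>)"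
    using assms by (intro continuous_intros) auto
  have *: "(\<Prod>i\<in>Basis. bump ((x \<bullet> i) / \<rho>) / \<rho>) = 0" if "infnorm x \<ge> \<rho>" for x :: 'a
  proof -
    obtain i where i: "i \<in> Basis" "infnorm x = \<bar>x \<bullet> i\<bar>" by (rule infnorm_attained)
    then have "bump ((x \<bullet> i) / \<rho>) = 0" using that assms by (intro bump_outside) auto
    then show ?thesis using i(1) by (intro prod_zero) auto
  qed
  then show "infnorm (x::'a) \<ge> \<rho> \<Longrightarrow> (\<Prod>i\<in>Basis. bump ((x \<bullet> i) / \<rho>) / \<rho>) = 0" .
  have "norm x \<le> sqrt DIM('a) * \<rho>" if "(\<Prod>i\<in>Basis. bump ((x \<bullet> i) / \<rho>) / \<rho>) \<noteq> 0" for x :: 'a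
  proof -
    have "infnorm x \<le> \<rho>" using *[of x] that by force
    then have "sqrt DIM('a) * infnorm x \<le> sqrt DIM('a) * \<rho>" by (intro mult_left_mono) auto
    then show ?thesis using norm_le_infnorm[of x] by linarith
  qed
  then show "bounded {x::'a. (\<Prod>i\<in>Basis. bump ((x \<bullet> i) / \<rho>) / \<rho>) \<noteq> 0}"
    by (auto simp: bounded_iff)
qed

text \<open>The integrand is continuous, nonnegative and positive at 0, so its nonzero set is open
  and nonempty, hence not negligible.\<close>

lemma unit_degree_pos:
  assumes "\<rho> > 0"
  shows "unit_degree TYPE('a::euclidean_space) \<rho> > 0"
proof -
  let ?f = "\<lambda>x::'a. \<Prod>i\<in>Basis. bump ((x \<bullet> i) / \<rho>) / \<rho>"
  have nn: "?f x \<ge> 0" for x using assms by (intro prod_nonneg) (simp add: bump_nonneg)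
  have int: "integrable lborel ?f"
    by (rule integrable_continuous_bounded_support) (use unit_degree_integrand[OF assms] in auto)
  have "(LINT x|lborel. ?f x) \<noteq> 0"
  proof
    assume "(LINT x|lborel. ?f x) = 0"
    then have "AE x in lborel. ?f x = 0"
      using integral_nonneg_eq_0_iff_AE[OF int] nn by auto
    then have "AE x in lebesgue. \<not> ?f x \<noteq> 0"
      by (auto intro: AE_completion)
    then have "negligible {x. ?f x \<noteq> 0}"
      by (subst negligible_iff_null_sets) (auto simp: AE_iff_null_sets eventually_ae_filter intro: null_sets_completion_subset)
    moreover have "open {x. ?f x \<noteq> 0}"
      by (rule open_Collect_neq) (use unit_degree_integrand(1)[OF assms] in auto)
    moreover have "0 \<in> {x. ?f x \<noteq> 0}" using assms by (simp add: bump_0)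
    ultimately show False using open_not_negligible by blast
  qed
  moreover have "(LINT x|lborel. ?f x) \<ge> 0" using nn by simp
  ultimately show ?thesis unfolding unit_degree_def by simp
qed

lemma jdet_diagonal:
  assumes "\<And>i e. i \<in> Basis \<Longrightarrow> e \<in> Basis \<Longrightarrow> i \<noteq> e \<Longrightarrow> D i e = 0"
  shows "jdet D = (\<Prod>i\<in>Basis. D i i)"
proof -
  have "(\<Prod>i\<in>Basis. D i (\<sigma> i)) = 0" if \<sigma>: "\<sigma> permutes Basis" "\<sigma> \<noteq> id" for \<sigma>
  proof -
    obtain i where "\<sigma> i \<noteq> i" using \<sigma>(2) by (auto simp: fun_eq_iff)
    moreover have "i \<in> Basis" using \<sigma>(1) calculation by (auto simp: permutes_def)
    ultimately show ?thesis using \<sigma>(1) assms[of i "\<sigma> i"]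
      by (intro prod_zero) (auto simp: permutes_in_image intro!: bexI[of _ i])
  qed
  then have "jdet D = (\<Sum>\<sigma>\<in>{id}. of_int (sign \<sigma>) * (\<Prod>i\<in>Basis. D i (\<sigma> i)))"
    unfolding jdet_def
    by (intro sum.mono_neutral_right) (auto simp: finite_permutations permutes_id)
  then show ?thesis by (simp add: sign_id)
qed

text \<open>The map is a polynomial with diagonal Jacobian, and for small \<open>\<rho>\<close> the
  cube around \<open>a\<close> that carries the bump lies inside \<open>U\<close>; the integral is
  then that of a translated bump over the whole space.\<close>

lemma cube_degree_translation:
  fixes a :: "'a::euclidean_space"
  assumes U: "open U" "bounded U" "a \<in> U"
  shows "\<forall>\<^sub>F \<rho> in at_right 0. cube_degree \<rho> U (\<lambda>x. x - a) = unit_degree TYPE('a) \<rho>"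
proof -
  obtain m where m: "m > 0" "\<And>x. x \<in> closure U - U \<Longrightarrow> m \<le> infnorm (x - a)"
    by (rule infnorm_pos_lower_bound[of "closure U - U" "\<lambda>x. x - a"])
      (use U in \<open>auto simp: compact_diff intro!: continuous_intros\<close>)
  obtain r where r: "r > 0" "ball a r \<subseteq> U" using U open_contains_ball by blast
  \<comment> \<open>By \<open>norm_le_infnorm\<close> the cube of half side \<open>d\<close> around
    \<open>a\<close> fits into the ball of radius \<open>r\<close>.\<close>
  define d where "d = r / sqrt DIM('a)"
  have d: "d > 0" using r by (simp add: d_def)
  have inU: "x \<in> U" if "infnorm (x - a) < d" for x
  proof -
    have "norm (x - a) \<le> sqrt DIM('a) * infnorm (x - a)" by (rule norm_le_infnorm)
    also have "\<dots> < sqrt DIM('a) * d" using that by (intro mult_strict_left_mono) auto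
    also have "\<dots> = r" by (simp add: d_def)
    finally show ?thesis using r(2) by (auto simp: subset_iff dist_norm norm_minus_commute)
  qed
  show ?thesis
  proof (rule eventually_small_cube[of "min m d"])
    fix \<rho> :: real assume \<rho>: "\<rho> > 0" "2 * \<rho> < min m d"
    have poly: "polynomial_function (\<lambda>x. x - a)" by auto
    obtain q where q: "polynomial_function q" "\<And>x. x \<in> closure U \<Longrightarrow> norm ((x - a) - q x) < \<rho> / 4"
      "cube_degree \<rho> U (\<lambda>x. x - a) = poly_degree \<rho> U q"
      by (rule cube_degree_approx[of \<rho> U "\<lambda>x. x - a"]) (use \<rho> U in \<open>auto intro!: continuous_intros\<close>)
    let ?K = "{x \<in> closure U. infnorm (x - a) \<le> 2 * \<rho>}"
    have "closed ?K" by (intro continuous_on_closed_Collect_le continuous_on_infnorm continuous_intros) auto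
    then have K: "compact ?K"
      using U(2) bounded_subset[of "closure U" ?K] by (auto simp: compact_eq_bounded_closed)
    have "poly_degree \<rho> U q = poly_degree \<rho> U (\<lambda>x. x - a)"
    proof (rule poly_degree_close[OF q(1) poly \<rho>(1) U(1) U(1) K, of "\<lambda>x. x - a" "\<lambda>x. x - a"])
      show "?K \<subseteq> U \<inter> U" using m(2) \<rho> by force
      show "norm (x - a - q x) \<le> \<rho> / 4" if "x \<in> U" for x
        using q(2)[of x] that closure_subset[of U] by force
    qed (use closure_subset[of U] \<rho> in auto)
    also have "\<dots> = (LINT x|lborel. indicator U x * (\<Prod>i\<in>Basis. bump (((x - a) \<bullet> i) / \<rho>) / \<rho>))"
    proof -
      have D: "deriv (\<lambda>s. smooth_step ((x + s *\<^sub>R e - a) \<bullet> i / \<rho>)) 0 = bump ((x - a) \<bullet> i / \<rho>) * ((e \<bullet> i) / \<rho>)" for x e i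
      proof (rule DERIV_imp_deriv)
        have "((\<lambda>s. (x + s *\<^sub>R e - a) \<bullet> i / \<rho>) has_real_derivative (e \<bullet> i) / \<rho>) (at 0)"
          using \<rho> by (auto simp: inner_simps intro!: derivative_eq_intros)
        from DERIV_chain2[OF DERIV_smooth_step this]
        show "((\<lambda>s. smooth_step ((x + s *\<^sub>R e - a) \<bullet> i / \<rho>)) has_real_derivative bump ((x - a) \<bullet> i / \<rho>) * ((e \<bullet> i) / \<rho>)) (at 0)"
          by simp
      qed
      have "jdet (\<lambda>i e. deriv (\<lambda>s. smooth_step ((x + s *\<^sub>R e - a) \<bullet> i / \<rho>)) 0) =
          (\<Prod>i\<in>Basis. bump (((x - a) \<bullet> i) / \<rho>) / \<rho>)" for x
        unfolding D by (subst jdet_diagonal) (auto simp: inner_Basis intro!: prod.cong)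
      then show ?thesis unfolding poly_degree_def by simp
    qed
    also have "\<dots> = (LINT x|lborel. (\<Prod>i\<in>Basis. bump (((x - a) \<bullet> i) / \<rho>) / \<rho>))"
    proof (rule arg_cong[where f = "integral\<^sup>L lborel"], rule ext)
      fix x
      show "indicator U x * (\<Prod>i\<in>Basis. bump (((x - a) \<bullet> i) / \<rho>) / \<rho>) = (\<Prod>i\<in>Basis. bump (((x - a) \<bullet> i) / \<rho>) / \<rho>)"
      proof (cases "x \<in> U")
        case False
        then have "\<rho> \<le> infnorm (x - a)" using inU[of x] \<rho> by force
        from unit_degree_integrand(2)[OF \<rho>(1) this] show ?thesis using False by simp
      qed simp
    qed
    also have "\<dots> = (LINT x|lborel. (\<Prod>i\<in>Basis. bump (((- a + x) \<bullet> i) / \<rho>) / \<rho>))" by simp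
    also have "\<dots> = unit_degree TYPE('a) \<rho>"
      unfolding unit_degree_def using unit_degree_integrand(1)[OF \<rho>(1)]
      by (intro integral_translation borel_measurable_continuous_onI)
    finally show "cube_degree \<rho> U (\<lambda>x. x - a) = unit_degree TYPE('a) \<rho>" using q(3) by simp
  qed (use m d in auto)
qed

lemma cube_degree_empty: "cube_degree \<rho> {} f = 0"
  by (simp add: cube_degree_def poly_degree_def)

lemma eventually_at_right_contradiction:
  "\<forall>\<^sub>F \<rho> in at_right (0::real). False \<Longrightarrow> False"
  by (simp add: trivial_limit_at_right_real)

text \<open>Without a zero, excision would shrink \<open>U\<close> to the empty set, where the
  degree is 0 and not the positive \<open>unit_degree\<close>.\<close>

lemma cube_degree_zero_exists:
  fixes f :: "'a::euclidean_space \<Rightarrow> 'a"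
  assumes U: "open U" "bounded U" "continuous_on (closure U) f"
    and nz: "\<And>x. x \<in> closure U \<Longrightarrow> f x = 0 \<Longrightarrow> x \<in> U"
    and deg: "\<forall>\<^sub>F \<rho> in at_right 0. cube_degree \<rho> U f = unit_degree TYPE('a) \<rho>"
  shows "\<exists>x\<in>U. f x = 0"
proof (rule ccontr)
  assume no: "\<not> ?thesis"
  have "\<forall>\<^sub>F \<rho> in at_right 0. cube_degree \<rho> U f = cube_degree \<rho> {} f"
    by (rule cube_degree_excision) (use U nz no in auto)
  then have "\<forall>\<^sub>F \<rho> in at_right (0::real). False"
    using deg eventually_at_right_less[of 0]
  proof eventually_elim
    case (elim \<rho>)
    then show ?case using unit_degree_pos[of \<rho>, where 'a = 'a] by (simp add: cube_degree_empty)
  qed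
  then show False by (rule eventually_at_right_contradiction)
qed

text \<open>The slice of \<open>W\<close> at 0 carries no zero, so its degree is 0, and by homotopy
  the slice at 1 has degree 0 as well. If all zeros of the latter lay in the \<open>U i\<close>,
  excision and additivity would give \<open>card I\<close> times the positive
  \<open>unit_degree\<close>.\<close>

theorem cube_degree_extra_zero:
  fixes f :: "'a::euclidean_space \<times> real \<Rightarrow> 'a"
  assumes W: "open W" "bounded W"
    and contf: "continuous_on (UNIV \<times> {0..1}) f"
    and nz: "\<And>z. z \<in> closure W \<inter> UNIV \<times> {0..1} \<Longrightarrow> f z = 0 \<Longrightarrow> z \<in> W"
    and start: "\<And>x. (x, 0) \<in> W \<Longrightarrow> f (x, 0) \<noteq> 0"
    and I: "finite I" "I \<noteq> {}" "disjoint_family_on U I"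
    and U: "\<And>i. i \<in> I \<Longrightarrow> open (U i)" "\<And>i. i \<in> I \<Longrightarrow> bounded (U i)"
    and nzU: "\<And>i x. i \<in> I \<Longrightarrow> x \<in> closure (U i) \<Longrightarrow> f (x, 1) = 0 \<Longrightarrow> x \<in> U i \<and> (x, 1) \<in> W"
    and deg: "\<And>i. i \<in> I \<Longrightarrow> \<forall>\<^sub>F \<rho> in at_right 0. cube_degree \<rho> (U i) (\<lambda>x. f (x, 1)) = unit_degree TYPE('a) \<rho>"
  shows "\<exists>x. (x, 1) \<in> W \<and> f (x, 1) = 0 \<and> x \<notin> (\<Union>i\<in>I. U i)"
proof (rule ccontr)
  assume no: "\<not> ?thesis"
  define S where "S t = {x. (x, t) \<in> W}" for t
  have clS: "(x, t) \<in> closure W" if "x \<in> closure (S t)" for x t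
  proof -
    have "closure (S t) \<subseteq> (\<lambda>x. (x, t)) -` closure W"
      by (rule closure_minimal)
        (use closure_subset in \<open>auto simp: S_def intro!: closed_vimage continuous_intros\<close>)
    then show ?thesis using that by auto
  qed
  have oS: "open (S t)" for t
  proof -
    have "S t = (\<lambda>x. (x, t)) -` W" by (auto simp: S_def)
    then show ?thesis using W(1) by (simp add: open_vimage continuous_intros)
  qed
  have bS: "bounded (S t)" for t
  proof -
    have "S t \<subseteq> fst ` W" by (force simp: S_def)
    then show ?thesis using W(2) bounded_fst bounded_subset by blast
  qed
  have cf: "continuous_on A (\<lambda>x. f (x, t))" if "t \<in> {0..1}" for A t
    by (rule continuous_on_compose2[OF contf]) (use that in \<open>auto intro!: continuous_intros\<close>)
  have nzS: "x \<in> S t" if "x \<in> closure (S t)" "f (x, t) = 0" "t \<in> {0..1}" for x t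
    using nz[of "(x, t)"] clS[OF that(1)] that by (auto simp: S_def)
  have h: "\<forall>\<^sub>F \<rho> in at_right 0. cube_degree \<rho> (S 0) (\<lambda>x. f (x, 0)) = cube_degree \<rho> (S 1) (\<lambda>x. f (x, 1))"
    unfolding S_def
    by (rule cube_degree_homotopy[OF W _ nz]) (use contf continuous_on_subset in blast)
  have e0: "\<forall>\<^sub>F \<rho> in at_right 0. cube_degree \<rho> (S 0) (\<lambda>x. f (x, 0)) = cube_degree \<rho> {} (\<lambda>x. f (x, 0))"
  proof (rule cube_degree_excision[OF oS bS])
    show "x \<in> S 0 \<inter> {}" if "x \<in> closure (S 0) \<union> closure {}" "f (x, 0) = 0" for x
      using nzS[of x 0] start[of x] that by (auto simp: S_def)
  qed (use cf in auto)
  have clU: "closure (\<Union>i\<in>I. U i) = (\<Union>i\<in>I. closure (U i))"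
    using I(1) by (rule closure_finite_UN)
  have e1: "\<forall>\<^sub>F \<rho> in at_right 0. cube_degree \<rho> (S 1) (\<lambda>x. f (x, 1)) = cube_degree \<rho> (\<Union>i\<in>I. U i) (\<lambda>x. f (x, 1))"
  proof (rule cube_degree_excision[OF oS bS])
    show "x \<in> S 1 \<inter> (\<Union>i\<in>I. U i)" if "x \<in> closure (S 1) \<union> closure (\<Union>i\<in>I. U i)" "f (x, 1) = 0" for x
    proof -
      have "x \<in> S 1"
        using that nzS[of x 1] nzU by (auto simp: clU S_def)
      then show ?thesis using no that(2) by (auto simp: S_def)
    qed
  qed (use U I cf in \<open>auto intro: open_UN\<close>)
  have add: "\<forall>\<^sub>F \<rho> in at_right 0. cube_degree \<rho> (\<Union>i\<in>I. U i) (\<lambda>x. f (x, 1)) = (\<Sum>i\<in>I. cube_degree \<rho> (U i) (\<lambda>x. f (x, 1)))"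
    by (rule cube_degree_additive[OF I(1,3) U cf]) (use nzU in auto)
  have "\<forall>\<^sub>F \<rho> in at_right 0. \<forall>i\<in>I. cube_degree \<rho> (U i) (\<lambda>x. f (x, 1)) = unit_degree TYPE('a) \<rho>"
    using I(1) deg by (intro eventually_ball_finite) auto
  then have "\<forall>\<^sub>F \<rho> in at_right (0::real). False"
    using h e0 e1 add eventually_at_right_less[of 0]
  proof eventually_elim
    case (elim \<rho>)
    then have "0 = (\<Sum>i\<in>I. cube_degree \<rho> (U i) (\<lambda>x. f (x, 1)))" by (simp add: cube_degree_empty)
    also have "\<dots> = card I * unit_degree TYPE('a) \<rho>" using elim(1) by simp
    finally show ?case using unit_degree_pos[OF elim(6), where 'a = 'a] I(1,2) by simp
  qed
  then show False by (rule eventually_at_right_contradiction)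
qed

section \<open>Volterra equations and the truncated force\<close>

text \<open>Cauchy's formula for the twofold integral: the function with second derivative
  \<open>\<phi>\<close> and with value and slope 0 at time 0.\<close>

definition volterra :: "(real \<Rightarrow> complex) \<Rightarrow> real \<Rightarrow> complex" where
  "volterra \<phi> t = integral {0..t} (\<lambda>s. (t - s) *\<^sub>R \<phi> s)"

lemma volterra_split:
  assumes "continuous_on {0..1} \<phi>" "t \<in> {0..1}"
  shows "volterra \<phi> t = t *\<^sub>R integral {0..t} \<phi> - integral {0..t} (\<lambda>s. s *\<^sub>R \<phi> s)"
proof -
  have c: "continuous_on {0..t} \<phi>" using assms by (auto intro: continuous_on_subset)
  have "volterra \<phi> t = integral {0..t} (\<lambda>s. t *\<^sub>R \<phi> s - s *\<^sub>R \<phi> s)"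
    by (simp add: volterra_def scaleR_left_diff_distrib)
  also have "\<dots> = t *\<^sub>R integral {0..t} \<phi> - integral {0..t} (\<lambda>s. s *\<^sub>R \<phi> s)"
    using c by (subst integral_diff) (auto intro!: integrable_continuous_real continuous_intros)
  finally show ?thesis .
qed

lemma volterra_has_vector_derivative:
  assumes c: "continuous_on {0..1} \<phi>" and t: "t \<in> {0..1}"
  shows "(volterra \<phi> has_vector_derivative integral {0..t} \<phi>) (at t within {0..1})"
proof -
  have 1: "((\<lambda>t. integral {0..t} \<phi>) has_vector_derivative \<phi> t) (at t within {0..1})"
    by (rule integral_has_vector_derivative[OF c t])
  have 2: "((\<lambda>t. integral {0..t} (\<lambda>s. s *\<^sub>R \<phi> s)) has_vector_derivative t *\<^sub>R \<phi> t) (at t within {0..1})"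
    using c t by (intro integral_has_vector_derivative) (auto intro!: continuous_intros)
  have id: "((\<lambda>t. t) has_vector_derivative 1) (at t within {0..1})"
    by (rule has_vector_derivative_id)
  have "((\<lambda>t. t *\<^sub>R integral {0..t} \<phi> - integral {0..t} (\<lambda>s. s *\<^sub>R \<phi> s)) has_vector_derivative
      (t *\<^sub>R \<phi> t + 1 *\<^sub>R integral {0..t} \<phi>) - t *\<^sub>R \<phi> t) (at t within {0..1})"
    by (intro has_vector_derivative_diff has_vector_derivative_scaleR 1 2)
      (simp add: has_real_derivative_iff_has_vector_derivative id)
  then have "((\<lambda>t. t *\<^sub>R integral {0..t} \<phi> - integral {0..t} (\<lambda>s. s *\<^sub>R \<phi> s)) has_vector_derivative
      integral {0..t} \<phi>) (at t within {0..1})" by simp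
  then show ?thesis
    by (rule has_vector_derivative_transform[OF t, rotated]) (use volterra_split[OF c] in auto)
qed

lemma volterra_continuous:
  assumes "continuous_on {0..1} \<phi>"
  shows "continuous_on {0..1} (volterra \<phi>)"
  using volterra_has_vector_derivative[OF assms]
  by (meson continuous_on_eq_continuous_within has_vector_derivative_continuous)

lemma volterra_norm_le:
  assumes c: "continuous_on {0..1} \<phi>" and t: "t \<in> {0..1}"
    and le: "\<And>s. s \<in> {0..t} \<Longrightarrow> norm (\<phi> s) \<le> \<psi> s" and ps: "continuous_on {0..1} \<psi>"
  shows "norm (volterra \<phi> t) \<le> integral {0..t} \<psi>"
  unfolding volterra_def
proof (rule integral_norm_bound_integral)
  have sub: "{0..t} \<subseteq> {0..1}" using t by auto
  show "(\<lambda>s. (t - s) *\<^sub>R \<phi> s) integrable_on {0..t}"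
    using continuous_on_subset[OF c sub] by (intro integrable_continuous_real continuous_intros)
  show "\<psi> integrable_on {0..t}"
    using continuous_on_subset[OF ps sub] by (intro integrable_continuous_real)
  show "norm ((t - s) *\<^sub>R \<phi> s) \<le> \<psi> s" if "s \<in> {0..t}" for s
  proof -
    have "norm ((t - s) *\<^sub>R \<phi> s) = (t - s) * norm (\<phi> s)" using that by simp
    also have "\<dots> \<le> 1 * norm (\<phi> s)" using that t by (intro mult_right_mono) auto
    also have "\<dots> \<le> \<psi> s" using le[OF that] by simp
    finally show ?thesis .
  qed
qed

text \<open>The exponent \<open>2 * L\<close> is made for this: integrating
  \<open>L * exp (2 * L * s)\<close> gains the factor 1/2 that drives both the contraction and the
  stability estimate.\<close>

lemma integral_exp_le:
  fixes L B :: real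
  assumes "L > 0" "B \<ge> 0" "t \<ge> 0"
  shows "integral {0..t} (\<lambda>s. L * (exp (2 * L * s) * B)) \<le> exp (2 * L * t) * B / 2"
proof -
  have "((\<lambda>s. L * (exp (2 * L * s) * B)) has_integral exp (2 * L * t) * B / 2 - exp (2 * L * 0) * B / 2) {0..t}"
    using assms(3)
    by (intro fundamental_theorem_of_calculus)
      (auto simp: has_real_derivative_iff_has_vector_derivative[symmetric] intro!: derivative_eq_intros)
  then show ?thesis using assms by (auto dest!: integral_unique)
qed

lemma volterra_exp_bound:
  assumes c: "continuous_on {0..1} \<phi>" and t: "t \<in> {0..1}" and LB: "L > 0" "B \<ge> 0"
    and le: "\<And>s. s \<in> {0..1} \<Longrightarrow> norm (\<phi> s) \<le> L * (exp (2 * L * s) * B)"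
  shows "norm (volterra \<phi> t) \<le> exp (2 * L * t) * B / 2"
proof -
  have "norm (volterra \<phi> t) \<le> integral {0..t} (\<lambda>s. L * (exp (2 * L * s) * B))"
    using t by (intro volterra_norm_le c le) (auto intro!: continuous_intros)
  also have "\<dots> \<le> exp (2 * L * t) * B / 2" using LB t by (intro integral_exp_le) auto
  finally show ?thesis .
qed

lemma volterra_diff:
  assumes "continuous_on {0..1} \<phi>" "continuous_on {0..1} \<psi>" "t \<in> {0..1}"
  shows "volterra \<phi> t - volterra \<psi> t = volterra (\<lambda>s. \<phi> s - \<psi> s) t"
proof -
  have "continuous_on {0..t} \<phi>" "continuous_on {0..t} \<psi>" using assms by (auto intro: continuous_on_subset)
  then show ?thesis unfolding volterra_def
    by (subst integral_diff[symmetric])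
      (auto intro!: integrable_continuous_real continuous_intros simp: scaleR_diff_right)
qed

text \<open>The weight \<open>exp (- 2 L t)\<close> makes the Volterra operator a contraction with factor \<open>1/2\<close>.\<close>

lemma volterra_equation_exists:
  fixes g :: "complex \<Rightarrow> complex"
  assumes L: "L > 0" and lip: "\<And>u v. norm (g u - g v) \<le> L * norm (u - v)"
    and a: "continuous_on {0..1} a"
  shows "\<exists>u. continuous_on {0..1} u \<and> (\<forall>t\<in>{0..1}. u t = a t + volterra (\<lambda>s. g (u s)) t)"
proof -
  have cg: "continuous_on S g" for S
    by (rule lipschitz_on_continuous_on[of L]) (use L lip in \<open>auto simp: lipschitz_on_def dist_norm\<close>)
  \<comment> \<open>Clamping the time lets the fixed point be sought among bounded continuous
    functions on the whole line, a complete space.\<close>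
  define cl where "cl t = max 0 (min 1 t)" for t :: real
  have cl: "cl t \<in> {0..1}" "t \<in> {0..1} \<Longrightarrow> cl t = t" for t by (auto simp: cl_def)
  have ccl: "continuous_on UNIV cl" unfolding cl_def by (intro continuous_intros)
  define E where "E t = exp (2 * L * t)" for t
  have E: "E t > 0" for t by (simp add: E_def)
  have cE [continuous_intros]: "continuous_on S E" for S unfolding E_def by (intro continuous_intros)
  \<comment> \<open>\<open>v\<close> stands for \<open>u\<close> divided by the weight
    \<open>E\<close>, so the supremum distance between such \<open>v\<close> is the weighted
    distance between the corresponding \<open>u\<close>.\<close>
  define \<phi> where "\<phi> v = (\<lambda>s. g (E s *\<^sub>R apply_bcontfun v s))" for v :: "real \<Rightarrow>\<^sub>C complex"
  have c\<phi>: "continuous_on {0..1} (\<phi> v)" for v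
    unfolding \<phi>_def by (rule continuous_on_compose2[OF cg[of UNIV]]) (auto intro!: continuous_intros)
  define w where "w v t = (a t + volterra (\<phi> v) t) /\<^sub>R E t" for v t
  have cw: "continuous_on {0..1} (w v)" for v
    unfolding w_def using E
    by (intro continuous_intros a volterra_continuous c\<phi>) (auto simp: less_imp_neq[symmetric])
  have wb: "(\<lambda>t. w v (cl t)) \<in> bcontfun" for v
  proof -
    have "bounded (w v ` {0..1})" using cw by (intro compact_imp_bounded compact_continuous_image) auto
    then obtain b where "\<And>t. t \<in> {0..1} \<Longrightarrow> norm (w v t) \<le> b"
      unfolding bounded_iff by (metis imageI)
    then show ?thesis
      using continuous_on_compose2[OF cw ccl] cl(1) by (intro bcontfun_normI[where b = b]) (auto simp: image_subset_iff)
  qed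
  define T where "T v = Bcontfun (\<lambda>t. w v (cl t))" for v
  have T: "apply_bcontfun (T v) t = w v (cl t)" for v t
    unfolding T_def using wb by (simp add: Bcontfun_inverse)
  have contr: "dist (T v) (T v') \<le> (1/2) * dist v v'" for v v'
  proof (rule dist_bound)
    fix t
    let ?t = "cl t"
    have "volterra (\<phi> v) ?t - volterra (\<phi> v') ?t = volterra (\<lambda>s. \<phi> v s - \<phi> v' s) ?t"
      by (rule volterra_diff) (use c\<phi> cl in auto)
    then have "dist (T v t) (T v' t) = norm (volterra (\<lambda>s. \<phi> v s - \<phi> v' s) ?t) / E ?t"
      using E[of ?t] by (simp add: T w_def dist_norm scaleR_diff_right[symmetric] divide_inverse mult.commute)
    also have "\<dots> \<le> (E ?t * dist v v' / 2) / E ?t"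
    proof (rule divide_right_mono)
      show "norm (volterra (\<lambda>s. \<phi> v s - \<phi> v' s) ?t) \<le> E ?t * dist v v' / 2"
        unfolding E_def
      proof (rule volterra_exp_bound)
        fix s :: real
        have "norm (\<phi> v s - \<phi> v' s) \<le> L * norm (E s *\<^sub>R v s - E s *\<^sub>R v' s)"
          unfolding \<phi>_def by (rule lip)
        also have "\<dots> = L * (E s * dist (v s) (v' s))"
          using E[of s] by (simp add: scaleR_diff_right[symmetric] dist_norm)
        also have "\<dots> \<le> L * (E s * dist v v')"
          using L E[of s] by (intro mult_left_mono dist_bounded) auto
        finally show "norm (\<phi> v s - \<phi> v' s) \<le> L * (exp (2 * L * s) * dist v v')" by (simp add: E_def)
      qed (use c\<phi> cl L in \<open>auto intro!: continuous_intros\<close>)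
    qed (use E[of ?t] in auto)
    also have "\<dots> = (1/2) * dist v v'" using E[of ?t] by simp
    finally show "dist (T v t) (T v' t) \<le> (1/2) * dist v v'" .
  qed
  then obtain v where v: "T v = v"
    using banach_fix_type[of "1/2" T] by auto
  define u where "u t = E t *\<^sub>R v t" for t
  have "u t = a t + volterra (\<lambda>s. g (u s)) t" if "t \<in> {0..1}" for t
  proof -
    have "u t = E t *\<^sub>R w v t" using T[of v t] cl(2)[OF that] by (simp add: v u_def)
    also have "\<dots> = a t + volterra (\<phi> v) t" using E[of t] by (simp add: w_def)
    finally show ?thesis by (simp add: \<phi>_def u_def)
  qed
  moreover have "continuous_on {0..1} u" unfolding u_def by (intro continuous_intros) auto
  ultimately show ?thesis by blast
qed

text \<open>At a maximum \<open>s0\<close> of the weighted difference,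
  \<open>volterra_exp_bound\<close> estimates the integral term by half of the difference itself;
  absorbing it leaves the factor 2.\<close>

lemma volterra_equation_stable:
  fixes g :: "complex \<Rightarrow> complex"
  assumes L: "L > 0" and lip: "\<And>u v. norm (g u - g v) \<le> L * norm (u - v)"
    and u: "continuous_on {0..1} u" "\<And>t. t \<in> {0..1} \<Longrightarrow> u t = a t + volterra (\<lambda>s. g (u s)) t"
    and v: "continuous_on {0..1} v" "\<And>t. t \<in> {0..1} \<Longrightarrow> v t = b t + volterra (\<lambda>s. g (v s)) t"
    and ab: "\<And>t. t \<in> {0..1} \<Longrightarrow> norm (a t - b t) \<le> \<epsilon>"
    and t: "t \<in> {0..1}"
  shows "norm (u t - v t) \<le> 2 * exp (2 * L) * \<epsilon>"
proof -
  have cg: "continuous_on S g" for S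
    by (rule lipschitz_on_continuous_on[of L]) (use L lip in \<open>auto simp: lipschitz_on_def dist_norm\<close>)
  have cgu: "continuous_on {0..1} (\<lambda>s. g (u s))" "continuous_on {0..1} (\<lambda>s. g (v s))"
    by (auto intro: continuous_on_compose2[OF cg[of UNIV]] u v)
  let ?d = "\<lambda>s. exp (- (2 * L * s)) * norm (u s - v s)"
  have "continuous_on {0..1} ?d" by (intro continuous_intros u v)
  then obtain s0 where s0: "s0 \<in> {0..1}" "\<And>s. s \<in> {0..1} \<Longrightarrow> ?d s \<le> ?d s0"
    using continuous_attains_sup[of "{0..1::real}" ?d] by auto
  define M where "M = ?d s0"
  have M: "norm (u s - v s) \<le> exp (2 * L * s) * M" if "s \<in> {0..1}" for s
    using s0(2)[OF that] by (simp add: M_def exp_minus field_simps)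
  have M0: "M \<ge> 0" by (simp add: M_def)
  have "norm (volterra (\<lambda>s. g (u s) - g (v s)) s0) \<le> exp (2 * L * s0) * M / 2"
  proof (rule volterra_exp_bound)
    show "norm (g (u s) - g (v s)) \<le> L * (exp (2 * L * s) * M)" if "s \<in> {0..1}" for s
      using lip[of "u s" "v s"] mult_left_mono[OF M[OF that], of L] L by linarith
  qed (use cgu s0 L M0 in \<open>auto intro!: continuous_intros\<close>)
  moreover have "u s0 - v s0 = (a s0 - b s0) + volterra (\<lambda>s. g (u s) - g (v s)) s0"
    using volterra_diff[OF cgu s0(1)] u(2)[OF s0(1)] v(2)[OF s0(1)] by (simp add: algebra_simps)
  then have "norm (u s0 - v s0) \<le> norm (a s0 - b s0) + norm (volterra (\<lambda>s. g (u s) - g (v s)) s0)"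
    by (simp only: norm_triangle_ineq)
  ultimately have "norm (u s0 - v s0) \<le> \<epsilon> + exp (2 * L * s0) * M / 2"
    using ab[OF s0(1)] by linarith
  moreover have "norm (u s0 - v s0) = exp (2 * L * s0) * M" by (simp add: M_def exp_minus field_simps)
  ultimately have "exp (2 * L * s0) * M \<le> 2 * \<epsilon>" by simp
  moreover have "1 * M \<le> exp (2 * L * s0) * M" using s0(1) L M0 by (intro mult_right_mono) auto
  ultimately have M2: "M \<le> 2 * \<epsilon>" by simp
  have "norm (u t - v t) \<le> exp (2 * L * t) * M" by (rule M[OF t])
  also have "\<dots> \<le> exp (2 * L) * (2 * \<epsilon>)"
    using t L M0 M2 by (intro mult_mono) (auto simp: mult_left_le)
  finally show ?thesis by simp
qed

text \<open>Freezing the radius in the denominator at \<open>d\<close> inside the disc removes the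
  singularity: the result is globally Lipschitz and agrees with the repulsive force wherever
  \<open>norm u \<ge> d\<close>.\<close>

definition cut_force :: "real \<Rightarrow> real \<Rightarrow> complex \<Rightarrow> complex" where
  "cut_force q d u = u /\<^sub>R (max (norm u) d powr (q + 1))"

lemma cut_force_eq: "norm u \<ge> d \<Longrightarrow> cut_force q d u = u /\<^sub>R (norm u powr (q + 1))"
  by (simp add: cut_force_def)

text \<open>The factor \<open>r\<close> compensates one power in the derivative of
  \<open>x powr (- p)\<close>, and what is left is at most \<open>d powr (- p)\<close>.\<close>

lemma powr_neg_diff_le:
  fixes p d r s :: real
  assumes "p > 0" "d > 0" "d \<le> r" "r \<le> s"
  shows "\<bar>s powr (- p) - r powr (- p)\<bar> * r \<le> p * d powr (- p) * (s - r)"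
proof (cases "r = s")
  case False
  then obtain z where z: "r < z" "z < s" "s powr (- p) - r powr (- p) = (s - r) * (- p * z powr (- p - 1))"
    using MVT2[of r s "\<lambda>x. x powr (- p)" "\<lambda>x. - p * x powr (- p - 1)"] assms
    by (force intro!: derivative_eq_intros)
  have "z powr (- p - 1) * r \<le> z powr (- p - 1) * z" using z by (intro mult_left_mono) auto
  also have "\<dots> = z powr (- p)" using z assms by (simp add: powr_diff)
  also have "\<dots> \<le> d powr (- p)" using z assms by (intro powr_mono2') auto
  finally have *: "z powr (- p - 1) * r \<le> d powr (- p)" .
  have "\<bar>s powr (- p) - r powr (- p)\<bar> * r = (s - r) * p * (z powr (- p - 1) * r)"
    unfolding z(3) using assms by (simp add: abs_mult)
  also have "\<dots> \<le> (s - r) * p * d powr (- p)" using * assms by (intro mult_left_mono) auto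
  finally show ?thesis by (simp add: mult_ac)
qed simp

text \<open>The difference splits into \<open>A u *\<^sub>R (u - v)\<close> and
  \<open>(A u - A v) *\<^sub>R v\<close>, contributing 1 and \<open>p = q + 1\<close> to the factor
  of \<open>d powr (- p)\<close>. The vector of smaller norm goes into the second term, where
  \<open>powr_neg_diff_le\<close> requires it.\<close>

lemma cut_force_lipschitz:
  assumes "q > 0" "d > 0"
  shows "norm (cut_force q d u - cut_force q d v) \<le> ((q + 2) * d powr (- (q + 1))) * norm (u - v)"
proof -
  define p where "p = q + 1"
  have p: "p > 0" using assms by (simp add: p_def)
  define A where "A w = max (norm w) d powr (- p)" for w :: complex
  have cf: "cut_force q d w = A w *\<^sub>R w" for w
    by (simp add: cut_force_def A_def p_def powr_minus[symmetric])
  have *: "norm (A u *\<^sub>R u - A v *\<^sub>R v) \<le> ((p + 1) * d powr (- p)) * norm (u - v)"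
    if le: "norm v \<le> norm u" for u v
  proof -
    have "A u *\<^sub>R u - A v *\<^sub>R v = A u *\<^sub>R (u - v) + (A u - A v) *\<^sub>R v"
      by (simp add: algebra_simps)
    then have "norm (A u *\<^sub>R u - A v *\<^sub>R v) \<le> norm (A u *\<^sub>R (u - v)) + norm ((A u - A v) *\<^sub>R v)"
      by (metis norm_triangle_ineq)
    moreover have "norm (A u *\<^sub>R (u - v)) \<le> d powr (- p) * norm (u - v)"
    proof -
      have "A u \<le> d powr (- p)" unfolding A_def using assms p by (intro powr_mono2') auto
      then show ?thesis by (simp add: A_def mult_right_mono)
    qed
    moreover have "norm ((A u - A v) *\<^sub>R v) \<le> p * d powr (- p) * norm (u - v)"
    proof -
      have "norm ((A u - A v) *\<^sub>R v) \<le> \<bar>A u - A v\<bar> * max (norm v) d"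
        by (simp add: mult_left_mono)
      also have "\<dots> \<le> p * d powr (- p) * (max (norm u) d - max (norm v) d)"
        unfolding A_def using powr_neg_diff_le[of p d "max (norm v) d" "max (norm u) d"] p assms le by auto
      also have "\<dots> \<le> p * d powr (- p) * norm (u - v)"
        using p norm_triangle_ineq2[of u v] le by (intro mult_left_mono) auto
      finally show ?thesis .
    qed
    ultimately show ?thesis by (simp add: algebra_simps)
  qed
  have "norm (A u *\<^sub>R u - A v *\<^sub>R v) \<le> ((p + 1) * d powr (- p)) * norm (u - v)"
    using *[of u v] *[of v u] by (cases "norm v \<le> norm u") (auto simp: norm_minus_commute)
  then show ?thesis by (simp add: cf p_def algebra_simps)
qed

lemma cut_force_continuous:
  assumes "q > 0" "d > 0"
  shows "continuous_on S (cut_force q d)"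
  by (rule lipschitz_on_continuous_on[of "(q + 2) * d powr (- (q + 1))"])
    (use assms cut_force_lipschitz[OF assms] in \<open>auto simp: lipschitz_on_def dist_norm\<close>)

lemma cut_force_norm_le:
  assumes "q > 0" "c > 0" "c \<le> max (norm u) d"
  shows "norm (cut_force q d u) \<le> c powr (- q)"
proof -
  let ?m = "max (norm u) d"
  have m: "?m > 0" using assms by linarith
  have "norm (cut_force q d u) = norm u * ?m powr (- (q + 1))"
    by (simp add: cut_force_def powr_minus[symmetric] mult.commute)
  also have "\<dots> \<le> ?m * ?m powr (- (q + 1))" by (intro mult_right_mono) auto
  also have "\<dots> = ?m powr (- q)" using m by (simp add: powr_diff powr_minus field_simps powr_add)
  also have "\<dots> \<le> c powr (- q)" using assms by (intro powr_mono2') auto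
  finally show ?thesis .
qed

section \<open>The forced problem and its shooting map\<close>

lemma continuous_norm_bound:
  fixes f :: "real \<Rightarrow> 'a::real_normed_vector"
  assumes "continuous_on {0..1} f"
  obtains B where "B \<ge> 0" "\<And>t. t \<in> {0..1} \<Longrightarrow> norm (f t) \<le> B"
proof -
  have "bounded (f ` {0..1})" using assms by (intro compact_imp_bounded compact_continuous_image) auto
  then obtain B where "\<And>x. x \<in> f ` {0..1} \<Longrightarrow> norm x \<le> B" unfolding bounded_iff by blast
  then show ?thesis using that[of "max B 0"] by (simp add: le_max_iff_disj)
qed

locale forced_problem =
  fixes q :: real and h H H' :: "real \<Rightarrow> complex"
  assumes q: "q \<ge> 2"
    and cont_h: "continuous_on {0..1} h"
    and C2_H: "C2_derivs H H' (\<lambda>t. - h t)"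
    and periodic_H: "H 0 = H 1" and periodic_H': "H' 0 = H' 1"
begin

lemma H_deriv: "t \<in> {0..1} \<Longrightarrow> (H has_vector_derivative H' t) (at t within {0..1})"
  and H'_deriv: "t \<in> {0..1} \<Longrightarrow> (H' has_vector_derivative - h t) (at t within {0..1})"
  using C2_H by (auto simp: C2_derivs_def)

lemma cont_H: "continuous_on {0..1} H" and cont_H': "continuous_on {0..1} H'"
  using H_deriv H'_deriv
  by (meson continuous_on_eq_continuous_within has_vector_derivative_continuous)+

text \<open>The solution of \<open>u'' = lam h\<close> with initial position and velocity
  \<open>z\<close>: the bracket is \<open>H\<close> minus its tangent at 0, and
  \<open>H'' = - h\<close>.\<close>

definition free_data :: "complex \<times> complex \<Rightarrow> real \<Rightarrow> real \<Rightarrow> complex" where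
  "free_data z lam t = fst z + t *\<^sub>R snd z - lam *\<^sub>R (H t - H 0 - t *\<^sub>R H' 0)"

text \<open>The initial value problem for the truncated force as a fixed-point equation; it is
  solvable for all data and parameters because \<open>cut_force\<close> is globally
  Lipschitz.\<close>

definition flow :: "real \<Rightarrow> complex \<times> complex \<Rightarrow> real \<Rightarrow> real \<Rightarrow> complex" where
  "flow d z lam = (SOME u. continuous_on {0..1} u \<and>
     (\<forall>t\<in>{0..1}. u t = free_data z lam t + volterra (\<lambda>s. cut_force q d (u s)) t))"

definition flow' :: "real \<Rightarrow> complex \<times> complex \<Rightarrow> real \<Rightarrow> real \<Rightarrow> complex" where
  "flow' d z lam t = snd z - lam *\<^sub>R (H' t - H' 0) + integral {0..t} (\<lambda>s. cut_force q d (flow d z lam s))"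

text \<open>The pair \<open>(u'(0) - u'(1), u(1) - u(0))\<close> for the solution \<open>u\<close> with initial data \<open>z\<close>.\<close>

definition shoot :: "real \<Rightarrow> (complex \<times> complex) \<times> real \<Rightarrow> complex \<times> complex" where
  "shoot d p = (case p of (z, lam) \<Rightarrow>
     (- integral {0..1} (\<lambda>s. cut_force q d (flow d z lam s)),
      snd z + lam *\<^sub>R H' 0 + volterra (\<lambda>s. cut_force q d (flow d z lam s)) 1))"

context
  fixes d :: real
  assumes d: "d > 0"
begin

definition "lip = (q + 2) * d powr (- (q + 1))"

lemma lip: "lip > 0" "norm (cut_force q d u - cut_force q d v) \<le> lip * norm (u - v)"
  using q d cut_force_lipschitz[of q d u v] by (auto simp: lip_def)

lemma cut_force_cont: "continuous_on S (cut_force q d)"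
  using q d by (intro cut_force_continuous) auto

lemma
  shows flow_cont: "continuous_on {0..1} (flow d z lam)"
    and flow_eq: "t \<in> {0..1} \<Longrightarrow>
      flow d z lam t = free_data z lam t + volterra (\<lambda>s. cut_force q d (flow d z lam s)) t"
proof -
  have "continuous_on {0..1} (free_data z lam)"
    unfolding free_data_def by (intro continuous_intros cont_H)
  from volterra_equation_exists[OF lip this]
  have "\<exists>u. continuous_on {0..1} u \<and>
     (\<forall>t\<in>{0..1}. u t = free_data z lam t + volterra (\<lambda>s. cut_force q d (u s)) t)" .
  from someI_ex[OF this] show "continuous_on {0..1} (flow d z lam)"
    "t \<in> {0..1} \<Longrightarrow>
      flow d z lam t = free_data z lam t + volterra (\<lambda>s. cut_force q d (flow d z lam s)) t"
    unfolding flow_def[symmetric] by auto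
qed

lemma cut_flow_cont: "continuous_on {0..1} (\<lambda>s. cut_force q d (flow d z lam s))"
  by (rule continuous_on_compose2[OF cut_force_cont[of UNIV] flow_cont]) auto

lemma flow_lipschitz:
  obtains C where "C > 0"
    "\<And>z lam z' lam' t. t \<in> {0..1} \<Longrightarrow>
       norm (flow d z lam t - flow d z' lam' t) \<le> C * dist (z, lam) (z', lam')"
proof -
  have "continuous_on {0..1} (\<lambda>t. H t - H 0 - t *\<^sub>R H' 0)"
    by (intro continuous_intros cont_H)
  then obtain B where B: "B \<ge> 0" "\<And>t. t \<in> {0..1} \<Longrightarrow> norm (H t - H 0 - t *\<^sub>R H' 0) \<le> B"
    by (rule continuous_norm_bound) blast
  show ?thesis
  proof (rule that[of "2 * exp (2 * lip) * (2 + B)"])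
    show "2 * exp (2 * lip) * (2 + B) > 0" using B(1) by simp
    fix z z' :: "complex \<times> complex" and lam lam' t :: real assume t: "t \<in> {0..1}"
    let ?D = "dist (z, lam) (z', lam')"
    have z: "norm (fst z - fst z') \<le> ?D" "norm (snd z - snd z') \<le> ?D" "\<bar>lam - lam'\<bar> \<le> ?D"
      using dist_fst_le[of "(z, lam)" "(z', lam')"] dist_fst_le[of z z'] dist_snd_le[of z z']
        dist_snd_le[of "(z, lam)" "(z', lam')"] by (auto simp: dist_norm)
    have "norm (free_data z lam t - free_data z' lam' t) \<le> (2 + B) * ?D" if t: "t \<in> {0..1}" for t
    proof -
      have "free_data z lam t - free_data z' lam' t =
          (fst z - fst z') + t *\<^sub>R (snd z - snd z') - (lam - lam') *\<^sub>R (H t - H 0 - t *\<^sub>R H' 0)"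
        by (simp add: free_data_def algebra_simps)
      also have "norm \<dots> \<le> norm (fst z - fst z') + norm (t *\<^sub>R (snd z - snd z')) +
          norm ((lam - lam') *\<^sub>R (H t - H 0 - t *\<^sub>R H' 0))"
        by (intro order_trans[OF norm_triangle_ineq4] add_right_mono norm_triangle_ineq)
      also have "\<dots> \<le> ?D + 1 * ?D + ?D * B"
      proof (intro add_mono)
        show "norm (t *\<^sub>R (snd z - snd z')) \<le> 1 * ?D"
          unfolding norm_scaleR using t z by (intro mult_mono) auto
        show "norm ((lam - lam') *\<^sub>R (H t - H 0 - t *\<^sub>R H' 0)) \<le> ?D * B"
          unfolding norm_scaleR using t z B by (intro mult_mono) auto
      qed (use z in auto)
      finally show ?thesis by (simp add: algebra_simps)
    qed
    then have "norm (flow d z lam t - flow d z' lam' t) \<le> 2 * exp (2 * lip) * ((2 + B) * ?D)"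
      using volterra_equation_stable[where g = "cut_force q d" and a = "free_data z lam" and b = "free_data z' lam'"
          and u = "flow d z lam" and v = "flow d z' lam'", OF lip flow_cont flow_eq flow_cont flow_eq _ t]
      by blast
    then show "norm (flow d z lam t - flow d z' lam' t) \<le> 2 * exp (2 * lip) * (2 + B) * ?D"
      by (simp add: mult.assoc)
  qed
qed

lemma shoot_continuous: "continuous_on S (shoot d)"
proof -
  obtain C where C: "C > 0" "\<And>z lam z' lam' t. t \<in> {0..1} \<Longrightarrow>
       norm (flow d z lam t - flow d z' lam' t) \<le> C * dist (z, lam) (z', lam')"
    by (rule flow_lipschitz) blast
  have g: "norm (cut_force q d (flow d z lam s) - cut_force q d (flow d z' lam' s)) \<le> lip * C * dist (z, lam) (z', lam')"
    if "s \<in> {0..1}" for s z lam z' lam'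
  proof -
    have "lip * norm (flow d z lam s - flow d z' lam' s) \<le> lip * (C * dist (z, lam) (z', lam'))"
      using C(2)[OF that] lip(1) by (intro mult_left_mono) auto
    then show ?thesis using lip(2)[of "flow d z lam s" "flow d z' lam' s"] by (simp add: mult.assoc)
  qed
  have lipI: "continuous_on S F" if "\<And>p p'. norm (F p - F p') \<le> (lip * C) * dist p p'"
    for F :: "(complex \<times> complex) \<times> real \<Rightarrow> complex"
    by (rule lipschitz_on_continuous_on[of "lip * C"]) (use that lip(1) C(1) in \<open>auto simp: lipschitz_on_def dist_norm\<close>)
  have 1: "continuous_on S (\<lambda>p. integral {0..1} (\<lambda>s. cut_force q d (flow d (fst p) (snd p) s)))"
  proof (rule lipI)
    fix p p' :: "(complex \<times> complex) \<times> real"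
    obtain z lam z' lam' where p: "p = (z, lam)" "p' = (z', lam')" by (cases p, cases p') auto
    have "norm (integral {0..1} (\<lambda>s. cut_force q d (flow d z lam s)) - integral {0..1} (\<lambda>s. cut_force q d (flow d z' lam' s)))
      = norm (integral {0..1} (\<lambda>s. cut_force q d (flow d z lam s) - cut_force q d (flow d z' lam' s)))"
      by (subst integral_diff) (auto intro!: integrable_continuous_real cut_flow_cont)
    also have "\<dots> \<le> (lip * C * dist (z, lam) (z', lam')) * (1 - 0)"
      by (rule integral_bound) (use g in \<open>auto intro!: continuous_intros cut_flow_cont\<close>)
    finally show "norm (integral {0..1} (\<lambda>s. cut_force q d (flow d (fst p) (snd p) s)) -
       integral {0..1} (\<lambda>s. cut_force q d (flow d (fst p') (snd p') s))) \<le> lip * C * dist p p'" by (simp add: p)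
  qed
  have 2: "continuous_on S (\<lambda>p. volterra (\<lambda>s. cut_force q d (flow d (fst p) (snd p) s)) 1)"
  proof (rule lipI)
    fix p p' :: "(complex \<times> complex) \<times> real"
    obtain z lam z' lam' where p: "p = (z, lam)" "p' = (z', lam')" by (cases p, cases p') auto
    have "norm (volterra (\<lambda>s. cut_force q d (flow d z lam s)) 1 - volterra (\<lambda>s. cut_force q d (flow d z' lam' s)) 1)
      = norm (volterra (\<lambda>s. cut_force q d (flow d z lam s) - cut_force q d (flow d z' lam' s)) 1)"
      by (subst volterra_diff) (auto intro!: cut_flow_cont)
    also have "\<dots> \<le> integral {0..1::real} (\<lambda>s. lip * C * dist (z, lam) (z', lam'))"
      by (rule volterra_norm_le) (use g in \<open>auto intro!: continuous_intros cut_flow_cont\<close>)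
    finally show "norm (volterra (\<lambda>s. cut_force q d (flow d (fst p) (snd p) s)) 1 -
       volterra (\<lambda>s. cut_force q d (flow d (fst p') (snd p') s)) 1) \<le> lip * C * dist p p'" by (simp add: p)
  qed
  show ?thesis unfolding shoot_def split_beta by (intro continuous_intros 1 2)
qed

lemma flow_C2: "C2_derivs (flow d z lam) (flow' d z lam) (\<lambda>t. cut_force q d (flow d z lam t) + lam *\<^sub>R h t)"
  unfolding C2_derivs_def
proof (intro conjI ballI)
  fix t :: real assume t: "t \<in> {0..1}"
  have "((\<lambda>t. free_data z lam t + volterra (\<lambda>s. cut_force q d (flow d z lam s)) t) has_vector_derivative
      (snd z - lam *\<^sub>R (H' t - H' 0)) + integral {0..t} (\<lambda>s. cut_force q d (flow d z lam s))) (at t within {0..1})"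
    unfolding free_data_def
    by (rule derivative_eq_intros refl H_deriv t volterra_has_vector_derivative cut_flow_cont | simp)+
  then have "((\<lambda>t. free_data z lam t + volterra (\<lambda>s. cut_force q d (flow d z lam s)) t) has_vector_derivative
      flow' d z lam t) (at t within {0..1})"
    by (simp add: flow'_def)
  then show "(flow d z lam has_vector_derivative flow' d z lam t) (at t within {0..1})"
    by (rule has_vector_derivative_transform[OF t, rotated]) (use flow_eq in auto)
  have "(flow' d z lam has_vector_derivative - (lam *\<^sub>R (- h t)) + cut_force q d (flow d z lam t)) (at t within {0..1})"
    unfolding flow'_def
    by (rule derivative_eq_intros refl H'_deriv t integral_has_vector_derivative cut_flow_cont | simp)+
  then show "(flow' d z lam has_vector_derivative cut_force q d (flow d z lam t) + lam *\<^sub>R h t) (at t within {0..1})"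
    by (simp add: add.commute)
next
  show "continuous_on {0..1} (\<lambda>t. cut_force q d (flow d z lam t) + lam *\<^sub>R h t)"
    by (intro continuous_intros cut_flow_cont cont_h)
qed

lemma flow_0: "flow d z lam 0 = fst z" and flow'_0: "flow' d z lam 0 = snd z"
  using flow_eq[of 0 z lam] by (auto simp: free_data_def flow'_def volterra_def)

lemma shoot_zero_periodic:
  assumes "shoot d (z, lam) = 0"
  shows "flow d z lam 0 = flow d z lam 1" "flow' d z lam 0 = flow' d z lam 1"
  using assms flow_eq[of 1 z lam] periodic_H periodic_H'
  by (auto simp: shoot_def zero_prod_def flow_0 flow'_0 free_data_def flow'_def algebra_simps)

text \<open>As long as the curve stays at distance at least \<open>d\<close> from 0, the truncated
  and the original force agree along it.\<close>

lemma shoot_zero_solution: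
  assumes "shoot d (z, lam) = 0" "\<And>t. t \<in> {0..1} \<Longrightarrow> d \<le> norm (flow d z lam t)"
  shows "repulsive_periodic_solution q h lam (flow d z lam)"
proof -
  let ?u = "flow d z lam"
  have eq: "\<forall>t\<in>{0..1}. cut_force q d (?u t) + lam *\<^sub>R h t - ?u t /\<^sub>R (norm (?u t) powr (q + 1)) = lam *\<^sub>R h t"
    using cut_force_eq[OF assms(2)] by simp
  have "\<forall>t\<in>{0..1}. ?u t \<noteq> 0" using assms(2) d by force
  then show ?thesis
    unfolding repulsive_periodic_solution_def
    using flow_C2[of z lam] eq shoot_zero_periodic[OF assms(1)] by blast
qed

end

end

section \<open>A priori bounds\<close>

lemma has_real_derivative_inner:
  fixes f g :: "real \<Rightarrow> 'a::real_inner"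
  assumes "(f has_vector_derivative f') (at t within S)" "(g has_vector_derivative g') (at t within S)"
  shows "((\<lambda>t. f t \<bullet> g t) has_real_derivative f t \<bullet> g' + f' \<bullet> g t) (at t within S)"
proof -
  have "(\<lambda>h. f t \<bullet> (h *\<^sub>R g') + (h *\<^sub>R f') \<bullet> g t) = times (f t \<bullet> g' + f' \<bullet> g t)"
    by (auto simp: fun_eq_iff algebra_simps)
  then show ?thesis
    using has_derivative_inner[OF assms[unfolded has_vector_derivative_def]]
    by (simp add: has_field_derivative_def)
qed

lemma integral_pos_if_pos:
  fixes f :: "real \<Rightarrow> real"
  assumes "continuous_on {0..1} f" "\<And>t. t \<in> {0..1} \<Longrightarrow> f t > 0"
  shows "integral {0..1} f > 0"
proof -
  obtain t0 where t0: "t0 \<in> {0..1}" "\<And>t. t \<in> {0..1} \<Longrightarrow> f t0 \<le> f t"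
    using continuous_attains_inf[of "{0..1}" f] assms(1) by auto
  have "integral {0..1::real} (\<lambda>t. f t0) \<le> integral {0..1::real} f"
    using t0 by (intro integral_le) (auto intro!: integrable_continuous_real assms continuous_intros)
  then show ?thesis using assms(2)[OF t0(1)] by simp
qed

lemma integral_of_derivative:
  fixes F f :: "real \<Rightarrow> real"
  assumes "\<And>t. t \<in> {a..b} \<Longrightarrow> (F has_real_derivative f t) (at t within {a..b})" "a \<le> b"
  shows "integral {a..b} f = F b - F a"
  using fundamental_theorem_of_calculus[of a b F f] assms
  by (auto simp: has_real_derivative_iff_has_vector_derivative intro!: integral_unique)

lemma norm_powr_inner: "norm (u::'a::real_inner) powr p = (u \<bullet> u) powr (p / 2)"
proof -
  have "(u \<bullet> u) powr (p / 2) = (norm u powr 2) powr (p / 2)"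
    by (simp add: dot_square_norm power2_eq_square powr_numeral)
  then show ?thesis by (simp only: powr_powr) simp
qed

context forced_problem
begin

lemma integral_h: "integral {0..1} h = 0"
proof -
  have "((\<lambda>t. - h t) has_integral H' 1 - H' 0) {0..1}"
    by (rule fundamental_theorem_of_calculus) (use H'_deriv in auto)
  then have "((\<lambda>t. - h t) has_integral 0) {0..1}" using periodic_H' by simp
  from has_integral_neg[OF this] show ?thesis by (simp add: integral_unique)
qed

text \<open>Testing the equation with \<open>u\<close> bounds the integral of \<open>?J\<close> by
  \<open>A\<close>. The energy \<open>E\<close> changes only through the forcing, hence by at most
  \<open>B\<close>. Together they bound \<open>E\<close> pointwise: its potential part keeps
  \<open>u\<close> away from 0 and its kinetic part bounds \<open>u'\<close>. The mean of the force
  then bounds \<open>u\<close> itself.\<close>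

lemma a_priori_bounds:
  assumes "Lam \<ge> 0"
  obtains c R where "c > 0" "R > 0"
    "\<And>lam u u' u''. \<lbrakk>0 \<le> lam; lam \<le> Lam; C2_derivs u u' u'';
      \<And>t. t \<in> {0..1} \<Longrightarrow> u t \<noteq> 0;
      \<And>t. t \<in> {0..1} \<Longrightarrow> u'' t - u t /\<^sub>R (norm (u t) powr (q + 1)) = lam *\<^sub>R h t;
      u 0 = u 1; u' 0 = u' 1\<rbrakk> \<Longrightarrow>
      lam \<noteq> 0 \<and> (\<forall>t\<in>{0..1}. c \<le> norm (u t)) \<and> norm (u 0) \<le> R \<and> norm (u' 0) \<le> R"
proof -
  obtain M where M: "M \<ge> 0" "\<And>t. t \<in> {0..1} \<Longrightarrow> norm (H' t) \<le> M"
    by (rule continuous_norm_bound[OF cont_H']) blast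
  obtain N where N: "N \<ge> 0" "\<And>t. t \<in> {0..1} \<Longrightarrow> norm (h t) \<le> N"
    by (rule continuous_norm_bound[OF cont_h]) blast
  note MN = M(2) N(2) M(1) N(1)
  \<comment> \<open>From Young's inequality for \<open>lam * (u' \<bullet> H')\<close>; half of the
    kinetic term is left to absorb the other summand.\<close>
  define A where "A = Lam\<^sup>2 * M\<^sup>2 / 2"
  \<comment> \<open>Bounds the total change of the energy: \<open>norm (u' t)\<close> is at most
    \<open>1 / 2 + ?J t\<close>, and \<open>?J\<close> has integral at most
    \<open>A\<close>.\<close>
  define B where "B = Lam * N * (1 / 2 + A)"
  define D where "D = (q - 1) * (A + B)"
  \<comment> \<open>Solves \<open>c powr (1 - q) = D + 1\<close>, a value that \<open>V\<close>
    cannot reach, being bounded by \<open>D\<close>.\<close>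
  define c where "c = (D + 1) powr (- 1 / (q - 1))"
  define R where "R = sqrt (2 * (A + B)) + 1"
  have AB: "A \<ge> 0" "B \<ge> 0" "D \<ge> 0" using assms MN q by (auto simp: A_def B_def D_def)
  have c: "c > 0" using AB by (simp add: c_def)
  have R: "R > 0" using AB by (simp add: R_def add_nonneg_pos)
  show ?thesis
  proof (rule that[OF c R])
    fix lam u u' u''
    assume lam: "0 \<le> lam" "lam \<le> Lam" and C2: "C2_derivs u u' u''"
      and u0: "\<And>t. t \<in> {0..1} \<Longrightarrow> u t \<noteq> 0"
      and eq: "\<And>t. t \<in> {0..1} \<Longrightarrow> u'' t - u t /\<^sub>R (norm (u t) powr (q + 1)) = lam *\<^sub>R h t"
      and per: "u 0 = u 1" "u' 0 = u' 1"
    have du: "(u has_vector_derivative u' t) (at t within {0..1})"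
      and du': "(u' has_vector_derivative u'' t) (at t within {0..1})" if "t \<in> {0..1}" for t
      using C2 that by (auto simp: C2_derivs_def)
    have cu: "continuous_on {0..1} u" and cu': "continuous_on {0..1} u'"
      using du du' by (meson continuous_on_eq_continuous_within has_vector_derivative_continuous)+
    have u'': "u'' t = u t /\<^sub>R (norm (u t) powr (q + 1)) + lam *\<^sub>R h t" if "t \<in> {0..1}" for t
      using eq[OF that] by (simp add: algebra_simps)
    have upos: "norm (u t) > 0" if "t \<in> {0..1}" for t using u0[OF that] by simp
    define V where "V t = norm (u t) powr (1 - q)" for t
    have Vpos: "V t > 0" if "t \<in> {0..1}" for t using upos[OF that] by (simp add: V_def)
    have cV: "continuous_on {0..1} V"
      unfolding V_def using u0 by (intro continuous_intros cu) auto
    have Veq: "(u t \<bullet> u t) / (norm (u t) powr (q + 1)) = V t" if "t \<in> {0..1}" for t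
    proof -
      have "u t \<bullet> u t = norm (u t) powr 2" using upos[OF that] by (simp add: dot_square_norm)
      moreover have "norm (u t) powr 2 / (norm (u t) powr (q + 1)) = norm (u t) powr (1 - q)"
        by (simp add: powr_diff[symmetric] del: powr_numeral)
      ultimately show ?thesis by (simp add: V_def)
    qed
    \<comment> \<open>The derivative of \<open>u \<bullet> u' + lam * (u \<bullet> H')\<close>: the
      second summand trades the forcing term for one with \<open>H'\<close>, and periodicity makes
      the integral 0.\<close>
    let ?I = "\<lambda>t. (norm (u' t))\<^sup>2 + V t + lam * (u' t \<bullet> H' t)"
    have "integral {0..1} ?I = (u 1 \<bullet> u' 1 + lam * (u 1 \<bullet> H' 1)) - (u 0 \<bullet> u' 0 + lam * (u 0 \<bullet> H' 0))"
    proof (rule integral_of_derivative)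
      fix t :: real assume t: "t \<in> {0..1}"
      have "((\<lambda>t. u t \<bullet> u' t + lam * (u t \<bullet> H' t)) has_real_derivative
          (u t \<bullet> u'' t + u' t \<bullet> u' t) + lam * (u t \<bullet> (- h t) + u' t \<bullet> H' t)) (at t within {0..1})"
        by (intro DERIV_add DERIV_cmult has_real_derivative_inner du du' H'_deriv t)
      moreover have "(u t \<bullet> u'' t + u' t \<bullet> u' t) + lam * (u t \<bullet> (- h t) + u' t \<bullet> H' t) = ?I t"
        using Veq[OF t] by (simp add: u''[OF t] inner_simps dot_square_norm algebra_simps divide_inverse)
      ultimately show "((\<lambda>t. u t \<bullet> u' t + lam * (u t \<bullet> H' t)) has_real_derivative ?I t) (at t within {0..1})"
        by simp
    qed simp
    then have I0: "integral {0..1} ?I = 0" using per periodic_H' by simp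
    have cI: "continuous_on {0..1} ?I" by (intro continuous_intros cu' cV cont_H')
    have lam0: "lam \<noteq> 0"
    proof
      assume "lam = 0"
      then have "integral {0..1} ?I > 0"
        by (intro integral_pos_if_pos cI) (use Vpos in \<open>auto simp: add_nonneg_pos\<close>)
      then show False using I0 by simp
    qed
    let ?J = "\<lambda>t. (norm (u' t))\<^sup>2 / 2 + V t"
    have cJ: "continuous_on {0..1} ?J" by (intro continuous_intros cu' cV) auto
    have IJ: "?J t - A \<le> ?I t" if t: "t \<in> {0..1}" for t
    proof -
      have "- (lam * (u' t \<bullet> H' t)) \<le> lam * norm (H' t) * norm (u' t)"
        using lam Cauchy_Schwarz_ineq2[of "u' t" "H' t"]
        by (metis abs_le_D2 abs_mult abs_of_nonneg mult.assoc mult.commute mult_left_mono)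
      also have "\<dots> \<le> ((lam * norm (H' t))\<^sup>2 + (norm (u' t))\<^sup>2) / 2"
        using sum_squares_bound[of "lam * norm (H' t)" "norm (u' t)"] by simp
      also have "(lam * norm (H' t))\<^sup>2 \<le> (Lam * M)\<^sup>2"
        using lam MN(1)[OF t] by (intro power_mono mult_mono) auto
      finally show ?thesis by (simp add: A_def power_mult_distrib algebra_simps)
    qed
    have J: "integral {0..1} ?J \<le> A"
    proof -
      have "integral {0..1} (\<lambda>t. ?J t - A) \<le> integral {0..1} ?I"
        using IJ by (intro integral_le integrable_continuous_real cI continuous_intros cJ)
      moreover have "integral {0..1} (\<lambda>t. ?J t - A) = integral {0..1} ?J - A"
        by (subst integral_diff) (auto intro!: integrable_continuous_real cJ)
      ultimately show ?thesis using I0 by simp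
    qed
    \<comment> \<open>The energy of the unforced problem.\<close>
    define E where "E t = (norm (u' t))\<^sup>2 / 2 + V t / (q - 1)" for t
    have dE: "(E has_real_derivative lam * (u' t \<bullet> h t)) (at t within {0..1})" if t: "t \<in> {0..1}" for t
    proof -
      have Ealt: "E = (\<lambda>t. (u' t \<bullet> u' t) / 2 + (u t \<bullet> u t) powr ((1 - q) / 2) / (q - 1))"
        by (simp add: E_def V_def fun_eq_iff norm_powr_inner dot_square_norm)
      have upp: "u t \<bullet> u t > 0" using u0[OF t] by simp
      have "((\<lambda>t. (u t \<bullet> u t) powr ((1 - q) / 2)) has_real_derivative
          (1 - q) / 2 * (u t \<bullet> u t) powr ((1 - q) / 2 - 1) * (u t \<bullet> u' t + u' t \<bullet> u t)) (at t within {0..1})"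
        using DERIV_chain2[OF has_real_derivative_powr[OF upp, of "(1 - q) / 2"] has_real_derivative_inner[OF du[OF t] du[OF t]]] by simp
      moreover have "(u t \<bullet> u t) powr ((1 - q) / 2 - 1) = inverse (norm (u t) powr (q + 1))"
      proof -
        have "(1 - q) / 2 - 1 = - (q + 1) / 2" by (simp add: field_simps)
        then show ?thesis by (simp only: norm_powr_inner[symmetric] powr_minus)
      qed
      ultimately have "(E has_real_derivative (u' t \<bullet> u'' t + u'' t \<bullet> u' t) / 2 +
          (1 - q) / 2 * inverse (norm (u t) powr (q + 1)) * (u t \<bullet> u' t + u' t \<bullet> u t) / (q - 1)) (at t within {0..1})"
        unfolding Ealt by (intro DERIV_add DERIV_cdivide has_real_derivative_inner du' t) simp
      moreover have "(u' t \<bullet> u'' t + u'' t \<bullet> u' t) / 2 +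
          (1 - q) / 2 * inverse (norm (u t) powr (q + 1)) * (u t \<bullet> u' t + u' t \<bullet> u t) / (q - 1) = lam * (u' t \<bullet> h t)"
      proof -
        have 1: "u' t \<bullet> u'' t = inverse (norm (u t) powr (q + 1)) * (u t \<bullet> u' t) + lam * (u' t \<bullet> h t)"
          by (simp add: u''[OF t] inner_add_right inner_commute)
        have 2: "(1 - q) / 2 * P * (w + w) / (q - 1) = - (P * w)" for P w
        proof -
          have "(1 - q) / 2 * P * (w + w) = - (P * w) * (q - 1)" by (simp add: field_simps)
          then show ?thesis using q by (subst nonzero_divide_eq_eq) auto
        qed
        show ?thesis using 1 2[of "inverse (norm (u t) powr (q + 1))" "u t \<bullet> u' t"]
          by (simp add: inner_commute[of "u'' t"] inner_commute[of "u' t" "u t"] add_divide_distrib)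
      qed
      ultimately show ?thesis by simp
    qed
    have E_osc: "E t \<le> E s + B" if ts: "t \<in> {0..1}" "s \<in> {0..1}" for s t
    proof -
      have cEd: "continuous_on {0..1} (\<lambda>t. lam * (u' t \<bullet> h t))" by (intro continuous_intros cu' cont_h)
      have cJ': "continuous_on {0..1} (\<lambda>r. Lam * N * (1 / 2 + ?J r))"
        by (intro continuous_on_mult_left continuous_on_add continuous_on_const cJ)
      have bnd: "\<bar>lam * (u' r \<bullet> h r)\<bar> \<le> Lam * N * (1 / 2 + ?J r)" if r: "r \<in> {0..1}" for r
      proof -
        have "\<bar>lam * (u' r \<bullet> h r)\<bar> \<le> lam * (norm (u' r) * norm (h r))"
          using lam Cauchy_Schwarz_ineq2[of "u' r" "h r"] by (simp add: abs_mult mult_left_mono)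
        also have "\<dots> \<le> Lam * ((1 / 2 + ?J r) * N)"
        proof (intro mult_mono lam)
          show "norm (u' r) \<le> 1 / 2 + ?J r"
            using sum_squares_bound[of 1 "norm (u' r)"] Vpos[OF r] by simp
        qed (use MN r lam Vpos[OF r] in \<open>auto simp: add_nonneg_nonneg\<close>)
        finally show ?thesis by (simp add: mult_ac)
      qed
      have "\<bar>E b - E a\<bar> \<le> B" if ab: "a \<in> {0..1}" "b \<in> {0..1}" "a \<le> b" for a b
      proof -
        have sub: "{a..b} \<subseteq> {0..1}" using ab by auto
        have "E b - E a = integral {a..b} (\<lambda>t. lam * (u' t \<bullet> h t))"
          by (rule integral_of_derivative[symmetric, OF DERIV_subset[OF dE sub]])
            (use ab sub in auto)
        also have "\<bar>\<dots>\<bar> \<le> integral {a..b} (\<lambda>r. Lam * N * (1 / 2 + ?J r))"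
        proof (subst real_norm_def[symmetric], rule integral_norm_bound_integral)
          show "(\<lambda>t. lam * (u' t \<bullet> h t)) integrable_on {a..b}"
            using continuous_on_subset[OF cEd sub] by (rule integrable_continuous_real)
          show "(\<lambda>r. Lam * N * (1 / 2 + ?J r)) integrable_on {a..b}"
            using continuous_on_subset[OF cJ' sub] by (rule integrable_continuous_real)
          show "norm (lam * (u' r \<bullet> h r)) \<le> Lam * N * (1 / 2 + ?J r)" if "r \<in> {a..b}" for r
            using bnd[of r] that sub by auto
        qed
        also have "\<dots> \<le> integral {0..1} (\<lambda>r. Lam * N * (1 / 2 + ?J r))"
        proof (rule integral_subset_le[OF sub])
          show "(\<lambda>r. Lam * N * (1 / 2 + ?J r)) integrable_on {a..b}"
            using continuous_on_subset[OF cJ' sub] by (rule integrable_continuous_real)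
          show "(\<lambda>r. Lam * N * (1 / 2 + ?J r)) integrable_on {0..1}"
            using cJ' by (rule integrable_continuous_real)
          show "\<forall>r\<in>{0..1}. 0 \<le> Lam * N * (1 / 2 + ?J r)"
            using Vpos assms MN(4) by (intro ballI mult_nonneg_nonneg add_nonneg_nonneg) (auto intro: less_imp_le)
        qed
        also have "\<dots> = Lam * N * (1 / 2 + integral {0..1} ?J)"
        proof -
          have "integral {0..1} (\<lambda>r. 1 / 2 + ?J r) = 1 / 2 + integral {0..1} ?J"
            by (subst Henstock_Kurzweil_Integration.integral_add) (auto intro!: integrable_continuous_real cJ)
          then show ?thesis by simp
        qed
        also have "\<dots> \<le> B" unfolding B_def using J assms MN(4) by (intro mult_left_mono) auto
        finally show ?thesis .
      qed
      from this[of s t] this[of t s] ts show ?thesis by (cases "s \<le> t") (auto simp: abs_le_iff)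
    qed
    have cE: "continuous_on {0..1} E" unfolding E_def by (intro continuous_intros cu' cV) (use q in auto)
    \<comment> \<open>Averages \<open>E t - B \<le> E s \<le> ?J s\<close> over \<open>s\<close>;
      the second inequality uses \<open>q - 1 \<ge> 1\<close>.\<close>
    have E_le: "E t \<le> A + B" if t: "t \<in> {0..1}" for t
    proof -
      have "integral {0..1::real} (\<lambda>s. E t - B) \<le> integral {0..1} ?J"
      proof (rule integral_le)
        show "E t - B \<le> ?J s" if s: "s \<in> {0..1}" for s
        proof -
          have "V s / (q - 1) \<le> V s" using Vpos[OF s] q by (simp add: divide_le_eq)
          then show ?thesis using E_osc[OF t s] by (simp add: E_def)
        qed
      qed (auto intro!: integrable_continuous_real cJ)
      then show ?thesis using J by simp
    qed
    have c_le: "c \<le> norm (u t)" if t: "t \<in> {0..1}" for t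
    proof (rule ccontr)
      assume "\<not> ?thesis"
      then have "c powr (1 - q) \<le> norm (u t) powr (1 - q)"
        using upos[OF t] q by (intro powr_mono2') auto
      also have "c powr (1 - q) = D + 1"
      proof -
        have "- 1 / (q - 1) * (1 - q) = 1" using q by (simp add: field_simps)
        then show ?thesis unfolding c_def powr_powr using AB by simp
      qed
      also have "norm (u t) powr (1 - q) = (q - 1) * (V t / (q - 1))" using q by (simp add: V_def)
      also have "\<dots> \<le> (q - 1) * E t" using q by (intro mult_left_mono) (auto simp: E_def)
      also have "\<dots> \<le> D" unfolding D_def using q E_le[OF t] by (intro mult_left_mono) auto
      finally show False by simp
    qed
    have u'_le: "norm (u' t) \<le> sqrt (2 * (A + B))" if t: "t \<in> {0..1}" for t
    proof (rule real_le_rsqrt)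
      have "V t / (q - 1) \<ge> 0" using Vpos[OF t] q by simp
      then show "(norm (u' t))\<^sup>2 \<le> 2 * (A + B)" using E_le[OF t] by (simp add: E_def)
    qed
    have osc: "norm (u t - u 0) \<le> sqrt (2 * (A + B))" if t: "t \<in> {0..1}" for t
    proof -
      have "norm (u t - u 0) \<le> sqrt (2 * (A + B)) * norm (t - 0)"
      proof (rule differentiable_bound[where S = "{0..1}"])
        show "\<And>x. x \<in> {0..1} \<Longrightarrow> (u has_derivative (\<lambda>s. s *\<^sub>R u' x)) (at x within {0..1})"
          using du by (simp add: has_vector_derivative_def)
        show "onorm (\<lambda>s. s *\<^sub>R u' x) \<le> sqrt (2 * (A + B))" if "x \<in> {0..1}" for x
          using u'_le[OF that] onorm_scaleR_left[OF bounded_linear_ident, of "u' x"] by (simp add: onorm_id)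
      qed (use t in auto)
      also have "\<dots> \<le> sqrt (2 * (A + B)) * 1" using t AB by (intro mult_left_mono) auto
      finally show ?thesis by simp
    qed
    have "norm (u 0) \<le> sqrt (2 * (A + B))"
    proof (rule ccontr)
      \<comment> \<open>The curve then moves by less than \<open>norm (u 0)\<close>, so it stays in
        the open half plane around \<open>u 0\<close>, and so does the force. Its mean could not
        vanish, whereas integrating the equation over a period shows that it does.\<close>
      assume far: "\<not> ?thesis"
      have pos: "u t \<bullet> u 0 > 0" if t: "t \<in> {0..1}" for t
      proof -
        have "u t \<bullet> u 0 = (norm (u 0))\<^sup>2 + (u t - u 0) \<bullet> u 0"
          by (simp add: inner_diff_left dot_square_norm)
        moreover have "- ((u t - u 0) \<bullet> u 0) \<le> norm (u t - u 0) * norm (u 0)"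
          using Cauchy_Schwarz_ineq2[of "u t - u 0" "u 0"] by simp
        moreover have "norm (u t - u 0) * norm (u 0) < (norm (u 0))\<^sup>2"
          unfolding power2_eq_square using osc[OF t] far upos[of 0] by (intro mult_strict_right_mono) auto
        ultimately show ?thesis by linarith
      qed
      let ?K = "\<lambda>t. u t /\<^sub>R (norm (u t) powr (q + 1))"
      have cK: "continuous_on {0..1} ?K"
        using u0 by (intro continuous_intros cu) auto
      have "(u'' has_integral u' 1 - u' 0) {0..1}"
        by (rule fundamental_theorem_of_calculus) (use du' in auto)
      then have "integral {0..1} u'' = 0" using per by (auto dest: integral_unique)
      moreover have "integral {0..1} u'' = integral {0..1} (\<lambda>t. ?K t + lam *\<^sub>R h t)"
        by (rule Henstock_Kurzweil_Integration.integral_cong) (rule u'')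
      moreover have "\<dots> = integral {0..1} ?K + lam *\<^sub>R integral {0..1} h"
        by (subst Henstock_Kurzweil_Integration.integral_add)
          (auto intro!: integrable_continuous_real cK continuous_intros cont_h)
      ultimately have K0: "integral {0..1} ?K = 0" by (simp add: integral_h)
      have "integral {0..1} (\<lambda>t. ?K t \<bullet> u 0) > 0"
        by (intro integral_pos_if_pos continuous_intros cK) (use pos upos in \<open>auto simp: zero_less_mult_iff\<close>)
      moreover have "integral {0..1} (\<lambda>t. ?K t \<bullet> u 0) = integral {0..1} ?K \<bullet> u 0"
        using integral_linear[OF integrable_continuous_real[OF cK] bounded_linear_inner_left[of "u 0"]]
        by (simp add: o_def)
      ultimately show False using K0 by simp
    qed
    then have "norm (u 0) \<le> R" by (simp add: R_def)
    moreover have "norm (u' 0) \<le> R" using u'_le[of 0] by (simp add: R_def)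
    ultimately show "lam \<noteq> 0 \<and> (\<forall>t\<in>{0..1}. c \<le> norm (u t)) \<and> norm (u 0) \<le> R \<and> norm (u' 0) \<le> R"
      using lam0 c_le by blast
  qed
qed

end

section \<open>The averaged force field and its potential\<close>

lemma norm_powr_line_derivative:
  fixes y e :: "'a::real_inner"
  assumes "y + s *\<^sub>R e \<noteq> 0"
  shows "((\<lambda>s. norm (y + s *\<^sub>R e) powr p) has_real_derivative
    p * norm (y + s *\<^sub>R e) powr (p - 2) * ((y + s *\<^sub>R e) \<bullet> e)) (at s within S)"
proof -
  have d: "((\<lambda>s. y + s *\<^sub>R e) has_vector_derivative e) (at s within S)"
    by (auto intro!: derivative_eq_intros)
  have pos: "(y + s *\<^sub>R e) \<bullet> (y + s *\<^sub>R e) > 0" using assms by simp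
  have "((\<lambda>s. ((y + s *\<^sub>R e) \<bullet> (y + s *\<^sub>R e)) powr (p / 2)) has_real_derivative
      p / 2 * ((y + s *\<^sub>R e) \<bullet> (y + s *\<^sub>R e)) powr (p / 2 - 1) * ((y + s *\<^sub>R e) \<bullet> e + e \<bullet> (y + s *\<^sub>R e)))
      (at s within S)"
    by (rule DERIV_chain2[OF has_real_derivative_powr[OF pos] has_real_derivative_inner[OF d d]])
  moreover have "((y + s *\<^sub>R e) \<bullet> (y + s *\<^sub>R e)) powr (p / 2 - 1) = norm (y + s *\<^sub>R e) powr (p - 2)"
    by (simp add: norm_powr_inner diff_divide_distrib)
  ultimately show ?thesis
    by (simp add: norm_powr_inner[of _ p] inner_commute[of e] mult.assoc)
qed

lemma continuous_on_norm_powr: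
  fixes f :: "'b::topological_space \<Rightarrow> 'a::real_normed_vector"
  assumes "continuous_on S f" "\<And>x. x \<in> S \<Longrightarrow> f x \<noteq> 0"
  shows "continuous_on S (\<lambda>x. norm (f x) powr p)"
  using assms by (intro continuous_intros) auto

lemma leibniz_line:
  fixes f f' :: "complex \<Rightarrow> real" and H :: "real \<Rightarrow> complex"
  assumes H: "continuous_on {0..1} H" and x: "x \<notin> H ` {0..1}"
    and der: "\<And>y s. y + s *\<^sub>R e \<noteq> 0 \<Longrightarrow>
      ((\<lambda>s. f (y + s *\<^sub>R e)) has_real_derivative f' (y + s *\<^sub>R e)) (at s)"
    and contf: "continuous_on (- {0}) f" and contf': "continuous_on (- {0}) f'"
  shows "((\<lambda>s. integral {0..1} (\<lambda>t. f (x + s *\<^sub>R e - H t))) has_real_derivative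
    integral {0..1} (\<lambda>t. f' (x - H t))) (at 0)"
proof -
  have "compact (H ` {0..1})" using H by (intro compact_continuous_image) auto
  then have "open (- (H ` {0..1}))" by (simp add: compact_imp_closed open_Compl)
  then obtain r where r: "r > 0" "ball x r \<subseteq> - (H ` {0..1})" using x open_contains_ball by blast
  \<comment> \<open>Keeps the segment inside the ball that misses the curve; adding 1 to
    \<open>norm e\<close> covers \<open>e = 0\<close>.\<close>
  define \<epsilon> where "\<epsilon> = r / (norm e + 1)"
  have e: "\<epsilon> > 0" using r by (simp add: \<epsilon>_def add_nonneg_pos)
  define U where "U = {- \<epsilon> <..< \<epsilon>}"
  have av: "x + s *\<^sub>R e - H t \<noteq> 0" if "s \<in> U" "t \<in> {0..1}" for s t
  proof -
    have "norm (s *\<^sub>R e) \<le> \<epsilon> * norm e" using that by (auto simp: U_def intro!: mult_right_mono)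
    also have "\<dots> < \<epsilon> * (norm e + 1)" using e by simp
    also have "\<dots> = r" by (simp add: \<epsilon>_def add_nonneg_eq_0_iff)
    finally have "x + s *\<^sub>R e \<in> ball x r" by (simp add: dist_norm)
    then show ?thesis using r(2) that(2) by auto
  qed
  have "((\<lambda>s. integral (cbox 0 1) (\<lambda>t. f (x + s *\<^sub>R e - H t))) has_real_derivative
      integral (cbox 0 1) (\<lambda>t. f' (x + 0 *\<^sub>R e - H t))) (at 0 within U)"
  proof (rule leibniz_rule_field_derivative[where f = "\<lambda>s t. f (x + s *\<^sub>R e - H t)" and fx = "\<lambda>s t. f' (x + s *\<^sub>R e - H t)"])
    show "((\<lambda>s. f (x + s *\<^sub>R e - H t)) has_real_derivative f' (x + s *\<^sub>R e - H t)) (at s within U)"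
      if "s \<in> U" "t \<in> cbox 0 1" for s t
    proof -
      have "x - H t + s *\<^sub>R e \<noteq> 0" using av[of s t] that by (simp add: algebra_simps)
      from has_field_derivative_at_within[OF der[OF this], of U] show ?thesis
        by (simp add: algebra_simps)
    qed
    show "(\<lambda>t. f (x + s *\<^sub>R e - H t)) integrable_on cbox 0 1" if "s \<in> U" for s
    proof (rule integrable_continuous)
      show "continuous_on (cbox 0 1) (\<lambda>t. f (x + s *\<^sub>R e - H t))"
        by (rule continuous_on_compose2[OF contf]) (use av that H in \<open>auto intro!: continuous_intros\<close>)
    qed
    have cH: "continuous_on (U \<times> cbox 0 1) (\<lambda>p. H (snd p))"
      by (rule continuous_on_compose2[OF H]) (auto intro!: continuous_intros)
    have "continuous_on (U \<times> cbox 0 1) (\<lambda>p. f' (x + fst p *\<^sub>R e - H (snd p)))"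
      by (rule continuous_on_compose2[OF contf']) (use av cH in \<open>auto intro!: continuous_intros\<close>)
    then show "continuous_on (U \<times> cbox 0 1) (\<lambda>(s, t). f' (x + s *\<^sub>R e - H t))"
      by (simp add: split_beta)
  qed (use e in \<open>auto simp: U_def\<close>)
  moreover have "at 0 within U = at 0" using e by (intro at_within_open) (auto simp: U_def)
  ultimately show ?thesis by simp
qed

lemma continuous_parametric_integral:
  fixes f :: "complex \<Rightarrow> 'a::euclidean_space" and H :: "real \<Rightarrow> complex"
  assumes H: "continuous_on {0..1} H" and contf: "continuous_on (- {0}) f"
  shows "continuous_on (- (H ` {0..1})) (\<lambda>x. integral {0..1} (\<lambda>t. f (x - H t)))"
proof -
  have cH: "continuous_on ((- (H ` {0..1})) \<times> cbox 0 1) (\<lambda>p. H (snd p))"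
    by (rule continuous_on_compose2[OF H]) (auto intro!: continuous_intros)
  have "continuous_on ((- (H ` {0..1})) \<times> cbox 0 1) (\<lambda>p. f (fst p - H (snd p)))"
    by (rule continuous_on_compose2[OF contf]) (use cH in \<open>auto intro!: continuous_intros\<close>)
  then have "continuous_on (- (H ` {0..1})) (\<lambda>x. integral (cbox 0 1) (\<lambda>t. f (x - H t)))"
    by (intro integral_continuous_on_param) (simp add: split_beta)
  then show ?thesis by simp
qed

context forced_problem
begin

definition force :: "complex \<Rightarrow> complex" where
  "force u = norm u powr (- (q + 1)) *\<^sub>R u"

definition field :: "complex \<Rightarrow> complex" where
  "field x = integral {0..1} (\<lambda>t. force (x - H t))"

definition pot :: "complex \<Rightarrow> real" where
  "pot x = integral {0..1} (\<lambda>t. norm (x - H t) powr (1 - q))"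

text \<open>The diagonal entry in direction \<open>e\<close> of the derivative of
  \<open>force\<close>; over an orthonormal pair these entries add up to the divergence.\<close>

definition hess :: "complex \<Rightarrow> complex \<Rightarrow> real" where
  "hess e u = norm u powr (- (q + 1)) * (e \<bullet> e) - (q + 1) * norm u powr (- (q + 3)) * (u \<bullet> e)\<^sup>2"

definition field_deriv :: "complex \<Rightarrow> complex \<Rightarrow> real" where
  "field_deriv e x = integral {0..1} (\<lambda>t. hess e (x - H t))"

lemma force_eq: "force u = u /\<^sub>R (norm u powr (q + 1))"
  by (simp add: force_def powr_minus[symmetric])

lemma cut_force_far: "d \<le> norm u \<Longrightarrow> cut_force q d u = force u"
  by (simp add: cut_force_eq force_eq)

lemma force_continuous: "continuous_on (- {0}) force"
  unfolding force_def by (intro continuous_intros) auto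

lemma hess_continuous: "continuous_on (- {0}) (hess e)"
  unfolding hess_def by (intro continuous_intros) auto

lemma H_image: "path_image H = H ` {0..1}"
  by (simp add: path_image_def)

lemma H_image_topology: "compact (H ` {0..1})" "closed (H ` {0..1})" "open (- (H ` {0..1}))"
proof -
  show c: "compact (H ` {0..1})" using cont_H by (intro compact_continuous_image) auto
  then show "closed (H ` {0..1})" "open (- (H ` {0..1}))" by (simp_all add: compact_imp_closed open_Compl)
qed

lemma integrable_along_H:
  assumes "continuous_on (- {0}) (f :: complex \<Rightarrow> 'a::euclidean_space)" "x \<notin> H ` {0..1}"
  shows "(\<lambda>t. f (x - H t)) integrable_on {0..1}" "continuous_on {0..1} (\<lambda>t. f (x - H t))"
proof -
  show c: "continuous_on {0..1} (\<lambda>t. f (x - H t))"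
    by (rule continuous_on_compose2[OF assms(1)]) (use assms(2) cont_H in \<open>auto intro!: continuous_intros\<close>)
  show "(\<lambda>t. f (x - H t)) integrable_on {0..1}" by (rule integrable_continuous_real[OF c])
qed

lemma pot_continuous: "continuous_on (- (H ` {0..1})) pot"
  unfolding pot_def
  by (rule continuous_parametric_integral[OF cont_H]) (intro continuous_on_norm_powr continuous_intros; simp)

lemma field_continuous: "continuous_on (- (H ` {0..1})) field"
  unfolding field_def by (rule continuous_parametric_integral[OF cont_H force_continuous])

lemma field_deriv_continuous: "continuous_on (- (H ` {0..1})) (field_deriv e)"
  unfolding field_deriv_def by (rule continuous_parametric_integral[OF cont_H hess_continuous])

lemma field_inner:
  assumes "x \<notin> H ` {0..1}"
  shows "field x \<bullet> e = integral {0..1} (\<lambda>t. force (x - H t) \<bullet> e)"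
  using integral_linear[OF integrable_along_H(1)[OF force_continuous assms] bounded_linear_inner_left[of e]]
  by (simp add: o_def field_def)

lemma pot_line_derivative_0:
  assumes "x \<notin> H ` {0..1}"
  shows "((\<lambda>s. pot (x + s *\<^sub>R e)) has_real_derivative (1 - q) * (field x \<bullet> e)) (at 0)"
proof -
  have "((\<lambda>s. integral {0..1} (\<lambda>t. norm (x + s *\<^sub>R e - H t) powr (1 - q))) has_real_derivative
      integral {0..1} (\<lambda>t. (1 - q) * (force (x - H t) \<bullet> e))) (at 0)"
  proof (rule leibniz_line[OF cont_H assms, where f = "\<lambda>u. norm u powr (1 - q)" and f' = "\<lambda>u. (1 - q) * (force u \<bullet> e)"])
    fix y :: complex and s :: real assume "y + s *\<^sub>R e \<noteq> 0"
    then show "((\<lambda>s. norm (y + s *\<^sub>R e) powr (1 - q)) has_real_derivative (1 - q) * (force (y + s *\<^sub>R e) \<bullet> e)) (at s)"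
      using norm_powr_line_derivative[of y s e "1 - q" UNIV] by (simp add: force_def algebra_simps)
  qed (intro continuous_on_norm_powr continuous_intros force_continuous; simp)+
  then show ?thesis by (simp add: pot_def field_inner[OF assms])
qed

lemma field_line_derivative_0:
  assumes "x \<notin> H ` {0..1}"
  shows "((\<lambda>s. field (x + s *\<^sub>R e) \<bullet> e) has_real_derivative field_deriv e x) (at 0)"
proof -
  have "((\<lambda>s. integral {0..1} (\<lambda>t. force (x + s *\<^sub>R e - H t) \<bullet> e)) has_real_derivative
      integral {0..1} (\<lambda>t. hess e (x - H t))) (at 0)"
  proof (rule leibniz_line[OF cont_H assms, where f = "\<lambda>u. force u \<bullet> e" and f' = "hess e"])
    fix y :: complex and s :: real assume nz: "y + s *\<^sub>R e \<noteq> 0"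
    have 1: "((\<lambda>s. (y + s *\<^sub>R e) \<bullet> e) has_real_derivative e \<bullet> e) (at s)"
      by (auto simp: inner_simps intro!: derivative_eq_intros)
    have "- (q + 1) - 2 = - (q + 3)" by simp
    then have "((\<lambda>s. norm (y + s *\<^sub>R e) powr (- (q + 1)) * ((y + s *\<^sub>R e) \<bullet> e)) has_real_derivative
        (- (q + 1) * norm (y + s *\<^sub>R e) powr (- (q + 3)) * ((y + s *\<^sub>R e) \<bullet> e)) * ((y + s *\<^sub>R e) \<bullet> e) +
        (e \<bullet> e) * norm (y + s *\<^sub>R e) powr (- (q + 1))) (at s)"
      using DERIV_mult[OF norm_powr_line_derivative[OF nz, of "- (q + 1)" UNIV] 1] by (simp only:)
    then show "((\<lambda>s. force (y + s *\<^sub>R e) \<bullet> e) has_real_derivative hess e (y + s *\<^sub>R e)) (at s)"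
      by (simp add: force_def hess_def power2_eq_square algebra_simps)
  qed (intro continuous_intros force_continuous hess_continuous)+
  then have d: "((\<lambda>s. integral {0..1} (\<lambda>t. force (x + s *\<^sub>R e - H t) \<bullet> e)) has_real_derivative field_deriv e x) (at 0)"
    by (simp only: field_deriv_def)
  have ev: "\<forall>\<^sub>F s in nhds 0. integral {0..1} (\<lambda>t. force (x + s *\<^sub>R e - H t) \<bullet> e) = field (x + s *\<^sub>R e) \<bullet> e"
  proof -
    have "((\<lambda>s. x + s *\<^sub>R e) \<longlongrightarrow> x + 0 *\<^sub>R e) (nhds 0)"
      by (intro tendsto_intros filterlim_ident)
    moreover have "\<forall>\<^sub>F y in nhds x. y \<in> - (H ` {0..1})"
      using assms H_image_topology(3) by (intro eventually_nhds_in_open) auto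
    ultimately have "\<forall>\<^sub>F s in nhds 0. x + s *\<^sub>R e \<in> - (H ` {0..1})"
      by (auto simp: filterlim_iff)
    then show ?thesis by eventually_elim (use field_inner in auto)
  qed
  show ?thesis using d DERIV_cong_ev[OF refl ev refl] by blast
qed

lemma pot_line_derivative:
  assumes "x + s *\<^sub>R e \<notin> H ` {0..1}"
  shows "((\<lambda>s. pot (x + s *\<^sub>R e)) has_real_derivative (1 - q) * (field (x + s *\<^sub>R e) \<bullet> e)) (at s)"
proof -
  have "((\<lambda>r. pot (x + (r + s) *\<^sub>R e)) has_real_derivative (1 - q) * (field (x + s *\<^sub>R e) \<bullet> e)) (at 0)"
    using pot_line_derivative_0[OF assms, of e] by (simp add: algebra_simps)
  then show ?thesis using DERIV_shift[of "\<lambda>s. pot (x + s *\<^sub>R e)" _ 0 s] by simp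
qed

lemma field_line_derivative:
  assumes "x + s *\<^sub>R e \<notin> H ` {0..1}"
  shows "((\<lambda>s. field (x + s *\<^sub>R e) \<bullet> e) has_real_derivative field_deriv e (x + s *\<^sub>R e)) (at s)"
proof -
  have "((\<lambda>r. field (x + (r + s) *\<^sub>R e) \<bullet> e) has_real_derivative field_deriv e (x + s *\<^sub>R e)) (at 0)"
    using field_line_derivative_0[OF assms, of e] by (simp add: algebra_simps)
  then show ?thesis using DERIV_shift[of "\<lambda>s. field (x + s *\<^sub>R e) \<bullet> e" _ 0 s] by simp
qed

text \<open>In the plane the divergence of \<open>force u\<close> is
  \<open>(2 - (q + 1)) * norm u powr (- (q + 1))\<close>, which is negative, and averaging along the
  curve keeps the sign. This is the strict subharmonicity of \<open>pot\<close>.\<close>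

lemma field_trace_neg:
  assumes "x \<notin> H ` {0..1}"
  shows "field_deriv 1 x + field_deriv \<i> x < 0"
proof -
  have hs: "hess 1 u + hess \<i> u = - ((q - 1) * norm u powr (- (q + 1)))" if "u \<noteq> 0" for u
  proof -
    have "norm u powr (- (q + 3)) * (norm u)\<^sup>2 = norm u powr (- (q + 3)) * norm u powr 2"
      using that by simp
    also have "\<dots> = norm u powr (- (q + 3) + 2)" by (rule powr_add[symmetric])
    also have "- (q + 3) + 2 = - (q + 1)" by simp
    finally have *: "norm u powr (- (q + 3)) * (norm u)\<^sup>2 = norm u powr (- (q + 1))" .
    have "(u \<bullet> 1)\<^sup>2 + (u \<bullet> \<i>)\<^sup>2 = (norm u)\<^sup>2"
      by (simp add: cmod_power2 inner_complex_def)
    moreover have "(1::complex) \<bullet> 1 = 1" "\<i> \<bullet> \<i> = 1" by (simp_all add: inner_complex_def)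
    then have "hess 1 u + hess \<i> u = 2 * norm u powr (- (q + 1)) -
        (q + 1) * (norm u powr (- (q + 3)) * ((u \<bullet> 1)\<^sup>2 + (u \<bullet> \<i>)\<^sup>2))"
      unfolding hess_def by (simp only:) (simp add: algebra_simps)
    ultimately have "hess 1 u + hess \<i> u = 2 * norm u powr (- (q + 1)) - (q + 1) * norm u powr (- (q + 1))"
      by (simp only: *)
    then show ?thesis by (simp add: algebra_simps)
  qed
  have nz: "x - H t \<noteq> 0" if "t \<in> {0..1}" for t using assms that by auto
  have "field_deriv 1 x + field_deriv \<i> x = integral {0..1} (\<lambda>t. hess 1 (x - H t) + hess \<i> (x - H t))"
    unfolding field_deriv_def
    by (subst Henstock_Kurzweil_Integration.integral_add) (auto intro!: integrable_along_H hess_continuous assms)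
  also have "\<dots> = integral {0..1} (\<lambda>t. - ((q - 1) * norm (x - H t) powr (- (q + 1))))"
    by (intro Henstock_Kurzweil_Integration.integral_cong hs nz)
  also have "\<dots> = - integral {0..1} (\<lambda>t. (q - 1) * norm (x - H t) powr (- (q + 1)))" by simp
  also have "\<dots> < 0"
  proof -
    have "integral {0..1} (\<lambda>t. (q - 1) * norm (x - H t) powr (- (q + 1))) > 0"
      using nz q by (intro integral_pos_if_pos continuous_intros continuous_on_norm_powr cont_H) auto
    then show ?thesis by simp
  qed
  finally show ?thesis .
qed

text \<open>At distance at least \<open>r\<close> from the curve, \<open>force\<close> coincides
  with \<open>cut_force q r\<close>, whose Lipschitz estimate is global; the segment from
  \<open>x\<close> to \<open>y\<close> is therefore free to come close to the curve.\<close>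

lemma field_lipschitz:
  assumes "r > 0"
  obtains L where "L > 0" "\<And>x y. \<lbrakk>\<And>t. t \<in> {0..1} \<Longrightarrow> r \<le> norm (x - H t); \<And>t. t \<in> {0..1} \<Longrightarrow> r \<le> norm (y - H t)\<rbrakk>
    \<Longrightarrow> norm (field x - field y) \<le> L * norm (x - y)"
proof (rule that[of "(q + 2) * r powr (- (q + 1))"])
  show "(q + 2) * r powr (- (q + 1)) > 0" using q assms by simp
  fix x y assume x: "\<And>t. t \<in> {0..1} \<Longrightarrow> r \<le> norm (x - H t)" and y: "\<And>t. t \<in> {0..1} \<Longrightarrow> r \<le> norm (y - H t)"
  have xy: "x \<notin> H ` {0..1}" "y \<notin> H ` {0..1}" using x y assms by fastforce+
  have "field x - field y = integral {0..1} (\<lambda>t. force (x - H t) - force (y - H t))"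
    unfolding field_def by (subst integral_diff) (auto intro!: integrable_along_H force_continuous xy)
  also have "norm \<dots> \<le> ((q + 2) * r powr (- (q + 1)) * norm (x - y)) * (1 - 0)"
  proof (rule integral_bound)
    show "continuous_on {0..1} (\<lambda>t. force (x - H t) - force (y - H t))"
      by (intro continuous_intros integrable_along_H force_continuous xy)
    show "norm (force (x - H t) - force (y - H t)) \<le> (q + 2) * r powr (- (q + 1)) * norm (x - y)"
      if "t \<in> {0..1}" for t
      using cut_force_lipschitz[of q r "x - H t" "y - H t"] q assms
      by (simp add: cut_force_far[OF x[OF that]] cut_force_far[OF y[OF that]])
  qed simp
  finally show "norm (field x - field y) \<le> (q + 2) * r powr (- (q + 1)) * norm (x - y)" by simp
qed

text \<open>At a maximum \<open>field\<close> vanishes. If \<open>field_deriv v x\<close> were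
  negative, \<open>field\<close> would point against \<open>v\<close> just beyond \<open>x\<close>,
  and \<open>pot\<close> would grow there. So both diagonal entries are nonnegative, against
  \<open>field_trace_neg\<close>.\<close>

lemma pot_not_local_max:
  assumes x: "x \<notin> H ` {0..1}" and r: "r > 0" and max: "\<And>y. y \<in> ball x r \<Longrightarrow> pot y \<le> pot x"
  shows False
proof -
  have near: "\<exists>e>0. \<forall>s. \<bar>s\<bar> < e \<longrightarrow> x + s *\<^sub>R v \<in> ball x r \<and> x + s *\<^sub>R v \<notin> H ` {0..1}" for v
  proof -
    have "open (ball x r \<inter> - (H ` {0..1}))" "x \<in> ball x r \<inter> - (H ` {0..1})"
      using H_image_topology(3) x r by (simp_all add: open_Int)
    then obtain r' where r': "r' > 0" "ball x r' \<subseteq> ball x r \<inter> - (H ` {0..1})"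
      by (meson open_contains_ball)
    have "x + s *\<^sub>R v \<in> ball x r \<inter> - (H ` {0..1})" if "\<bar>s\<bar> < r' / (norm v + 1)" for s
    proof -
      have "norm (s *\<^sub>R v) \<le> \<bar>s\<bar> * (norm v + 1)" by (simp add: mult_left_mono)
      also have "\<dots> < r'" using that by (simp add: less_divide_eq add_nonneg_pos)
      finally have "x + s *\<^sub>R v \<in> ball x r'" by (simp add: dist_norm)
      then show ?thesis using r'(2) by blast
    qed
    then show ?thesis using r'(1) by (intro exI[of _ "r' / (norm v + 1)"]) (auto simp: add_nonneg_pos)
  qed
  have crit: "field x \<bullet> v = 0" for v
  proof -
    obtain e where e: "e > 0" "\<forall>s. \<bar>s\<bar> < e \<longrightarrow> x + s *\<^sub>R v \<in> ball x r" using near by blast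
    have "(1 - q) * (field x \<bullet> v) = 0"
      by (rule DERIV_local_max[OF pot_line_derivative_0[OF x] e(1)]) (use e max in auto)
    then show ?thesis using q by simp
  qed
  have no: "field_deriv v x \<ge> 0" for v
  proof (rule ccontr)
    assume "\<not> ?thesis"
    then obtain d where d: "d > 0" "\<And>s. 0 < s \<Longrightarrow> s < d \<Longrightarrow> field (x + s *\<^sub>R v) \<bullet> v < 0"
      using DERIV_neg_dec_right[OF field_line_derivative_0[OF x, of v]] by (auto simp: crit)
    obtain e where e: "e > 0" "\<forall>s. \<bar>s\<bar> < e \<longrightarrow> x + s *\<^sub>R v \<in> ball x r \<and> x + s *\<^sub>R v \<notin> H ` {0..1}"
      using near by blast
    define s where "s = min d e / 2"
    have s: "s > 0" "s < d" "s < e" using d e by (auto simp: s_def)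
    have dr: "((\<lambda>s. pot (x + s *\<^sub>R v)) has_real_derivative (1 - q) * (field (x + z *\<^sub>R v) \<bullet> v)) (at z)"
      if "0 \<le> z" "z \<le> s" for z
      by (rule pot_line_derivative) (use e s that in auto)
    obtain z where z: "0 < z" "z < s" "pot (x + s *\<^sub>R v) - pot (x + 0 *\<^sub>R v) = (s - 0) * ((1 - q) * (field (x + z *\<^sub>R v) \<bullet> v))"
      using MVT2[OF s(1) dr] by blast
    have "(1 - q) * (field (x + z *\<^sub>R v) \<bullet> v) > 0"
      using d(2)[of z] z s q by (intro mult_neg_neg) auto
    then have "(s - 0) * ((1 - q) * (field (x + z *\<^sub>R v) \<bullet> v)) > 0" using s(1) by simp
    then have "pot (x + s *\<^sub>R v) > pot x" unfolding z(3)[symmetric] by simp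
    moreover have "x + s *\<^sub>R v \<in> ball x r" using e s by auto
    ultimately show False using max by force
  qed
  show False using field_trace_neg[OF x] no[of 1] no[of \<i>] by linarith
qed

end

text \<open>The range of \<open>b\<close> is cut into pieces of length \<open>1 / n\<close>. There
  are O(n) of them, and \<open>f\<close> maps each into an interval of length O(1/n^2), so the total
  length is O(1/n).\<close>

lemma negligible_quadratic_image:
  fixes f b :: "'a \<Rightarrow> real"
  assumes fb: "\<And>x y. x \<in> A \<Longrightarrow> y \<in> A \<Longrightarrow> \<bar>f x - f y\<bar> \<le> C * (b x - b y)\<^sup>2"
    and bB: "\<And>x. x \<in> A \<Longrightarrow> \<bar>b x\<bar> \<le> B" and C: "C \<ge> 0" and B: "B \<ge> 0"
  shows "negligible (f ` A)"
  unfolding negligible_outer_le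
proof (intro allI impI)
  fix e :: real assume e: "e > 0"
  \<comment> \<open>Chosen so that the final total length \<open>(2 * B + 2) * (2 * C) / n\<close>
    is at most \<open>e\<close>; the summand 1 makes \<open>n\<close> positive.\<close>
  obtain n :: nat where n: "real n > (2 * B + 2) * (2 * C) / e + 1" using reals_Archimedean2 by blast
  have n1: "real n \<ge> 1"
  proof -
    have "(2 * B + 2) * (2 * C) / e \<ge> 0" using B C e by simp
    then show ?thesis using n by linarith
  qed
  define k where "k x = \<lfloor>real n * b x\<rfloor>" for x
  define pt where "pt j = (SOME x. x \<in> A \<and> k x = j)" for j
  have pt: "pt j \<in> A" "k (pt j) = j" if "j \<in> k ` A" for j
    using someI_ex[of "\<lambda>x. x \<in> A \<and> k x = j"] that unfolding pt_def by auto
  let ?I = "\<lambda>j. {f (pt j) - C / (real n)\<^sup>2 .. f (pt j) + C / (real n)\<^sup>2}"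
  define T where "T = (\<Union>j\<in>k ` A. ?I j)"
  have kr: "k ` A \<subseteq> {\<lfloor>- (real n * B)\<rfloor> .. \<lfloor>real n * B\<rfloor>}"
  proof
    fix j assume "j \<in> k ` A"
    then obtain x where x: "x \<in> A" "j = k x" by auto
    have "b x \<le> B" "- B \<le> b x" using bB[OF x(1)] by auto
    then have "real n * b x \<le> real n * B" "real n * (- B) \<le> real n * b x" by (intro mult_left_mono; simp)+
    then show "j \<in> {\<lfloor>- (real n * B)\<rfloor> .. \<lfloor>real n * B\<rfloor>}" unfolding x(2) k_def by (auto intro!: floor_mono)
  qed
  then have fin: "finite (k ` A)" by (rule finite_subset) auto
  have "card (k ` A) \<le> nat (\<lfloor>real n * B\<rfloor> + 1 - \<lfloor>- (real n * B)\<rfloor>)"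
    using card_mono[OF _ kr] by simp
  also have "real \<dots> \<le> 2 * (real n * B) + 2"
  proof -
    have nB: "real n * B \<ge> 0" using B by simp
    then have le: "\<lfloor>- (real n * B)\<rfloor> \<le> \<lfloor>real n * B\<rfloor>" by (intro floor_mono) simp
    have "real_of_int \<lfloor>real n * B\<rfloor> \<le> real n * B" "real_of_int \<lfloor>- (real n * B)\<rfloor> > - (real n * B) - 1"
      by linarith+
    then have "real_of_int (\<lfloor>real n * B\<rfloor> + 1 - \<lfloor>- (real n * B)\<rfloor>) \<le> 2 * (real n * B) + 2"
      by linarith
    then show ?thesis using le by (subst of_nat_nat) linarith+
  qed
  finally have card: "real (card (k ` A)) \<le> 2 * (real n * B) + 2" by simp
  show "\<exists>T. f ` A \<subseteq> T \<and> T \<in> lmeasurable \<and> measure lebesgue T \<le> e"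
  proof (intro exI conjI)
    show "f ` A \<subseteq> T"
    proof
      fix y assume "y \<in> f ` A"
      then obtain x where x: "x \<in> A" "y = f x" by auto
      let ?p = "pt (k x)"
      have p: "?p \<in> A" "k ?p = k x" using pt[of "k x"] x by auto
      have "\<bar>real n * b x - real n * b ?p\<bar> \<le> 1"
        using p(2) unfolding k_def by linarith
      then have "\<bar>real n * (b x - b ?p)\<bar> \<le> 1" by (simp add: algebra_simps)
      then have "(real n)\<^sup>2 * (b x - b ?p)\<^sup>2 \<le> 1"
        unfolding power_mult_distrib[symmetric] by (simp only: abs_square_le_1)
      then have "(b x - b ?p)\<^sup>2 \<le> 1 / (real n)\<^sup>2"
        using n1 by (subst pos_le_divide_eq) (simp_all add: mult.commute)
      then have "C * (b x - b ?p)\<^sup>2 \<le> C * (1 / (real n)\<^sup>2)" using C by (rule mult_left_mono)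
      then have "\<bar>f x - f ?p\<bar> \<le> C / (real n)\<^sup>2" using fb[OF x(1) p(1)] by simp
      then have "f x \<in> ?I (k x)" by auto
      then show "y \<in> T" using x unfolding T_def by blast
    qed
    show "T \<in> lmeasurable" unfolding T_def using fin by (intro lmeasurable_compact compact_UN) auto
    have "measure lebesgue T \<le> (\<Sum>j\<in>k ` A. measure lebesgue (?I j))"
      unfolding T_def using fin by (intro measure_UNION_le) auto
    also have "\<dots> = real (card (k ` A)) * (2 * C / (real n)\<^sup>2)" using C by simp
    also have "\<dots> \<le> (2 * (real n * B) + 2) * (2 * C / (real n)\<^sup>2)"
      using card C by (intro mult_right_mono) auto
    also have "\<dots> \<le> (real n * (2 * B + 2)) * (2 * C / (real n)\<^sup>2)"
      using n1 C by (intro mult_right_mono) (auto simp: algebra_simps)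
    also have "\<dots> = (2 * B + 2) * (2 * C) / real n"
      using n1 by (simp add: power2_eq_square)
    also have "\<dots> \<le> e"
    proof -
      have "(2 * B + 2) * (2 * C) / e \<le> real n" using n by linarith
      then show ?thesis using e n1 by (simp add: field_simps)
    qed
    finally show "measure lebesgue T \<le> e" .
  qed
qed

context forced_problem
begin

section \<open>Blow-up of the potential at the curve, and its critical values\<close>

lemma H_lipschitz:
  obtains K where "K \<ge> 1" "\<And>s t. s \<in> {0..1} \<Longrightarrow> t \<in> {0..1} \<Longrightarrow> norm (H s - H t) \<le> K * \<bar>s - t\<bar>"
proof -
  obtain B where B: "B \<ge> 0" "\<And>t. t \<in> {0..1} \<Longrightarrow> norm (H' t) \<le> B"
    by (rule continuous_norm_bound[OF cont_H']) blast
  show ?thesis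
  proof (rule that[of "B + 1"])
    fix s t :: real assume st: "s \<in> {0..1}" "t \<in> {0..1}"
    have "norm (H s - H t) \<le> (B + 1) * norm (s - t)"
    proof (rule differentiable_bound[where S = "{0..1}"])
      show "\<And>x. x \<in> {0..1} \<Longrightarrow> (H has_derivative (\<lambda>s. s *\<^sub>R H' x)) (at x within {0..1})"
        using H_deriv by (simp add: has_vector_derivative_def)
      show "onorm (\<lambda>s. s *\<^sub>R H' x) \<le> B + 1" if "x \<in> {0..1}" for x
        using B(2)[OF that] onorm_scaleR_left[OF bounded_linear_ident, of "H' x"] by (simp add: onorm_id)
    qed (use st in auto)
    then show "norm (H s - H t) \<le> (B + 1) * \<bar>s - t\<bar>" by simp
  qed (use B in simp)
qed

text \<open>
  Here \<open>q \<ge> 2\<close> enters: near the curve the potential dominates the divergent integral of the inverse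
  distance along a Lipschitz arc.
\<close>

lemma pot_blowup:
  obtains r where "r > 0" "\<And>x t. x \<notin> H ` {0..1} \<Longrightarrow> t \<in> {0..1} \<Longrightarrow> norm (x - H t) < r \<Longrightarrow> pot x > c"
proof -
  obtain K where K: "K \<ge> 1" "\<And>s t. s \<in> {0..1} \<Longrightarrow> t \<in> {0..1} \<Longrightarrow> norm (H s - H t) \<le> K * \<bar>s - t\<bar>"
    by (rule H_lipschitz) blast
  \<comment> \<open>Makes \<open>ln r\<close> so negative that the integral of
    \<open>inverse (r + K * s)\<close> over an interval of length \<open>\<sigma>\<close> exceeds
    \<open>c\<close>.\<close>
  define r where "r = exp (- (K * (\<bar>c\<bar> + 1))) / 2"
  have r: "r > 0" "r \<le> 1 / 2" using K by (auto simp: r_def)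
  \<comment> \<open>\<open>K * \<sigma> = 1 / 2\<close> keeps
    \<open>r + K * \<bar>s - t\<bar>\<close> at most 1, where the power \<open>1 - q\<close>
    dominates the inverse; \<open>\<sigma> \<le> 1 / 2\<close> lets the interval fit into
    \<open>{0..1}\<close> on one side of \<open>t\<close>.\<close>
  define \<sigma> where "\<sigma> = 1 / (2 * K)"
  have sg: "\<sigma> > 0" "\<sigma> \<le> 1 / 2" "K * \<sigma> = 1 / 2" using K by (auto simp: \<sigma>_def field_simps)
  have gain: "(ln (r + K * \<sigma>) - ln r) / K > c"
  proof -
    have "ln r = - (K * (\<bar>c\<bar> + 1)) - ln 2" unfolding r_def by (simp add: ln_div)
    moreover have "ln (r + K * \<sigma>) \<ge> ln (1 / 2)" using r sg by (subst ln_le_cancel_iff) auto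
    ultimately have "ln (r + K * \<sigma>) - ln r \<ge> K * (\<bar>c\<bar> + 1)" by (simp add: ln_div)
    then have "(ln (r + K * \<sigma>) - ln r) / K \<ge> \<bar>c\<bar> + 1" using K by (simp add: field_simps)
    then show ?thesis by linarith
  qed
  show ?thesis
  proof (rule that[OF r(1)])
    fix x t assume x: "x \<notin> H ` {0..1}" and t: "t \<in> {0..1}" and near: "norm (x - H t) < r"
    have ge: "pot x > c"
      if ab: "a \<in> {0..1}" "b \<in> {0..1}" "a \<le> b"
        and close: "\<And>s. s \<in> {a..b} \<Longrightarrow> \<bar>s - t\<bar> \<le> \<sigma>"
        and F: "\<And>s. s \<in> {a..b} \<Longrightarrow> (F has_real_derivative inverse (r + K * \<bar>s - t\<bar>)) (at s within {a..b})"
        and gainF: "F b - F a = (ln (r + K * \<sigma>) - ln r) / K" for F :: "real \<Rightarrow> real" and a b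
    proof -
      let ?f = "\<lambda>s. norm (x - H s) powr (1 - q)" and ?g = "\<lambda>s. inverse (r + K * \<bar>s - t\<bar>)"
      have sub: "{a..b} \<subseteq> {0..1}" using ab by auto
      have cf: "continuous_on {0..1} ?f"
        using x by (intro continuous_on_norm_powr continuous_intros cont_H) auto
      have pos: "r + K * \<bar>s - t\<bar> > 0" for s using r K by (simp add: add_pos_nonneg)
      have cg: "continuous_on {a..b} ?g" using pos by (intro continuous_intros) (auto simp: less_imp_neq[symmetric])
      have "c < integral {a..b} ?g"
        using integral_of_derivative[OF F ab(3)] gainF gain by simp
      also have "\<dots> \<le> integral {a..b} ?f"
      proof (rule integral_le)
        fix s assume s: "s \<in> {a..b}"
        have s01: "s \<in> {0..1}" using s sub by auto
        let ?w = "norm (x - H s)" and ?y = "r + K * \<bar>s - t\<bar>"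
        have w0: "?w > 0" using x s01 by auto
        have "?w \<le> norm (x - H t) + norm (H t - H s)" using norm_triangle_ineq[of "x - H t" "H t - H s"] by simp
        also have "\<dots> \<le> ?y" using near K(2)[OF t s01] by (simp add: abs_minus_commute)
        finally have wy: "?w \<le> ?y" .
        have "K * \<bar>s - t\<bar> \<le> K * \<sigma>" using close[OF s] K by (intro mult_left_mono) auto
        then have y1: "?y \<le> 1" using r sg by simp
        have "inverse ?y = ?y powr (- 1)" using pos[of s] by (simp add: powr_minus)
        also have "\<dots> \<le> ?y powr (1 - q)" using q pos[of s] y1 by (intro powr_mono') auto
        also have "\<dots> \<le> ?w powr (1 - q)" using w0 wy q by (intro powr_mono2') auto
        finally show "?g s \<le> ?f s" .
      qed (use cg continuous_on_subset[OF cf sub] in \<open>auto intro: integrable_continuous_real\<close>)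
      also have "\<dots> \<le> integral {0..1} ?f"
        by (rule integral_subset_le[OF sub])
          (use cf continuous_on_subset[OF cf sub] in \<open>auto intro: integrable_continuous_real\<close>)
      finally show ?thesis by (simp add: pot_def)
    qed
    have pos: "r + K * y > 0" if "y \<ge> 0" for y using r K that by (simp add: add_pos_nonneg)
    show "pot x > c"
    proof (cases "t \<le> 1 / 2")
      case True
      show ?thesis
      proof (rule ge[of t "t + \<sigma>" "\<lambda>s. ln (r + K * (s - t)) / K"])
        fix s assume s: "s \<in> {t..t + \<sigma>}"
        have "((\<lambda>s. ln (r + K * (s - t))) has_real_derivative K * inverse (r + K * (s - t))) (at s within {t..t + \<sigma>})"
          using pos[of "s - t"] s by (auto intro!: derivative_eq_intros simp: divide_inverse)
        from DERIV_cdivide[OF this, of K] show "((\<lambda>s. ln (r + K * (s - t)) / K) has_real_derivative inverse (r + K * \<bar>s - t\<bar>)) (at s within {t..t + \<sigma>})"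
          using s K by simp
      qed (use True t sg in \<open>auto simp: diff_divide_distrib\<close>)
    next
      case False
      show ?thesis
      proof (rule ge[of "t - \<sigma>" t "\<lambda>s. - ln (r + K * (t - s)) / K"])
        fix s assume s: "s \<in> {t - \<sigma>..t}"
        have "((\<lambda>s. - ln (r + K * (t - s))) has_real_derivative K * inverse (r + K * (t - s))) (at s within {t - \<sigma>..t})"
          using pos[of "t - s"] s by (auto intro!: derivative_eq_intros simp: divide_inverse)
        from DERIV_cdivide[OF this, of K] show "((\<lambda>s. - ln (r + K * (t - s)) / K) has_real_derivative inverse (r + K * \<bar>s - t\<bar>)) (at s within {t - \<sigma>..t})"
          using s K by simp
      qed (use False t sg in \<open>auto simp: diff_divide_distrib\<close>)
    qed
  qed
qed


text \<open>The path from \<open>x\<close> runs along \<open>e'\<close> to the corner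
  \<open>z\<close> and then along \<open>e\<close> to \<open>y\<close>. The first leg changes
  \<open>field\<close> by at most \<open>L\<close> times its length, while along the second the
  \<open>e\<close>-component falls at rate at least \<open>\<kappa>\<close>. As \<open>field\<close>
  vanishes at both ends, the second leg is controlled by the first.\<close>

lemma critical_pair_bound:
  assumes e: "norm e = 1" "norm e' = 1" "\<And>x. x = (x \<bullet> e) *\<^sub>R e + (x \<bullet> e') *\<^sub>R e'" "e' \<bullet> e = 0"
    and L: "\<And>x y. x \<in> ball p (2 * r) \<Longrightarrow> y \<in> ball p (2 * r) \<Longrightarrow> norm (field x - field y) \<le> L * norm (x - y)"
    and av: "\<And>x. x \<in> ball p (2 * r) \<Longrightarrow> x \<notin> H ` {0..1}"
    and \<kappa>: "\<kappa> > 0" "\<And>x. x \<in> ball p (2 * r) \<Longrightarrow> field_deriv e x \<le> - \<kappa>"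
    and x: "x \<in> ball p r" "field x = 0" and y: "y \<in> ball p r" "field y = 0"
    and le: "x \<bullet> e \<le> y \<bullet> e"
  shows "\<kappa> * (y \<bullet> e - x \<bullet> e) \<le> L * \<bar>y \<bullet> e' - x \<bullet> e'\<bar>"
proof -
  define z where "z = x + (y \<bullet> e' - x \<bullet> e') *\<^sub>R e'"
  define d where "d = y \<bullet> e - x \<bullet> e"
  have yz: "y = z + d *\<^sub>R e"
    using e(3)[of y] e(3)[of x] by (simp add: z_def d_def algebra_simps)
  \<comment> \<open>The corner may leave the ball of radius \<open>r\<close>; but both of its
    coordinates relative to \<open>p\<close> stay below \<open>r\<close>, so twice the radius
    suffices.\<close>
  have in2: "z + s *\<^sub>R e \<in> ball p (2 * r)" if s: "0 \<le> s" "s \<le> d" for s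
  proof -
    have "z + s *\<^sub>R e - p = ((x - p) \<bullet> e + s) *\<^sub>R e + ((y - p) \<bullet> e') *\<^sub>R e'"
      using e(3)[of x] e(3)[of p] by (simp add: z_def algebra_simps)
    then have "norm (z + s *\<^sub>R e - p) \<le> \<bar>(x - p) \<bullet> e + s\<bar> + \<bar>(y - p) \<bullet> e'\<bar>"
      using norm_triangle_ineq[of "((x - p) \<bullet> e + s) *\<^sub>R e" "((y - p) \<bullet> e') *\<^sub>R e'"] e(1,2) by simp
    moreover have "\<bar>(x - p) \<bullet> e\<bar> \<le> norm (x - p)" "\<bar>(y - p) \<bullet> e\<bar> \<le> norm (y - p)" "\<bar>(y - p) \<bullet> e'\<bar> \<le> norm (y - p)"
      using Cauchy_Schwarz_ineq2[of "x - p" e] Cauchy_Schwarz_ineq2[of "y - p" e] Cauchy_Schwarz_ineq2[of "y - p" e'] e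
      by auto
    moreover have "norm (x - p) < r" "norm (y - p) < r" using x y by (auto simp: dist_norm norm_minus_commute)
    moreover have "(x - p) \<bullet> e + s \<le> (y - p) \<bullet> e" using s by (simp add: d_def inner_diff_left)
    ultimately have "norm (z + s *\<^sub>R e - p) < 2 * r" using s by linarith
    then show ?thesis by (simp add: dist_norm norm_minus_commute)
  qed
  have "\<kappa> * d \<le> \<bar>field z \<bullet> e\<bar>"
  proof (cases "d = 0")
    case False
    then have d0: "0 < d" using le by (simp add: d_def)
    have dr: "((\<lambda>s. field (z + s *\<^sub>R e) \<bullet> e) has_real_derivative field_deriv e (z + s *\<^sub>R e)) (at s)"
      if "0 \<le> s" "s \<le> d" for s
      by (rule field_line_derivative) (use av in2 that in auto)
    obtain s where s: "0 < s" "s < d"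
      "field (z + d *\<^sub>R e) \<bullet> e - field (z + 0 *\<^sub>R e) \<bullet> e = (d - 0) * field_deriv e (z + s *\<^sub>R e)"
      using MVT2[OF d0 dr] by blast
    then have "field z \<bullet> e = - (d * field_deriv e (z + s *\<^sub>R e))"
      using y(2) by (simp add: yz[symmetric])
    moreover have "d * \<kappa> \<le> d * - field_deriv e (z + s *\<^sub>R e)"
      using \<kappa>(2)[OF in2[of s]] s d0 by (intro mult_left_mono) auto
    ultimately show ?thesis by (simp add: mult.commute)
  qed simp
  also have "\<dots> \<le> norm (field z)" using Cauchy_Schwarz_ineq2[of "field z" e] e(1) by simp
  also have "\<dots> = norm (field z - field x)" by (simp add: x(2))
  also have "\<dots> \<le> L * norm (z - x)"
    using in2[of 0] le x zero_le_dist[of p x] by (intro L) (auto simp: d_def simp del: zero_le_dist)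
  also have "norm (z - x) = \<bar>y \<bullet> e' - x \<bullet> e'\<bar>" by (simp add: z_def e)
  finally show ?thesis by (simp add: d_def)
qed

text \<open>
  Since the trace of the derivative of \<open>field\<close> does not vanish, the critical points of \<open>pot\<close> lie
  locally on a Lipschitz graph over a coordinate axis, along which \<open>pot\<close> varies quadratically.
\<close>

lemma critical_values_locally_negligible:
  assumes p: "p \<notin> H ` {0..1}"
  shows "\<exists>r>0. negligible (pot ` {x \<in> ball p r. field x = 0})"
proof -
  \<comment> \<open>The trace is negative, so one of the two coordinate directions has a negative
    diagonal entry; it becomes \<open>e\<close>.\<close>
  obtain e e' where e: "norm e = 1" "norm e' = 1" "\<And>x. x = (x \<bullet> e) *\<^sub>R e + (x \<bullet> e') *\<^sub>R e'" "e' \<bullet> e = 0"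
    and neg: "field_deriv e p < 0"
  proof (cases "field_deriv 1 p < 0")
    case True
    then show ?thesis by (intro that[of 1 \<i>]) (auto simp: complex_eq_iff inner_complex_def)
  next
    case False
    then have "field_deriv \<i> p < 0" using field_trace_neg[OF p] by linarith
    then show ?thesis by (intro that[of \<i> 1]) (auto simp: complex_eq_iff inner_complex_def)
  qed
  define \<kappa> where "\<kappa> = - field_deriv e p / 2"
  have \<kappa>: "\<kappa> > 0" "field_deriv e p < - \<kappa>" using neg by (auto simp: \<kappa>_def)
  have "isCont (field_deriv e) p"
    using field_deriv_continuous H_image_topology(3) p by (simp add: continuous_on_eq_continuous_at)
  then have "\<forall>\<^sub>F x in at p. field_deriv e x < - \<kappa>"
    using \<kappa>(2) by (auto simp: isCont_def dest: order_tendstoD(2))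
  then obtain r1 where r1': "r1 > 0" "\<And>x. x \<noteq> p \<Longrightarrow> dist x p < r1 \<Longrightarrow> field_deriv e x < - \<kappa>"
    unfolding eventually_at by blast
  have r1: "r1 > 0" "\<And>x. x \<in> ball p r1 \<Longrightarrow> field_deriv e x \<le> - \<kappa>"
  proof -
    show "field_deriv e x \<le> - \<kappa>" if "x \<in> ball p r1" for x
      using r1'(2)[of x] \<kappa>(2) that by (cases "x = p") (auto simp: dist_commute)
  qed (rule r1'(1))
  obtain d where d: "d > 0" "\<And>t. t \<in> {0..1} \<Longrightarrow> d \<le> norm (p - H t)"
    using separate_point_closed[OF H_image_topology(2) p] by (auto simp: dist_norm)
  define r where "r = min r1 (d / 2) / 2"
  have r: "r > 0" using r1 d by (simp add: r_def)
  have far: "d / 2 \<le> norm (x - H t)" if "x \<in> ball p (2 * r)" "t \<in> {0..1}" for x t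
  proof -
    have "norm (p - x) \<le> d / 2" using that by (simp add: dist_norm r_def)
    then show ?thesis using d(2)[OF that(2)] norm_triangle_ineq[of "p - x" "x - H t"] by simp
  qed
  have av: "x \<notin> H ` {0..1}" if "x \<in> ball p (2 * r)" for x using far[OF that] d by fastforce
  obtain L where L: "L > 0" "\<And>x y. \<lbrakk>\<And>t. t \<in> {0..1} \<Longrightarrow> d / 2 \<le> norm (x - H t); \<And>t. t \<in> {0..1} \<Longrightarrow> d / 2 \<le> norm (y - H t)\<rbrakk>
    \<Longrightarrow> norm (field x - field y) \<le> L * norm (x - y)"
    using field_lipschitz[of "d / 2"] d(1) by auto
  have L2: "norm (field x - field y) \<le> L * norm (x - y)" if "x \<in> ball p (2 * r)" "y \<in> ball p (2 * r)" for x y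
    using L(2) far that by blast
  have k2: "field_deriv e x \<le> - \<kappa>" if "x \<in> ball p (2 * r)" for x
    using r1(2)[of x] that by (simp add: r_def)
  define A where "A = {x \<in> ball p r. field x = 0}"
  have one: "\<kappa> * \<bar>y \<bullet> e - x \<bullet> e\<bar> \<le> L * \<bar>y \<bullet> e' - x \<bullet> e'\<bar>" if "x \<in> A" "y \<in> A" for x y
  proof (cases "x \<bullet> e \<le> y \<bullet> e")
    case True
    then show ?thesis
      using critical_pair_bound[where x = x and y = y, OF e L2 av \<kappa>(1) k2] that by (auto simp: A_def)
  next
    case False
    then show ?thesis
      using critical_pair_bound[where x = y and y = x, OF e L2 av \<kappa>(1) k2] that
      by (auto simp: A_def abs_minus_commute)
  qed
  have dist_le: "norm (y - x) \<le> (L / \<kappa> + 1) * \<bar>y \<bullet> e' - x \<bullet> e'\<bar>" if "x \<in> A" "y \<in> A" for x y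
  proof -
    have "y - x = (y \<bullet> e - x \<bullet> e) *\<^sub>R e + (y \<bullet> e' - x \<bullet> e') *\<^sub>R e'"
      using e(3)[of "y - x"] by (simp add: inner_diff_left)
    then have "norm (y - x) \<le> \<bar>y \<bullet> e - x \<bullet> e\<bar> + \<bar>y \<bullet> e' - x \<bullet> e'\<bar>"
      using norm_triangle_ineq[of "(y \<bullet> e - x \<bullet> e) *\<^sub>R e" "(y \<bullet> e' - x \<bullet> e') *\<^sub>R e'"] e(1,2) by simp
    moreover have "\<bar>y \<bullet> e - x \<bullet> e\<bar> \<le> L / \<kappa> * \<bar>y \<bullet> e' - x \<bullet> e'\<bar>"
      using one[OF that] \<kappa>(1) by (simp add: field_simps)
    ultimately show ?thesis by (simp add: algebra_simps)
  qed
  \<comment> \<open>\<open>field\<close> vanishes at \<open>x\<close>, so along the segment it is at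
    most \<open>L * norm (y - x)\<close> and \<open>pot\<close> changes quadratically in the
    distance; \<open>dist_le\<close> converts this into the coordinate along
    \<open>e'\<close>.\<close>
  have quad: "\<bar>pot x - pot y\<bar> \<le> ((q - 1) * L * (L / \<kappa> + 1)\<^sup>2) * (x \<bullet> e' - y \<bullet> e')\<^sup>2" if xy: "x \<in> A" "y \<in> A" for x y
  proof -
    have seg: "x + s *\<^sub>R (y - x) \<in> ball p (2 * r)" if "0 \<le> s" "s \<le> 1" for s
    proof -
      have "x + s *\<^sub>R (y - x) = (1 - s) *\<^sub>R x + s *\<^sub>R y" by (simp add: algebra_simps)
      moreover have "x \<in> ball p (2 * r)" "y \<in> ball p (2 * r)" using xy r by (auto simp: A_def)
      ultimately show ?thesis using convexD_alt[OF convex_ball] that by metis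
    qed
    have dr: "((\<lambda>s. pot (x + s *\<^sub>R (y - x))) has_real_derivative (1 - q) * (field (x + s *\<^sub>R (y - x)) \<bullet> (y - x))) (at s)"
      if "0 \<le> s" "s \<le> 1" for s
      by (rule pot_line_derivative) (use av seg that in auto)
    obtain s where s: "0 < s" "s < 1"
      "pot (x + 1 *\<^sub>R (y - x)) - pot (x + 0 *\<^sub>R (y - x)) = (1 - 0) * ((1 - q) * (field (x + s *\<^sub>R (y - x)) \<bullet> (y - x)))"
      using MVT2[of 0 1, OF _ dr] by auto
    let ?w = "x + s *\<^sub>R (y - x)"
    have "norm (field ?w) = norm (field ?w - field x)" using xy by (simp add: A_def)
    also have "\<dots> \<le> L * norm (?w - x)" using seg[of s] seg[of 0] s by (intro L2) auto
    also have "\<dots> \<le> L * norm (y - x)" using s L(1) by (intro mult_left_mono) (auto simp: mult_left_le_one_le)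
    finally have fw: "norm (field ?w) \<le> L * norm (y - x)" .
    have "\<bar>pot x - pot y\<bar> = \<bar>(1 - q) * (field ?w \<bullet> (y - x))\<bar>"
      using s(3) by (simp add: abs_minus_commute[of "pot x"])
    also have "\<dots> = (q - 1) * \<bar>field ?w \<bullet> (y - x)\<bar>" using q by (simp add: abs_mult)
    also have "\<dots> \<le> (q - 1) * (norm (field ?w) * norm (y - x))"
      using q Cauchy_Schwarz_ineq2[of "field ?w" "y - x"] by (intro mult_left_mono) auto
    also have "\<dots> \<le> (q - 1) * ((L * norm (y - x)) * norm (y - x))"
      using q fw by (intro mult_left_mono mult_right_mono) auto
    also have "\<dots> = (q - 1) * L * (norm (y - x))\<^sup>2" by (simp add: power2_eq_square)
    also have "\<dots> \<le> (q - 1) * L * ((L / \<kappa> + 1) * \<bar>y \<bullet> e' - x \<bullet> e'\<bar>)\<^sup>2"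
      using q L(1) dist_le[OF xy] by (intro mult_left_mono power_mono) auto
    also have "\<dots> = ((q - 1) * L * (L / \<kappa> + 1)\<^sup>2) * (x \<bullet> e' - y \<bullet> e')\<^sup>2"
      by (simp add: power_mult_distrib power2_commute)
    finally show ?thesis .
  qed
  have "\<bar>x \<bullet> e'\<bar> \<le> norm p + r" if "x \<in> A" for x
  proof -
    have "\<bar>x \<bullet> e'\<bar> \<le> norm x" using Cauchy_Schwarz_ineq2[of x e'] e(2) by simp
    also have "\<dots> \<le> norm p + norm (x - p)" using norm_triangle_ineq[of p "x - p"] by simp
    also have "norm (x - p) \<le> r" using that by (simp add: A_def dist_norm norm_minus_commute)
    finally show ?thesis by simp
  qed
  then have "negligible (pot ` A)"
    using r q L(1) \<kappa>(1) by (intro negligible_quadratic_image[OF quad]) auto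
  then show ?thesis using r unfolding A_def by blast
qed

section \<open>Sublevel sets inside a bounded component\<close>

context
  fixes \<Omega> :: "complex set"
  assumes \<Omega>: "\<Omega> \<in> bounded_components H"
begin

lemma component_facts:
  shows "\<Omega> \<in> components (- (H ` {0..1}))" "bounded \<Omega>" "open \<Omega>" "connected \<Omega>" "\<Omega> \<inter> H ` {0..1} = {}"
    "\<Omega> \<noteq> {}" "closure \<Omega> - \<Omega> \<subseteq> H ` {0..1}"
proof -
  show 1: "\<Omega> \<in> components (- (H ` {0..1}))" and "bounded \<Omega>"
    using \<Omega> by (auto simp: bounded_components_def H_image)
  show op: "open \<Omega>" using open_components[OF H_image_topology(3) 1] .
  show "connected \<Omega>" using 1 by (rule in_components_connected)
  show "\<Omega> \<inter> H ` {0..1} = {}" using in_components_subset[OF 1] by auto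
  show "\<Omega> \<noteq> {}" using 1 by (rule in_components_nonempty)
  have "frontier \<Omega> \<subseteq> frontier (- (H ` {0..1}))" by (rule frontier_of_components_subset[OF 1])
  also have "\<dots> \<subseteq> H ` {0..1}" using H_image_topology(2) by (simp add: frontier_complement frontier_subset_closed)
  finally show "closure \<Omega> - \<Omega> \<subseteq> H ` {0..1}" using op by (simp add: frontier_def interior_open)
qed

lemma pot_cont_component: "S \<subseteq> \<Omega> \<Longrightarrow> continuous_on S pot" "S \<subseteq> \<Omega> \<Longrightarrow> continuous_on S field"
  using pot_continuous field_continuous component_facts(5) by (auto elim!: continuous_on_subset)

lemma sublevel_far:
  obtains r where "r > 0" "\<And>x t. x \<in> \<Omega> \<Longrightarrow> pot x \<le> c \<Longrightarrow> t \<in> {0..1} \<Longrightarrow> r \<le> norm (x - H t)"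
proof -
  obtain r where r: "r > 0" "\<And>x t. x \<notin> H ` {0..1} \<Longrightarrow> t \<in> {0..1} \<Longrightarrow> norm (x - H t) < r \<Longrightarrow> pot x > c"
    by (rule pot_blowup) blast
  have "r \<le> norm (x - H t)" if "x \<in> \<Omega>" "pot x \<le> c" "t \<in> {0..1}" for x t
  proof (rule ccontr)
    assume "\<not> ?thesis"
    then have "pot x > c" using r(2)[of x t] that component_facts(5) by auto
    then show False using that by simp
  qed
  then show ?thesis using that r(1) by blast
qed

text \<open>The boundary of \<open>\<Omega>\<close> lies on the curve, where \<open>pot\<close>
  blows up; the sublevel set is therefore closed in a compact part of \<open>\<Omega>\<close> at
  distance at least \<open>r\<close> from the curve.\<close>

lemma sublevel_compact: "compact {x \<in> \<Omega>. pot x \<le> c}"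
proof -
  obtain r where r: "r > 0" "\<And>x t. x \<in> \<Omega> \<Longrightarrow> pot x \<le> c \<Longrightarrow> t \<in> {0..1} \<Longrightarrow> r \<le> norm (x - H t)"
    by (rule sublevel_far) blast
  define T where "T = closure \<Omega> \<inter> (\<Inter>t\<in>{0..1}. {x. r \<le> norm (x - H t)})"
  have "closed T" unfolding T_def
    by (intro closed_Int closed_closure closed_INT ballI closed_Collect_le continuous_intros)
  moreover have "bounded T" using component_facts(2) bounded_subset[of "closure \<Omega>" T] by (auto simp: T_def)
  ultimately have T: "compact T" by (simp add: compact_eq_bounded_closed)
  have sub: "T \<subseteq> \<Omega>"
  proof
    fix x assume x: "x \<in> T"
    show "x \<in> \<Omega>"
    proof (rule ccontr)
      assume "x \<notin> \<Omega>"
      then have "x \<in> H ` {0..1}" using x component_facts(7) by (auto simp: T_def)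
      then obtain t where t: "t \<in> {0..1}" "x = H t" by blast
      have "\<forall>s\<in>{0..1}. r \<le> norm (x - H s)" using x by (auto simp: T_def)
      then have "r \<le> norm (x - H t)" using t(1) by blast
      then show False using t(2) r(1) by simp
    qed
  qed
  have "{x \<in> \<Omega>. pot x \<le> c} = {x \<in> T. pot x \<le> c}"
    using r(2) sub closure_subset[of \<Omega>] by (auto simp: T_def)
  moreover have "closed {x \<in> T. pot x \<le> c}"
    using T pot_cont_component(1)[OF sub] by (intro continuous_on_closed_Collect_le continuous_intros) (auto simp: compact_imp_closed)
  ultimately show ?thesis using T
    by (metis (no_types, lifting) compact_Int_closed inf.absorb2 mem_Collect_eq subsetI)
qed

text \<open>A Sard-type argument: finitely many balls from
  \<open>critical_values_locally_negligible\<close> cover a compact sublevel set, so the critical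
  values up to \<open>b\<close> are negligible and cannot fill an interval.\<close>

lemma noncritical_level:
  assumes "a < b"
  shows "\<exists>c. a < c \<and> c < b \<and> (\<forall>x\<in>\<Omega>. pot x = c \<longrightarrow> field x \<noteq> 0)"
proof (rule ccontr)
  assume no: "\<not> ?thesis"
  let ?S = "{x \<in> \<Omega>. pot x \<le> b}"
  have "\<forall>p\<in>?S. \<exists>r. r > 0 \<and> negligible (pot ` {x \<in> ball p r. field x = 0})"
    using critical_values_locally_negligible component_facts(5) by blast
  from bchoice[OF this] obtain r where r': "\<forall>p\<in>?S. r p > 0 \<and> negligible (pot ` {x \<in> ball p (r p). field x = 0})"
    by blast
  have r: "r p > 0" "negligible (pot ` {x \<in> ball p (r p). field x = 0})" if "p \<in> ?S" for p
    using r' that by auto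
  have cover: "?S \<subseteq> (\<Union>p\<in>?S. ball p (r p))" using r(1) by force
  obtain C where C: "C \<subseteq> ?S" "finite C" "?S \<subseteq> (\<Union>p\<in>C. ball p (r p))"
    by (rule compactE_image[OF sublevel_compact _ cover]) auto
  have "negligible (\<Union>p\<in>C. pot ` {x \<in> ball p (r p). field x = 0})"
    using C r(2) by (intro negligible_Union) auto
  moreover have "{a<..<b} \<subseteq> (\<Union>p\<in>C. pot ` {x \<in> ball p (r p). field x = 0})"
  proof
    fix c assume c: "c \<in> {a<..<b}"
    then obtain x where x: "x \<in> \<Omega>" "pot x = c" "field x = 0" using no by auto
    then have "x \<in> ?S" using c by auto
    then obtain p where p: "p \<in> C" "x \<in> ball p (r p)" using C(3) by blast
    have "c \<in> pot ` {x \<in> ball p (r p). field x = 0}" using x p(2) by (intro image_eqI[of _ _ x]) auto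
    then show "c \<in> (\<Union>p\<in>C. pot ` {x \<in> ball p (r p). field x = 0})" using p(1) by blast
  qed
  ultimately have "negligible {a<..<b}" by (rule negligible_subset)
  then show False using open_not_negligible[of "{a<..<b}"] assms by auto
qed

text \<open>
  One explicit gradient step maps the closure of a component of a noncritical sublevel set into that
  component; by the maximum principle the component has no holes.
\<close>

lemma gradient_step_region:
  obtains N \<tau> where "open N" "N \<noteq> {}" "contractible N" "closure N \<subseteq> \<Omega>" "\<tau> > 0"
    "\<And>x. x \<in> closure N \<Longrightarrow> x + \<tau> *\<^sub>R field x \<in> N"
proof -
  obtain x0 where x0: "x0 \<in> \<Omega>" using component_facts(6) by blast
  obtain c where c: "pot x0 < c" "\<And>x. x \<in> \<Omega> \<Longrightarrow> pot x = c \<Longrightarrow> field x \<noteq> 0"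
    using noncritical_level[of "pot x0" "pot x0 + 1"] by auto
  define G where "G = {x \<in> \<Omega>. pot x < c}"
  define S where "S = {x \<in> \<Omega>. pot x \<le> c}"
  define N where "N = connected_component_set G x0"
  have S: "compact S" "S \<subseteq> \<Omega>" unfolding S_def by (rule sublevel_compact) auto
  have oG: "open G"
  proof -
    have "G = \<Omega> \<inter> pot -` {..<c}" by (auto simp: G_def)
    then show ?thesis
      using continuous_open_preimage[OF pot_cont_component(1)[OF order_refl] component_facts(3), of "{..<c}"] by simp
  qed
  have oN: "open N" unfolding N_def by (rule open_connected_component[OF oG])
  have x0G: "x0 \<in> G" using x0 c by (simp add: G_def)
  have x0N: "x0 \<in> N" using x0G by (simp add: N_def connected_component_refl)
  have NG: "N \<subseteq> G" by (simp add: N_def connected_component_subset)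
  have cN: "connected N" by (simp add: N_def)
  \<comment> \<open>\<open>N\<close> is a component of \<open>G\<close> and swallows every connected
    part of \<open>G\<close> that it meets; membership in \<open>N\<close> is obtained through this
    below.\<close>
  have absorb: "T \<subseteq> N" if "connected T" "T \<subseteq> G" "y \<in> T" "y \<in> N" for T y
  proof -
    have "connected_component_set G x0 = connected_component_set G y"
      using that(4) unfolding N_def by (simp add: connected_component_eq)
    then show ?thesis using connected_component_maximal[OF that(3,1,2)] by (simp add: N_def)
  qed
  have clS: "closure N \<subseteq> S"
    using NG by (intro closure_minimal compact_imp_closed S) (auto simp: G_def S_def)
  have level: "pot x = c" if x: "x \<in> closure N" "x \<notin> N" for x
  proof (rule ccontr)
    assume "pot x \<noteq> c"
    then have "x \<in> G" using x(1) clS by (auto simp: S_def G_def)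
    then obtain r where r: "r > 0" "ball x r \<subseteq> G" using oG by (meson open_contains_ball)
    obtain y where y: "y \<in> N" "dist y x < r" using x(1) r(1) by (meson closure_approachable)
    have "ball x r \<subseteq> N" using y by (intro absorb[of _ y] r) (auto simp: dist_commute)
    then have "x \<in> N" using r(1) by (meson centre_in_ball subsetD)
    then show False using x(2) by simp
  qed
  have "simply_connected N"
  proof -
    have bN: "bounded N" using NG component_facts(2) by (auto simp: G_def intro: bounded_subset)
    have "\<Omega> \<noteq> UNIV" using component_facts(2) by auto
    then obtain y where y: "y \<in> - \<Omega>" by auto
    have con\<Omega>: "connected (- \<Omega>)"
      using component_complement_connected[OF _ component_facts(1)] cont_H
      by (simp add: connected_continuous_image)
    \<comment> \<open>\<open>C\<close> is the outer component of the complement of \<open>N\<close>,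
      and \<open>Q\<close> below is \<open>N\<close> with its holes filled. The boundary of
      \<open>Q\<close> lies on the level \<open>c\<close>, so the maximum principle puts
      \<open>Q\<close> into \<open>G\<close> and hence into \<open>N\<close>.\<close>
    define C where "C = connected_component_set (- N) y"
    have subN: "- \<Omega> \<subseteq> - N" using NG by (auto simp: G_def)
    have \<Omega>C: "- \<Omega> \<subseteq> C" unfolding C_def by (rule connected_component_maximal[OF y con\<Omega> subN])
    have C: "C \<in> components (- N)" using y subN by (auto simp: C_def components_def)
    have clC: "closed C" using closed_components[OF _ C] oN by auto
    define Q where "Q = - C"
    have Q: "open Q" "connected Q" "Q \<subseteq> \<Omega>" "N \<subseteq> Q"
      using clC component_complement_connected[OF cN C] \<Omega>C in_components_subset[OF C]
      by (auto simp: Q_def open_Compl)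
    have frQ: "closure Q - Q \<subseteq> closure N - N"
    proof -
      have "frontier Q \<subseteq> frontier N"
        using frontier_of_components_subset[OF C] by (simp add: Q_def frontier_complement)
      then show ?thesis using Q(1) oN by (simp add: frontier_def interior_open)
    qed
    have clQ: "closure Q \<subseteq> \<Omega>" using frQ clS Q(3) S(2) by auto
    have compQ: "compact (closure Q)"
      using component_facts(2) Q(3) bounded_subset by (auto intro!: compact_closure[THEN iffD2])
    have QG: "Q \<subseteq> G"
    proof (rule ccontr)
      assume "\<not> Q \<subseteq> G"
      then obtain x where xG: "x \<in> Q" "x \<notin> G" by blast
      then have x: "x \<in> Q" "c \<le> pot x" using Q(3) by (auto simp: G_def not_less subset_iff)
      obtain p where p: "p \<in> closure Q" "\<And>y. y \<in> closure Q \<Longrightarrow> pot y \<le> pot p"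
        using continuous_attains_sup[OF compQ _ pot_cont_component(1)[OF clQ]] x(1) closure_subset by blast
      \<comment> \<open>If the maximum sits on the boundary, its value is \<open>c\<close>; the
        point \<open>x\<close> of \<open>Q\<close> with \<open>c \<le> pot x\<close> is then an
        interior maximum as well.\<close>
      obtain p' where p': "p' \<in> Q" "\<And>y. y \<in> closure Q \<Longrightarrow> pot y \<le> pot p'"
      proof (cases "p \<in> Q")
        case True
        then show ?thesis using p that by blast
      next
        case False
        then have "pot p = c" using p(1) frQ level by blast
        then have "pot y \<le> pot x" if "y \<in> closure Q" for y using p(2)[OF that] x(2) by linarith
        then show ?thesis using x(1) that by blast
      qed
      obtain r where r: "r > 0" "ball p' r \<subseteq> Q" using Q(1) p'(1) by (meson open_contains_ball)
      have "pot y \<le> pot p'" if "y \<in> ball p' r" for y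
        using p'(2) r(2) that closure_subset by blast
      then show False
        using pot_not_local_max[of p' r] r(1) p'(1) Q(3) component_facts(5) by blast
    qed
    have "Q \<subseteq> N" by (rule absorb[OF Q(2) QG, of x0]) (use x0N Q(4) in auto)
    then have "- N = C" using Q(4) by (auto simp: Q_def)
    then have "connected (- N)" using in_components_connected[OF C] by simp
    then show ?thesis using simply_connected_iff_simple[OF oN bN] cN by simp
  qed
  then have contr: "contractible N" using contractible_eq_simply_connected_2d[OF oN] by simp
  obtain r where r: "r > 0" "\<And>x t. x \<in> \<Omega> \<Longrightarrow> pot x \<le> c \<Longrightarrow> t \<in> {0..1} \<Longrightarrow> r \<le> norm (x - H t)"
    by (rule sublevel_far) blast
  obtain L where L: "L > 0" "\<And>x y. \<lbrakk>\<And>t. t \<in> {0..1} \<Longrightarrow> r / 2 \<le> norm (x - H t); \<And>t. t \<in> {0..1} \<Longrightarrow> r / 2 \<le> norm (y - H t)\<rbrakk>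
    \<Longrightarrow> norm (field x - field y) \<le> L * norm (x - y)"
    using field_lipschitz[of "r / 2"] r(1) by auto
  have "bounded (field ` S)"
    using S by (intro compact_imp_bounded compact_continuous_image pot_cont_component)
  then obtain M where M: "M > 0" "\<And>x. x \<in> S \<Longrightarrow> norm (field x) \<le> M"
    unfolding bounded_pos by (metis imageI)
  \<comment> \<open>The first bound limits the step to length \<open>r / 2\<close>, so it stays off
    the curve; the second keeps \<open>field\<close> along the step within half of its initial norm
    from its initial value, so \<open>pot\<close> decreases.\<close>
  define \<tau> where "\<tau> = min (r / (2 * M)) (1 / (2 * L))"
  have \<tau>: "\<tau> > 0" "\<tau> * M \<le> r / 2" "\<tau> * L \<le> 1 / 2"
    using r(1) L(1) M(1) by (auto simp: \<tau>_def min_def field_simps)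
  have far: "r / 2 \<le> norm (x + s *\<^sub>R field x - H t)" if "x \<in> S" "0 \<le> s" "s \<le> \<tau>" "t \<in> {0..1}" for x s t
  proof -
    have "norm (s *\<^sub>R field x) \<le> \<tau> * M" unfolding norm_scaleR using that M \<tau>(1) by (intro mult_mono) auto
    then have "norm (s *\<^sub>R field x) \<le> r / 2" using \<tau>(2) by linarith
    moreover have "r \<le> norm (x - H t)" using that by (intro r(2)) (auto simp: S_def)
    moreover have "norm (x - H t) \<le> norm (x + s *\<^sub>R field x - H t) + norm (s *\<^sub>R field x)"
      using norm_triangle_ineq4[of "x + s *\<^sub>R field x - H t" "s *\<^sub>R field x"] by simp
    ultimately show ?thesis by linarith
  qed
  have av: "x + s *\<^sub>R field x \<notin> H ` {0..1}" if "x \<in> S" "0 \<le> s" "s \<le> \<tau>" for x s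
    using far[OF that] r(1) by force
  let ?seg = "\<lambda>x. (\<lambda>s. x + s *\<^sub>R field x) ` {0..\<tau>}"
  have con_seg: "connected (?seg x)" for x
    by (intro connected_continuous_image continuous_intros) auto
  have seg\<Omega>: "?seg x \<subseteq> \<Omega>" if x: "x \<in> S" for x
  proof (rule components_maximal[OF component_facts(1) con_seg])
    show "?seg x \<subseteq> - (H ` {0..1})"
    proof (rule image_subsetI)
      show "x + s *\<^sub>R field x \<in> - (H ` {0..1})" if "s \<in> {0..\<tau>}" for s
        using av[OF x, of s] that by simp
    qed
    have "x \<in> ?seg x" using \<tau>(1) by (intro image_eqI[of _ _ 0]) auto
    then show "\<Omega> \<inter> ?seg x \<noteq> {}" using x S(2) by blast
  qed
  have descent: "pot (x + s *\<^sub>R field x) < pot x" if x: "x \<in> S" "field x \<noteq> 0" and s: "0 < s" "s \<le> \<tau>" for x s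
  proof -
    have dr: "((\<lambda>s. pot (x + s *\<^sub>R field x)) has_real_derivative (1 - q) * (field (x + z *\<^sub>R field x) \<bullet> field x)) (at z)"
      if "0 \<le> z" "z \<le> s" for z
      by (rule pot_line_derivative) (use av[OF x(1)] that s in auto)
    obtain z where z: "0 < z" "z < s"
      "pot (x + s *\<^sub>R field x) - pot (x + 0 *\<^sub>R field x) = (s - 0) * ((1 - q) * (field (x + z *\<^sub>R field x) \<bullet> field x))"
      using MVT2[OF s(1) dr] by blast
    let ?w = "x + z *\<^sub>R field x"
    have "norm (field ?w - field x) \<le> L * norm (?w - x)"
      using far[OF x(1)] z s \<tau>(1) far[OF x(1), of 0] by (intro L(2)) auto
    also have "\<dots> = (z * L) * norm (field x)" using z by simp
    also have "\<dots> \<le> (\<tau> * L) * norm (field x)" using z s L(1) by (intro mult_right_mono) auto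
    also have "\<dots> \<le> 1 / 2 * norm (field x)" using \<tau>(3) by (intro mult_right_mono) auto
    finally have d: "norm (field ?w - field x) \<le> norm (field x) / 2" by simp
    have "field ?w \<bullet> field x = (norm (field x))\<^sup>2 + (field ?w - field x) \<bullet> field x"
      by (simp add: inner_diff_left dot_square_norm)
    moreover have "- ((field ?w - field x) \<bullet> field x) \<le> norm (field ?w - field x) * norm (field x)"
      using Cauchy_Schwarz_ineq2[of "field ?w - field x" "field x"] by simp
    moreover have "norm (field ?w - field x) * norm (field x) \<le> (norm (field x))\<^sup>2 / 2"
      using mult_right_mono[OF d, of "norm (field x)"] by (simp add: power2_eq_square)
    moreover have "(norm (field x))\<^sup>2 > 0" using x(2) by simp
    ultimately have "field ?w \<bullet> field x > 0" by linarith
    then have "(s - 0) * ((1 - q) * (field ?w \<bullet> field x)) < 0"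
      using q s by (simp add: mult_pos_neg mult_neg_pos)
    then show ?thesis unfolding z(3)[symmetric] by simp
  qed
  have stepN: "x + \<tau> *\<^sub>R field x \<in> N" if x: "x \<in> N" for x
  proof (cases "field x = 0")
    case False
    have xS: "x \<in> S" using x clS closure_subset by blast
    have "?seg x \<subseteq> G"
    proof
      fix y assume y: "y \<in> ?seg x"
      then obtain s where s: "0 \<le> s" "s \<le> \<tau>" "y = x + s *\<^sub>R field x" by auto
      have "pot x < c" using x NG by (auto simp: G_def)
      then have "pot y < c" using descent[OF xS False, of s] s by (cases "s = 0") auto
      then show "y \<in> G" using y seg\<Omega>[OF xS] by (auto simp: G_def)
    qed
    moreover have "x \<in> ?seg x" using \<tau>(1) by (intro image_eqI[of _ _ 0]) auto
    ultimately have "?seg x \<subseteq> N" using x by (intro absorb[OF con_seg])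
    moreover have "x + \<tau> *\<^sub>R field x \<in> ?seg x" using \<tau>(1) by (intro image_eqI[of _ _ \<tau>]) auto
    ultimately show ?thesis by blast
  qed (use x in simp)
  have step: "x + \<tau> *\<^sub>R field x \<in> N" if x: "x \<in> closure N" for x
  proof (cases "x \<in> N")
    case False
    have xS: "x \<in> S" using x clS by auto
    have "pot x = c" using level x False by blast
    moreover from this have "field x \<noteq> 0" using c(2) xS S(2) by blast
    ultimately have "pot (x + \<tau> *\<^sub>R field x) < c" using descent[OF xS, of \<tau>] \<tau>(1) by simp
    moreover have "x + \<tau> *\<^sub>R field x \<in> \<Omega>"
      using seg\<Omega>[OF xS] \<tau>(1) by (auto simp: image_subset_iff)
    ultimately have "x + \<tau> *\<^sub>R field x \<in> G" by (simp add: G_def)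
    \<comment> \<open>So far the image of the boundary point is known to lie in \<open>G\<close>
      only. Points of \<open>N\<close> close to \<open>x\<close> have images in \<open>N\<close> by
      \<open>stepN\<close>, which places it in the same component.\<close>
    then obtain e where e: "e > 0" "ball (x + \<tau> *\<^sub>R field x) e \<subseteq> G" using oG by (meson open_contains_ball)
    have "continuous_on (closure N) (\<lambda>x. x + \<tau> *\<^sub>R field x)"
      using clS S(2) by (intro continuous_intros pot_cont_component) auto
    then obtain d where d: "d > 0"
      "\<And>y. y \<in> closure N \<Longrightarrow> dist y x < d \<Longrightarrow> dist (y + \<tau> *\<^sub>R field y) (x + \<tau> *\<^sub>R field x) < e"
      using x e(1) unfolding continuous_on_iff by blast
    obtain y where y: "y \<in> N" "dist y x < d" using x d(1) by (meson closure_approachable)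
    have yc: "y \<in> closure N" using y(1) closure_subset by blast
    have "y + \<tau> *\<^sub>R field y \<in> ball (x + \<tau> *\<^sub>R field x) e" using d(2)[OF yc y(2)] by (simp add: dist_commute)
    then have "ball (x + \<tau> *\<^sub>R field x) e \<subseteq> N"
      using stepN[OF y(1)] by (intro absorb[OF _ e(2)]) auto
    then show ?thesis using e(1) by (meson centre_in_ball subsetD)
  qed (rule stepN)
  show ?thesis
    by (rule that[OF oN _ contr _ \<tau>(1) step]) (use x0N clS S(2) in auto)
qed

end

end

section \<open>The degree of the shooting map near a bounded component\<close>

lemma cube_degree_cong:
  assumes "\<And>x. x \<in> closure U \<Longrightarrow> f x = g x"
  shows "cube_degree \<rho> U f = cube_degree \<rho> U g"
  using assms by (simp add: cube_degree_def)

lemma contractible_contraction: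
  fixes N :: "'a::real_normed_vector set"
  assumes "contractible N" "N \<noteq> {}"
  obtains k :: "real \<times> 'a \<Rightarrow> 'a" and a where "continuous_on ({0..1} \<times> N) k" "\<And>t x. t \<in> {0..1} \<Longrightarrow> x \<in> N \<Longrightarrow> k (t, x) \<in> N"
    "\<And>x. x \<in> N \<Longrightarrow> k (0, x) = x" "\<And>x. x \<in> N \<Longrightarrow> k (1, x) = a" "a \<in> N"
proof -
  obtain a k where k: "continuous_map (prod_topology (top_of_set {0..1::real}) (top_of_set N)) (top_of_set N) k"
    "\<And>x. k (0, x) = id x" "\<And>x. k (1, x) = a"
    using assms(1) unfolding contractible_def homotopic_with_def by blast
  then have c: "continuous_on ({0..1} \<times> N) k" "k \<in> {0..1} \<times> N \<rightarrow> N"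
    by (auto simp: prod_topology_subtopology_eu continuous_map_subtopology_eu)
  have in_N: "k (t, x) \<in> N" if "t \<in> {0..1}" "x \<in> N" for t x using c(2) that by auto
  obtain x where "x \<in> N" using assms(2) by blast
  then have "a \<in> N" using in_N[of 1 x] k(3) by simp
  then show ?thesis using that[of k a] c(1) in_N k(2,3) by simp
qed

context forced_problem
begin

lemma flow_joint_continuous:
  assumes d: "d > 0"
  shows "continuous_on (UNIV \<times> {0..1}) (\<lambda>(z, t). flow d z lam t)"
proof -
  obtain C where C: "C > 0" "\<And>z lam z' lam' t. t \<in> {0..1} \<Longrightarrow>
       norm (flow d z lam t - flow d z' lam' t) \<le> C * dist (z, lam) (z', lam')"
    by (rule flow_lipschitz[OF d]) blast
  show ?thesis
    unfolding continuous_on_iff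
  proof (intro ballI allI impI)
    fix p :: "(complex \<times> complex) \<times> real" and e :: real assume p: "p \<in> UNIV \<times> {0..1}" and e: "e > 0"
    obtain z t where zt: "p = (z, t)" "t \<in> {0..1}" using p by auto
    obtain r where r: "r > 0" "\<And>t'. t' \<in> {0..1} \<Longrightarrow> dist t' t < r \<Longrightarrow> dist (flow d z lam t') (flow d z lam t) < e / 2"
      using flow_cont[OF d, of z lam] zt(2) e unfolding continuous_on_iff by (metis half_gt_zero)
    show "\<exists>r>0. \<forall>p'\<in>UNIV \<times> {0..1}. dist p' p < r \<longrightarrow>
       dist (case p' of (z, t) \<Rightarrow> flow d z lam t) (case p of (z, t) \<Rightarrow> flow d z lam t) < e"
    proof (intro exI[of _ "min r (e / (2 * C))"] conjI ballI impI)
      show "0 < min r (e / (2 * C))" using r e C by simp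
      fix p' assume p': "p' \<in> UNIV \<times> {0..1}" "dist p' p < min r (e / (2 * C))"
      obtain z' t' where zt': "p' = (z', t')" "t' \<in> {0..1}" using p'(1) by auto
      have "dist z' z < e / (2 * C)" "dist t' t < r"
        using p'(2) dist_fst_le[of p' p] dist_snd_le[of p' p] by (auto simp: zt zt')
      then have "C * dist (z', lam) (z, lam) < e / 2" using C(1) by (simp add: dist_Pair_Pair field_simps)
      then have "dist (flow d z' lam t') (flow d z lam t') < e / 2"
        using C(2)[OF zt'(2), of z' lam z lam] by (simp add: dist_norm)
      then have "dist (flow d z' lam t') (flow d z lam t) < e"
        using r(2)[OF zt'(2) \<open>dist t' t < r\<close>] dist_triangle_half_l by (metis dist_commute)
      then show "dist (case p' of (z, t) \<Rightarrow> flow d z lam t) (case p of (z, t) \<Rightarrow> flow d z lam t) < e"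
        by (simp add: zt zt')
    qed
  qed
qed

text \<open>With this as \<open>x\<close> and \<open>vel_coord\<close> as \<open>v\<close>, the free
  solution with data \<open>z\<close> is \<open>lam\<close> times \<open>x - H t + t v\<close>; see
  \<open>free_data_coords\<close>.\<close>

definition pos_coord :: "real \<Rightarrow> complex \<times> complex \<Rightarrow> complex" where
  "pos_coord lam z = fst z /\<^sub>R lam + H 0"

definition vel_coord :: "real \<Rightarrow> complex \<times> complex \<Rightarrow> complex" where
  "vel_coord lam z = snd z /\<^sub>R lam + H' 0"

text \<open>Initial data of curves that stay close to \<open>lam (x - H)\<close> for some \<open>x \<in> N\<close>.\<close>

definition near_region :: "complex set \<Rightarrow> real \<Rightarrow> real \<Rightarrow> (complex \<times> complex) set" where
  "near_region N \<eta> lam = {z. pos_coord lam z \<in> N \<and> norm (vel_coord lam z) < \<eta>}"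

lemma coord_continuous [continuous_intros]:
  "continuous_on S (pos_coord lam)" "continuous_on S (vel_coord lam)"
  unfolding pos_coord_def vel_coord_def by (intro continuous_intros)+

lemma free_data_coords:
  assumes "lam > 0"
  shows "free_data z lam t = lam *\<^sub>R (pos_coord lam z - H t + t *\<^sub>R vel_coord lam z)"
  using assms by (simp add: free_data_def pos_coord_def vel_coord_def algebra_simps)

lemma near_region_open: "open N \<Longrightarrow> open (near_region N \<eta> lam)"
proof -
  assume "open N"
  then have "open (pos_coord lam -` N)" "open {z. norm (vel_coord lam z) < \<eta>}"
    by (auto intro!: open_vimage open_Collect_less continuous_intros)
  moreover have "near_region N \<eta> lam = pos_coord lam -` N \<inter> {z. norm (vel_coord lam z) < \<eta>}"
    by (auto simp: near_region_def)
  ultimately show ?thesis by (simp add: open_Int)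
qed

lemma near_region_bounded:
  assumes "bounded N" "lam > 0"
  shows "bounded (near_region N \<eta> lam)"
proof -
  obtain B where B: "\<And>x. x \<in> N \<Longrightarrow> norm x \<le> B" using assms(1) by (auto simp: bounded_iff)
  have "norm z \<le> lam * (B + norm (H 0)) + lam * (\<eta> + norm (H' 0))" if z: "z \<in> near_region N \<eta> lam" for z
  proof -
    have 1: "fst z = lam *\<^sub>R (pos_coord lam z - H 0)" "snd z = lam *\<^sub>R (vel_coord lam z - H' 0)"
      using assms(2) by (simp_all add: pos_coord_def vel_coord_def)
    have "norm (pos_coord lam z - H 0) \<le> B + norm (H 0)" "norm (vel_coord lam z - H' 0) \<le> \<eta> + norm (H' 0)"
      using z B[of "pos_coord lam z"] norm_triangle_ineq4[of "pos_coord lam z" "H 0"]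
        norm_triangle_ineq4[of "vel_coord lam z" "H' 0"]
      by (auto simp: near_region_def)
    then have "norm (fst z) \<le> lam * (B + norm (H 0))" "norm (snd z) \<le> lam * (\<eta> + norm (H' 0))"
      unfolding 1 using assms(2) by (simp_all add: mult_left_mono)
    then show ?thesis using norm_Pair_le[of "fst z" "snd z"] by simp
  qed
  then show ?thesis unfolding bounded_iff by blast
qed

lemma near_region_closure:
  assumes "z \<in> closure (near_region N \<eta> lam)"
  shows "pos_coord lam z \<in> closure N" "norm (vel_coord lam z) \<le> \<eta>"
proof -
  have "closed (pos_coord lam -` closure N \<inter> {z. norm (vel_coord lam z) \<le> \<eta>})"
    by (intro closed_Int closed_vimage closed_Collect_le continuous_intros) auto
  moreover have "near_region N \<eta> lam \<subseteq> pos_coord lam -` closure N \<inter> {z. norm (vel_coord lam z) \<le> \<eta>}"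
    using closure_subset by (auto simp: near_region_def)
  ultimately have "closure (near_region N \<eta> lam) \<subseteq> pos_coord lam -` closure N \<inter> {z. norm (vel_coord lam z) \<le> \<eta>}"
    by (rule closure_minimal[rotated])
  then show "pos_coord lam z \<in> closure N" "norm (vel_coord lam z) \<le> \<eta>" using assms by auto
qed

lemma cut_volterra_bound:
  assumes d: "d > 0" and c: "c > 0" and t: "t \<in> {0..1}"
    and ge: "\<And>s. s \<in> {0..t} \<Longrightarrow> c \<le> norm (flow d z lam s)"
  shows "norm (volterra (\<lambda>s. cut_force q d (flow d z lam s)) t) \<le> c powr (- q)"
proof -
  have "norm (volterra (\<lambda>s. cut_force q d (flow d z lam s)) t) \<le> integral {0..t} (\<lambda>s. c powr (- q))"
  proof (rule volterra_norm_le[OF cut_flow_cont[OF d] t])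
    show "norm (cut_force q d (flow d z lam s)) \<le> c powr (- q)" if "s \<in> {0..t}" for s
      using ge[OF that] q c by (intro cut_force_norm_le) auto
  qed auto
  also have "\<dots> \<le> c powr (- q)" using t by (simp add: mult_left_le_one_le)
  finally show ?thesis .
qed

text \<open>A continuation argument: while the curve stays beyond \<open>lam * d0 / 2\<close>, the
  force adds less than \<open>lam * d0 / 4\<close> to a free part of norm at least
  \<open>3 / 4 * (lam * d0)\<close>. The bound thus holds strictly and cannot be lost at a first
  time.\<close>

lemma flow_near_free:
  assumes d: "d > 0" and lam: "lam > 0" and d0: "d0 > 0"
    and far: "\<And>t. t \<in> {0..1} \<Longrightarrow> d0 \<le> norm (pos_coord lam z - H t)"
    and vel: "norm (vel_coord lam z) \<le> d0 / 4"
    and small: "(lam * d0 / 2) powr (- q) < lam * d0 / 4"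
    and t: "t \<in> {0..1}"
  shows "norm (volterra (\<lambda>s. cut_force q d (flow d z lam s)) t) \<le> (lam * d0 / 2) powr (- q)"
    and "lam * d0 / 2 \<le> norm (flow d z lam t)"
proof -
  define c where "c = lam * d0 / 2"
  have c: "c > 0" using lam d0 by (simp add: c_def)
  let ?u = "flow d z lam"
  have free: "3 / 4 * (lam * d0) \<le> norm (free_data z lam t)" if t: "t \<in> {0..1}" for t
  proof -
    have "norm (t *\<^sub>R vel_coord lam z) \<le> 1 * (d0 / 4)" unfolding norm_scaleR using t vel by (intro mult_mono) auto
    then have "3 / 4 * d0 \<le> norm (pos_coord lam z - H t + t *\<^sub>R vel_coord lam z)"
      using far[OF t] norm_triangle_ineq4[of "pos_coord lam z - H t + t *\<^sub>R vel_coord lam z" "t *\<^sub>R vel_coord lam z"] by simp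
    then have "lam * (3 / 4 * d0) \<le> lam * norm (pos_coord lam z - H t + t *\<^sub>R vel_coord lam z)"
      using lam by (intro mult_left_mono) auto
    then show ?thesis using lam by (simp add: free_data_coords mult_ac)
  qed
  have est: "c < norm (?u t)" if t: "t \<in> {0..1}" and ge: "\<And>s. s \<in> {0..t} \<Longrightarrow> c \<le> norm (?u s)" for t
  proof -
    have "norm (volterra (\<lambda>s. cut_force q d (?u s)) t) \<le> c powr (- q)" by (rule cut_volterra_bound[OF d c t ge])
    moreover have "norm (free_data z lam t) \<le> norm (?u t) + norm (volterra (\<lambda>s. cut_force q d (?u s)) t)"
      using norm_triangle_ineq4[of "?u t" "volterra (\<lambda>s. cut_force q d (?u s)) t"] flow_eq[OF d t, of z lam] by simp
    ultimately show ?thesis using free[OF t] small by (simp add: c_def)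
  qed
  have all: "c \<le> norm (?u t)" if t: "t \<in> {0..1}" for t
  proof (rule ccontr)
    assume bad: "\<not> ?thesis"
    define B where "B = {t \<in> {0..1}. norm (?u t) \<le> c}"
    have "closed B" unfolding B_def
      by (intro continuous_on_closed_Collect_le continuous_intros flow_cont[OF d])
    moreover have "bounded B" by (rule bounded_subset[of "{0..1}"]) (auto simp: B_def)
    ultimately have cB: "compact B" by (simp add: compact_eq_bounded_closed)
    have neB: "B \<noteq> {}" using bad t by (auto simp: B_def)
    obtain t0 where t0: "t0 \<in> B" "\<And>t. t \<in> B \<Longrightarrow> t0 \<le> t"
      using compact_attains_inf[OF cB neB] by blast
    have t01: "t0 \<in> {0..1}" using t0(1) by (simp add: B_def)
    have before: "c < norm (?u s)" if "s \<in> {0..<t0}" for s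
      using t0(2)[of s] that t01 by (force simp: B_def)
    \<comment> \<open>\<open>before\<close> covers only the times preceding \<open>t0\<close>; the
      intermediate value theorem excludes a value below \<open>c\<close> at \<open>t0\<close>
      itself.\<close>
    have "c \<le> norm (?u t0)"
    proof (rule ccontr)
      assume "\<not> ?thesis"
      then have lt: "norm (?u t0) < c" by simp
      have "flow d z lam 0 = free_data z lam 0" using flow_eq[OF d, of 0 z lam] by (simp add: volterra_def)
      then have "c < norm (?u 0)" using free[of 0] mult_pos_pos[OF lam d0] by (simp add: c_def)
      then have "\<exists>s\<ge>0. s \<le> t0 \<and> norm (?u s) = (c + norm (?u t0)) / 2"
        using lt t01 by (intro IVT2') (auto intro!: continuous_intros continuous_on_subset[OF flow_cont[OF d]])
      then obtain s where s: "0 \<le> s" "s \<le> t0" "norm (?u s) = (c + norm (?u t0)) / 2" by blast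
      then have "s \<noteq> t0" using lt by auto
      then show False using before[of s] s lt by auto
    qed
    then have "c \<le> norm (?u s)" if "s \<in> {0..t0}" for s
      using before[of s] that by (cases "s = t0") auto
    then have "c < norm (?u t0)" by (rule est[OF t01])
    then show False using t0(1) by (simp add: B_def)
  qed
  show "lam * d0 / 2 \<le> norm (?u t)" using all[OF t] by (simp add: c_def)
  show "norm (volterra (\<lambda>s. cut_force q d (?u s)) t) \<le> (lam * d0 / 2) powr (- q)"
    using all t unfolding c_def[symmetric] by (intro cut_volterra_bound[OF d c t]) auto
qed

lemma force_scale: "lam > 0 \<Longrightarrow> force (lam *\<^sub>R v) = lam powr (- q) *\<^sub>R force v"
proof -
  assume lam: "lam > 0"
  have "lam powr (- (q + 1)) * lam = lam powr (- q)"
    using lam powr_add[of lam "- (q + 1)" 1] by simp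
  then show ?thesis using lam by (simp add: force_def powr_mult mult_ac)
qed


text \<open>Three homotopies lead from the shooting map to a translation: \<open>h1\<close> replaces
  the curve by \<open>lam (x - H)\<close>, \<open>h2\<close> changes the positive factor in front of
  \<open>field\<close> to \<open>lam * \<tau>\<close>, and \<open>h3\<close> contracts the image of
  the gradient step to a point of \<open>N\<close>.\<close>

lemma local_degree:
  assumes \<Omega>: "\<Omega> \<in> bounded_components H"
  obtains N \<eta> L \<delta> where "N \<subseteq> \<Omega>" "L > 0" "\<delta> > 0"
    "\<And>lam d. L \<le> lam \<Longrightarrow> 0 < d \<Longrightarrow> d \<le> \<delta> \<Longrightarrow>
       open (near_region N \<eta> lam) \<and> bounded (near_region N \<eta> lam) \<and>
       (\<forall>z\<in>closure (near_region N \<eta> lam). shoot d (z, lam) = 0 \<longrightarrow>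
          z \<in> near_region N \<eta> lam \<and> (\<forall>t\<in>{0..1}. d \<le> norm (flow d z lam t)) \<and>
          winding_number (\<lambda>t. - flow d z lam t) 0 = of_int (component_winding \<Omega> H)) \<and>
       (\<forall>\<^sub>F \<rho> in at_right 0. cube_degree \<rho> (near_region N \<eta> lam) (\<lambda>z. shoot d (z, lam)) =
          unit_degree TYPE(complex \<times> complex) \<rho>)"
proof -
  note cf = component_facts[OF \<Omega>]
  obtain N \<tau> where N: "open N" "N \<noteq> {}" "contractible N" "closure N \<subseteq> \<Omega>" and \<tau>: "\<tau> > 0"
    and step: "\<And>x. x \<in> closure N \<Longrightarrow> x + \<tau> *\<^sub>R field x \<in> N"
    by (rule gradient_step_region[OF \<Omega>]) blast
  have N\<Omega>: "N \<subseteq> \<Omega>" using N(4) closure_subset by blast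
  have bN: "bounded N" using N\<Omega> cf(2) bounded_subset by blast
  have compN: "compact (closure N)" using bN by simp
  have av: "x \<notin> H ` {0..1}" if "x \<in> closure N" for x using that N(4) cf(5) by blast
  obtain d0 where d0: "d0 > 0" "\<And>x t. x \<in> closure N \<Longrightarrow> t \<in> {0..1} \<Longrightarrow> d0 \<le> norm (x - H t)"
  proof -
    have "closure N \<inter> H ` {0..1} = {}" using av by blast
    from separate_compact_closed[OF compN H_image_topology(2) this]
    obtain e where "e > 0" "\<forall>x\<in>closure N. \<forall>y\<in>H ` {0..1}. e \<le> dist x y" by blast
    then show ?thesis using that[of e] by (simp add: dist_norm)
  qed
  have contf: "continuous_on (closure N) field" by (rule pot_cont_component(2)[OF \<Omega> N(4)])
  have fnz: "x \<in> N" if "x \<in> closure N" "field x = 0" for x using step[OF that(1)] that(2) by simp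
  obtain m where m: "m > 0" "\<And>x. x \<in> closure N - N \<Longrightarrow> m \<le> norm (field x)"
  proof -
    have "compact (closure N - N)" using compN N(1) by (simp add: compact_diff)
    moreover have "continuous_on (closure N - N) field" using contf by (rule continuous_on_subset) auto
    moreover have "field x \<noteq> 0" if "x \<in> closure N - N" for x using fnz that by auto
    ultimately obtain m where "m > 0" "\<And>x. x \<in> closure N - N \<Longrightarrow> m \<le> infnorm (field x)"
      by (rule infnorm_pos_lower_bound) blast+
    then show ?thesis using that[of m] infnorm_le_norm order_trans by blast
  qed
  obtain k :: "real \<times> complex \<Rightarrow> complex" and a where k: "continuous_on ({0..1} \<times> N) k" "\<And>t x. t \<in> {0..1} \<Longrightarrow> x \<in> N \<Longrightarrow> k (t, x) \<in> N"
    "\<And>x. x \<in> N \<Longrightarrow> k (0, x) = x" "\<And>x. x \<in> N \<Longrightarrow> k (1, x) = a" "a \<in> N"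
    by (rule contractible_contraction[OF N(3,2)]) blast
  \<comment> \<open>\<open>E1\<close> bounds the displacement caused by the force for all
    \<open>lam \<ge> 1\<close>; \<open>L0\<close> is the Lipschitz constant of \<open>force\<close>
    beyond distance \<open>d0 / 2\<close>.\<close>
  define E1 where "E1 = (d0 / 2) powr (- q)"
  define L0 where "L0 = (q + 2) * (d0 / 2) powr (- (q + 1))"
  have E1: "E1 > 0" and L0: "L0 > 0" using d0(1) q by (auto simp: E1_def L0_def)
  \<comment> \<open>The three summands yield \<open>lam \<ge> 1\<close>,
    \<open>E < lam * d0 / 4\<close> and \<open>L0 * (2 * E / lam) < m\<close>.\<close>
  define L where "L = 1 + 8 * E1 / d0 + 4 * L0 * E1 / m"
  have L: "L > 0" using E1 L0 d0(1) m(1) by (simp add: L_def add_pos_nonneg)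
  show ?thesis
  proof (rule that[of N L "d0 / 2" "d0 / 4"])
    show "N \<subseteq> \<Omega>" by (rule N\<Omega>)
    show "L > 0" by (rule L)
    show "d0 / 2 > 0" using d0(1) by simp
    fix lam d :: real assume lamL: "L \<le> lam" and d: "0 < d" "d \<le> d0 / 2"
    define U where "U = near_region N (d0 / 4) lam"
    have pos8: "8 * E1 / d0 > 0" "4 * L0 * E1 / m > 0" using E1 L0 d0(1) m(1) by auto
    have lam1: "lam \<ge> 1" using lamL pos8 by (simp add: L_def)
    then have lam: "lam > 0" by simp
    define E where "E = (lam * d0 / 2) powr (- q)"
    have E0: "E > 0" using lam d0(1) by (simp add: E_def)
    have EE1: "E \<le> E1"
    proof -
      have "d0 / 2 \<le> lam * d0 / 2" using lam1 d0(1) by simp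
      then show ?thesis unfolding E_def E1_def using d0(1) q by (intro powr_mono2') auto
    qed
    have small: "E < lam * d0 / 4"
    proof -
      have "8 * E1 / d0 < lam" using lamL pos8 by (simp add: L_def)
      then have "8 * E1 < lam * d0" using d0(1) by (simp add: field_simps)
      then show ?thesis using EE1 E1 by linarith
    qed
    have small2: "L0 * (2 * E / lam) < m"
    proof -
      have "4 * L0 * E1 / m < lam" using lamL pos8 by (simp add: L_def)
      then have "4 * L0 * E1 < lam * m" using m(1) by (simp add: field_simps)
      moreover have "2 * L0 * E \<le> 2 * L0 * E1" using EE1 L0 by simp
      moreover have "L0 * E1 > 0" using L0 E1 by simp
      ultimately have "2 * L0 * E < lam * m" by linarith
      then show ?thesis using lam by (simp add: field_simps)
    qed
    have dlam: "d \<le> lam * d0 / 2"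
    proof -
      have "1 * (d0 / 2) \<le> lam * (d0 / 2)" using lam1 d0(1) by (intro mult_right_mono) auto
      then show ?thesis using d(2) by simp
    qed
    have U: "open U" "bounded U" unfolding U_def
      by (rule near_region_open[OF N(1)], rule near_region_bounded[OF bN lam])
    have clU: "pos_coord lam z \<in> closure N" "norm (vel_coord lam z) \<le> d0 / 4" if "z \<in> closure U" for z
      using near_region_closure[of z N "d0 / 4" lam] that by (auto simp: U_def)
    define V where "V z = volterra (\<lambda>s. cut_force q d (flow d z lam s)) 1" for z
    have Veq: "V z = snd (shoot d (z, lam)) - lam *\<^sub>R vel_coord lam z" for z
      using lam by (simp add: V_def shoot_def vel_coord_def algebra_simps)
    have near: "norm (volterra (\<lambda>s. cut_force q d (flow d z lam s)) t) \<le> E" "lam * d0 / 2 \<le> norm (flow d z lam t)"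
      if "z \<in> closure U" "t \<in> {0..1}" for z t
      using flow_near_free[OF d(1) lam d0(1) d0(2)[OF clU(1)[OF that(1)]] clU(2)[OF that(1)] small[unfolded E_def] that(2)]
      by (auto simp: E_def)
    have VE: "norm (V z) \<le> E" if "z \<in> closure U" for z unfolding V_def by (rule near(1)[OF that]) simp
    have diff: "norm (flow d z lam t - lam *\<^sub>R (pos_coord lam z - H t)) \<le> E + lam * norm (vel_coord lam z)"
      if z: "z \<in> closure U" and t: "t \<in> {0..1}" for z t
    proof -
      have "flow d z lam t - lam *\<^sub>R (pos_coord lam z - H t) =
          volterra (\<lambda>s. cut_force q d (flow d z lam s)) t + (lam * t) *\<^sub>R vel_coord lam z"
        using flow_eq[OF d(1) t, of z lam] by (simp add: free_data_coords[OF lam] algebra_simps)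
      then have "norm (flow d z lam t - lam *\<^sub>R (pos_coord lam z - H t)) \<le>
          norm (volterra (\<lambda>s. cut_force q d (flow d z lam s)) t) + norm ((lam * t) *\<^sub>R vel_coord lam z)"
        by (simp only: norm_triangle_ineq)
      moreover have "norm ((lam * t) *\<^sub>R vel_coord lam z) \<le> lam * norm (vel_coord lam z)"
        unfolding norm_scaleR using lam t by (intro mult_right_mono) auto
      ultimately show ?thesis using near(1)[OF z t] by linarith
    qed
    define w where "w z \<theta> t = \<theta> *\<^sub>R flow d z lam t + (1 - \<theta>) *\<^sub>R (lam *\<^sub>R (pos_coord lam z - H t))" for z \<theta> t
    define h1 where "h1 z \<theta> = (- integral {0..1} (\<lambda>t. cut_force q d (w z \<theta> t)), lam *\<^sub>R vel_coord lam z + \<theta> *\<^sub>R V z)" for z \<theta>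
    define h2 where "h2 z \<theta> = (- (((1 - \<theta>) * lam powr (- q) + \<theta> * (lam * \<tau>)) *\<^sub>R field (pos_coord lam z)), lam *\<^sub>R vel_coord lam z)" for z \<theta>
    define h3 where "h3 z \<theta> = (lam *\<^sub>R (pos_coord lam z - k (\<theta>, pos_coord lam z + \<tau> *\<^sub>R field (pos_coord lam z))), lam *\<^sub>R vel_coord lam z)" for z \<theta>
    have shoot_h1: "shoot d (z, lam) = h1 z 1" for z
      using lam by (simp add: shoot_def h1_def w_def V_def vel_coord_def algebra_simps)
    \<comment> \<open>The second component bounds the velocity coordinate by \<open>E / lam\<close>.
      The curve divided by \<open>lam\<close> is then within \<open>2 * E / lam\<close> of
      \<open>x - H\<close>, and the first component makes \<open>field x\<close> smaller than
      \<open>m\<close>, which excludes \<open>x\<close> from the boundary of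
      \<open>N\<close>.\<close>
    have h1_zero: "z \<in> U \<and> (\<forall>t\<in>{0..1}. norm (w z \<theta> t - lam *\<^sub>R (pos_coord lam z - H t)) \<le> 2 * E)"
      if z: "z \<in> closure U" and \<theta>: "\<theta> \<in> {0..1}" and h0: "h1 z \<theta> = 0" for z \<theta>
    proof -
      have "lam *\<^sub>R vel_coord lam z = - (\<theta> *\<^sub>R V z)" using h0 by (simp add: h1_def zero_prod_def add_eq_0_iff)
      then have "lam * norm (vel_coord lam z) = \<theta> * norm (V z)" using lam \<theta>
        by (metis abs_of_nonneg atLeastAtMost_iff less_eq_real_def norm_minus_cancel norm_scaleR)
      also have "\<dots> \<le> 1 * E" using \<theta> VE[OF z] by (intro mult_mono) auto
      finally have vE: "lam * norm (vel_coord lam z) \<le> E" by simp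
      then have "lam * norm (vel_coord lam z) < lam * (d0 / 4)" using small by simp
      then have vel: "norm (vel_coord lam z) < d0 / 4" using lam by simp
      have wd: "norm (w z \<theta> t - lam *\<^sub>R (pos_coord lam z - H t)) \<le> 2 * E" if t: "t \<in> {0..1}" for t
      proof -
        have "w z \<theta> t - lam *\<^sub>R (pos_coord lam z - H t) = \<theta> *\<^sub>R (flow d z lam t - lam *\<^sub>R (pos_coord lam z - H t))"
          by (simp add: w_def algebra_simps)
        then have "norm (w z \<theta> t - lam *\<^sub>R (pos_coord lam z - H t)) = \<theta> * norm (flow d z lam t - lam *\<^sub>R (pos_coord lam z - H t))"
          using \<theta> by simp
        also have "\<dots> \<le> 1 * (E + lam * norm (vel_coord lam z))"
          using \<theta> diff[OF z t] by (intro mult_mono) auto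
        finally show ?thesis using vE by simp
      qed
      have "pos_coord lam z \<in> N"
      proof (rule ccontr)
        assume nN: "pos_coord lam z \<notin> N"
        let ?x = "pos_coord lam z"
        have xc: "?x \<in> closure N" by (rule clU(1)[OF z])
        let ?v = "\<lambda>t. w z \<theta> t /\<^sub>R lam"
        have vx: "norm (?v t - (?x - H t)) \<le> 2 * E / lam" if t: "t \<in> {0..1}" for t
        proof -
          have "?v t - (?x - H t) = (w z \<theta> t - lam *\<^sub>R (?x - H t)) /\<^sub>R lam" using lam by (simp add: algebra_simps)
          then have "norm (?v t - (?x - H t)) = norm (w z \<theta> t - lam *\<^sub>R (?x - H t)) / lam"
            using lam by (simp add: divide_inverse mult.commute)
          then show ?thesis using wd[OF t] lam by (simp add: divide_right_mono)
        qed
        have E2: "2 * E / lam < d0 / 2" using small lam by (simp add: field_simps)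
        have vfar: "d0 / 2 \<le> norm (?v t)" if t: "t \<in> {0..1}" for t
        proof -
          have "norm (?x - H t) \<le> norm (?v t) + norm (?v t - (?x - H t))"
            using norm_triangle_ineq4[of "?v t" "?v t - (?x - H t)"] by simp
          then show ?thesis using vx[OF t] E2 d0(2)[OF xc t] by linarith
        qed
        have cutw: "cut_force q d (w z \<theta> t) = lam powr (- q) *\<^sub>R force (?v t)" if t: "t \<in> {0..1}" for t
        proof -
          have "w z \<theta> t = lam *\<^sub>R ?v t" using lam by simp
          moreover have "d \<le> norm (lam *\<^sub>R ?v t)"
          proof -
            have "lam * (d0 / 2) \<le> lam * norm (?v t)" using vfar[OF t] lam by (intro mult_left_mono) auto
            moreover have "norm (lam *\<^sub>R ?v t) = lam * norm (?v t)" by (simp only: norm_scaleR abs_of_pos[OF lam])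
            moreover have "lam * (d0 / 2) = lam * d0 / 2" by simp
            ultimately show ?thesis using dlam by linarith
          qed
          ultimately show ?thesis using cut_force_far force_scale[OF lam] by metis
        qed
        have cw: "continuous_on {0..1} (w z \<theta>)"
          unfolding w_def by (intro continuous_intros flow_cont[OF d(1)] cont_H)
        have cfv: "continuous_on {0..1} (\<lambda>t. force (?v t))"
        proof (rule continuous_on_compose2[OF force_continuous])
          show "continuous_on {0..1} ?v" by (intro continuous_intros cw)
          have "?v t \<noteq> 0" if "t \<in> {0..1}" for t using vfar[OF that] d0(1) by auto
          then show "?v ` {0..1} \<subseteq> - {0}" by auto
        qed
        have "integral {0..1} (\<lambda>t. cut_force q d (w z \<theta> t)) = integral {0..1} (\<lambda>t. lam powr (- q) *\<^sub>R force (?v t))"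
          by (rule Henstock_Kurzweil_Integration.integral_cong) (rule cutw)
        then have "lam powr (- q) *\<^sub>R integral {0..1} (\<lambda>t. force (?v t)) = 0"
          using h0 by (simp add: h1_def zero_prod_def)
        then have I0: "integral {0..1} (\<lambda>t. force (?v t)) = 0" using lam by simp
        have "field ?x = field ?x - integral {0..1} (\<lambda>t. force (?v t))" by (simp add: I0)
        also have "\<dots> = integral {0..1} (\<lambda>t. force (?x - H t) - force (?v t))"
          unfolding field_def
          by (subst integral_diff) (auto intro!: integrable_along_H force_continuous av[OF xc] integrable_continuous_real cfv)
        also have "norm \<dots> \<le> (L0 * (2 * E / lam)) * (1 - 0)"
        proof (rule integral_bound)
          show "continuous_on {0..1} (\<lambda>t. force (?x - H t) - force (?v t))"
            by (intro continuous_on_diff integrable_along_H(2) force_continuous av[OF xc] cfv)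
          show "norm (force (?x - H t) - force (?v t)) \<le> L0 * (2 * E / lam)" if t: "t \<in> {0..1}" for t
          proof -
            have "d0 / 2 \<le> norm (?x - H t)" using d0(1) d0(2)[OF xc t] by linarith
            then have "norm (force (?x - H t) - force (?v t)) \<le> L0 * norm ((?x - H t) - ?v t)"
              using cut_force_lipschitz[of q "d0 / 2" "?x - H t" "?v t"] q d0(1) vfar[OF t]
              by (simp add: cut_force_far L0_def)
            also have "\<dots> \<le> L0 * (2 * E / lam)"
              using vx[OF t] L0 by (intro mult_left_mono) (auto simp: norm_minus_commute)
            finally show ?thesis .
          qed
        qed simp
        finally show False using m(2)[of ?x] xc nN small2 by simp
      qed
      then show ?thesis using vel wd by (simp add: U_def near_region_def)
    qed
    have cUcoord: "continuous_on (closure U \<times> {0..1}) (\<lambda>p. pos_coord lam (fst p))"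
      "continuous_on (closure U \<times> {0..1}) (\<lambda>p. vel_coord lam (fst p))"
      unfolding pos_coord_def vel_coord_def by (intro continuous_intros)+
    have cfield: "continuous_on (closure U \<times> {0..1}) (\<lambda>p. field (pos_coord lam (fst p)))"
      by (rule continuous_on_compose2[OF contf cUcoord(1)]) (use clU in auto)
    have hom1: "\<forall>\<^sub>F \<rho> in at_right 0. cube_degree \<rho> U (\<lambda>z. h1 z 0) = cube_degree \<rho> U (\<lambda>z. h1 z 1)"
    proof (rule cube_degree_homotopy_cylinder[OF U])
      have "continuous_on ((closure U \<times> {0..1}) \<times> cbox 0 1) (\<lambda>p. flow d (fst (fst p)) lam (snd p))"
      proof -
        have "continuous_on ((closure U \<times> {0..1}) \<times> cbox 0 1) (\<lambda>p. case (fst (fst p), snd p) of (z, t) \<Rightarrow> flow d z lam t)"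
          by (rule continuous_on_compose2[OF flow_joint_continuous[OF d(1)]]) (auto intro!: continuous_intros)
        then show ?thesis by simp
      qed
      moreover have "continuous_on ((closure U \<times> {0..1}) \<times> cbox 0 1) (\<lambda>p. H (snd p))"
        by (rule continuous_on_compose2[OF cont_H]) (auto intro!: continuous_intros)
      moreover have "continuous_on ((closure U \<times> {0..1}) \<times> cbox 0 1) (\<lambda>p. pos_coord lam (fst (fst p)))"
        unfolding pos_coord_def by (intro continuous_intros)
      ultimately have "continuous_on ((closure U \<times> {0..1}) \<times> cbox 0 1) (\<lambda>p. w (fst (fst p)) (snd (fst p)) (snd p))"
        unfolding w_def by (intro continuous_intros)
      then have "continuous_on ((closure U \<times> {0..1}) \<times> cbox 0 1) (\<lambda>p. cut_force q d (w (fst (fst p)) (snd (fst p)) (snd p)))"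
        by (rule continuous_on_compose2[OF cut_force_cont[OF d(1), of UNIV]]) auto
      then have "continuous_on (closure U \<times> {0..1}) (\<lambda>p. integral (cbox 0 1) (\<lambda>t. cut_force q d (w (fst p) (snd p) t)))"
        by (intro integral_continuous_on_param) (simp add: split_beta)
      then have 1: "continuous_on (closure U \<times> {0..1}) (\<lambda>p. integral {0..1} (\<lambda>t. cut_force q d (w (fst p) (snd p) t)))"
        by simp
      have "continuous_on (closure U \<times> {0..1::real}) (\<lambda>p. shoot d (fst p, lam))"
        by (rule continuous_on_compose2[OF shoot_continuous[OF d(1), of UNIV]]) (auto intro!: continuous_intros)
      then have 2: "continuous_on (closure U \<times> {0..1::real}) (\<lambda>p. V (fst p))"
        unfolding Veq by (intro continuous_intros cUcoord)
      show "continuous_on (closure U \<times> {0..1}) (\<lambda>(z, \<theta>). h1 z \<theta>)"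
        unfolding h1_def split_beta by (intro continuous_intros 1 2 cUcoord)
      show "z \<in> U" if "z \<in> closure U" "\<theta> \<in> {0..1}" "h1 z \<theta> = 0" for z \<theta>
        using h1_zero[OF that] by blast
    qed
    have in_U: "z \<in> U" if "pos_coord lam z \<in> N" "lam *\<^sub>R vel_coord lam z = 0" for z
      using that lam d0(1) by (auto simp: U_def near_region_def)
    have hom2: "\<forall>\<^sub>F \<rho> in at_right 0. cube_degree \<rho> U (\<lambda>z. h2 z 0) = cube_degree \<rho> U (\<lambda>z. h2 z 1)"
    proof (rule cube_degree_homotopy_cylinder[OF U])
      show "continuous_on (closure U \<times> {0..1}) (\<lambda>(z, \<theta>). h2 z \<theta>)"
        unfolding h2_def split_beta by (intro continuous_intros cUcoord cfield)
      show "z \<in> U" if z: "z \<in> closure U" and \<theta>: "\<theta> \<in> {0..1}" and h0: "h2 z \<theta> = 0" for z \<theta>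
      proof -
        have "(1 - \<theta>) * lam powr (- q) + \<theta> * (lam * \<tau>) > 0"
        proof (cases "\<theta> = 0")
          case False
          then have "\<theta> * (lam * \<tau>) > 0" using \<theta> lam \<tau> by simp
          moreover have "(1 - \<theta>) * lam powr (- q) \<ge> 0" using \<theta> by simp
          ultimately show ?thesis by linarith
        qed (use lam in simp)
        then have "field (pos_coord lam z) = 0" "lam *\<^sub>R vel_coord lam z = 0"
          using h0 by (simp_all add: h2_def zero_prod_def)
        then show ?thesis using fnz[OF clU(1)[OF z]] in_U by blast
      qed
    qed
    \<comment> \<open>At a zero, \<open>x\<close> is a value of the contraction \<open>k\<close> and
      hence a point of \<open>N\<close>.\<close>
    have hom3: "\<forall>\<^sub>F \<rho> in at_right 0. cube_degree \<rho> U (\<lambda>z. h3 z 0) = cube_degree \<rho> U (\<lambda>z. h3 z 1)"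
    proof (rule cube_degree_homotopy_cylinder[OF U])
      have "continuous_on (closure U \<times> {0..1}) (\<lambda>p. k (snd p, pos_coord lam (fst p) + \<tau> *\<^sub>R field (pos_coord lam (fst p))))"
        by (rule continuous_on_compose2[OF k(1)]) (use step clU in \<open>auto intro!: continuous_intros cUcoord cfield\<close>)
      then show "continuous_on (closure U \<times> {0..1}) (\<lambda>(z, \<theta>). h3 z \<theta>)"
        unfolding h3_def split_beta by (intro continuous_intros cUcoord)
      show "z \<in> U" if z: "z \<in> closure U" and \<theta>: "\<theta> \<in> {0..1}" and h0: "h3 z \<theta> = 0" for z \<theta>
      proof -
        have "pos_coord lam z = k (\<theta>, pos_coord lam z + \<tau> *\<^sub>R field (pos_coord lam z))" "lam *\<^sub>R vel_coord lam z = 0"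
          using h0 lam by (simp_all add: h3_def zero_prod_def)
        then show ?thesis using k(2)[OF \<theta> step[OF clU(1)[OF z]]] in_U by metis
      qed
    qed
    have h12: "cube_degree \<rho> U (\<lambda>z. h1 z 0) = cube_degree \<rho> U (\<lambda>z. h2 z 0)" for \<rho>
    proof (rule cube_degree_cong)
      fix z assume z: "z \<in> closure U"
      have "cut_force q d (w z 0 t) = lam powr (- q) *\<^sub>R force (pos_coord lam z - H t)" if t: "t \<in> {0..1}" for t
      proof -
        have "lam * (d0 / 2) \<le> lam * norm (pos_coord lam z - H t)"
          using d0(1) d0(2)[OF clU(1)[OF z] t] lam by (intro mult_left_mono) auto
        moreover have "norm (lam *\<^sub>R (pos_coord lam z - H t)) = lam * norm (pos_coord lam z - H t)"
          by (simp only: norm_scaleR abs_of_pos[OF lam])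
        moreover have "lam * (d0 / 2) = lam * d0 / 2" by simp
        ultimately have "d \<le> norm (lam *\<^sub>R (pos_coord lam z - H t))" using dlam by linarith
        then show ?thesis by (simp add: w_def cut_force_far force_scale[OF lam])
      qed
      then have "integral {0..1} (\<lambda>t. cut_force q d (w z 0 t)) =
          integral {0..1} (\<lambda>t. lam powr (- q) *\<^sub>R force (pos_coord lam z - H t))"
        by (rule Henstock_Kurzweil_Integration.integral_cong)
      then show "h1 z 0 = h2 z 0" by (simp add: h1_def h2_def field_def)
    qed
    have h23: "cube_degree \<rho> U (\<lambda>z. h2 z 1) = cube_degree \<rho> U (\<lambda>z. h3 z 0)" for \<rho>
      by (rule cube_degree_cong) (use step clU k(3) in \<open>simp add: h2_def h3_def\<close>)
    define z0 where "z0 = (lam *\<^sub>R (a - H 0), - (lam *\<^sub>R H' 0))"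
    have z0U: "z0 \<in> U" using lam k(5) d0(1) by (simp add: z0_def U_def near_region_def pos_coord_def vel_coord_def)
    have h3t: "cube_degree \<rho> U (\<lambda>z. h3 z 1) = cube_degree \<rho> U (\<lambda>z. z - z0)" for \<rho>
    proof (rule cube_degree_cong)
      fix z assume z: "z \<in> closure U"
      show "h3 z 1 = z - z0"
        using lam k(4)[OF step[OF clU(1)[OF z]]]
        by (cases z) (simp add: h3_def z0_def pos_coord_def vel_coord_def algebra_simps)
    qed
    have deg: "\<forall>\<^sub>F \<rho> in at_right 0. cube_degree \<rho> U (\<lambda>z. shoot d (z, lam)) = unit_degree TYPE(complex \<times> complex) \<rho>"
      using hom1 hom2 hom3 cube_degree_translation[OF U z0U]
      by eventually_elim (simp add: shoot_h1 h12 h23 h3t)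
    have zeros: "z \<in> U \<and> (\<forall>t\<in>{0..1}. d \<le> norm (flow d z lam t)) \<and>
          winding_number (\<lambda>t. - flow d z lam t) 0 = of_int (component_winding \<Omega> H)"
      if z: "z \<in> closure U" and s0: "shoot d (z, lam) = 0" for z
    proof -
      let ?x = "pos_coord lam z"
      have hz: "z \<in> U" "\<And>t. t \<in> {0..1} \<Longrightarrow> norm (flow d z lam t - lam *\<^sub>R (?x - H t)) \<le> 2 * E"
        using h1_zero[OF z, of 1] s0 by (simp_all add: shoot_h1 w_def)
      have dl: "d \<le> norm (flow d z lam t)" if "t \<in> {0..1}" for t using near(2)[OF z that] dlam by linarith
      have xN: "?x \<in> \<Omega>" using clU(1)[OF z] N(4) by blast
      have pu: "path (\<lambda>t. - flow d z lam t)" and pH: "path (\<lambda>t. lam *\<^sub>R (H t - ?x))" "path (\<lambda>t. H t - ?x)" "path H"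
        unfolding path_def by (intro continuous_intros flow_cont[OF d(1)] cont_H)+
      have clo: "pathfinish (\<lambda>t. - flow d z lam t) = pathstart (\<lambda>t. - flow d z lam t)"
        "pathfinish (\<lambda>t. lam *\<^sub>R (H t - ?x)) = pathstart (\<lambda>t. lam *\<^sub>R (H t - ?x))"
        "pathfinish (\<lambda>t. H t - ?x) = pathstart (\<lambda>t. H t - ?x)" "pathfinish H = pathstart H"
        using shoot_zero_periodic[OF d(1) s0] periodic_H by (auto simp: pathfinish_def pathstart_def)
      \<comment> \<open>\<open>- flow\<close> is closer to \<open>lam (H - x)\<close> than the
        latter is to 0; removing the factor \<open>lam\<close> leaves the winding number of
        \<open>H\<close> around \<open>x\<close>. This is the origin of the minus sign.\<close>
      have "winding_number (\<lambda>t. - flow d z lam t) 0 = winding_number (\<lambda>t. lam *\<^sub>R (H t - ?x)) 0"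
      proof (rule winding_number_nearby_loops_eq[OF pH(1) pu clo(2) clo(1)])
        fix t :: real assume t: "t \<in> {0..1}"
        have "norm (- flow d z lam t - lam *\<^sub>R (H t - ?x)) = norm (flow d z lam t - lam *\<^sub>R (?x - H t))"
          using norm_minus_cancel[of "flow d z lam t - lam *\<^sub>R (?x - H t)"] by (simp add: algebra_simps)
        also have "\<dots> \<le> 2 * E" by (rule hz(2)[OF t])
        also have "\<dots> < lam * d0" using small lam d0(1) E0 by linarith
        also have "\<dots> \<le> lam * norm (?x - H t)" using d0(2)[OF clU(1)[OF z] t] lam by (intro mult_left_mono) auto
        also have "\<dots> = norm (lam *\<^sub>R (H t - ?x) - 0)" using lam by (simp add: norm_minus_commute)
        finally show "norm (- flow d z lam t - lam *\<^sub>R (H t - ?x)) < norm (lam *\<^sub>R (H t - ?x) - 0)" .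
      qed
      also have "\<dots> = winding_number (\<lambda>t. H t - ?x) 0"
      proof (rule winding_number_loops_linear_eq[OF pH(2) pH(1) clo(3) clo(2)])
        fix t :: real assume t: "t \<in> {0..1}"
        show "0 \<notin> closed_segment (H t - ?x) (lam *\<^sub>R (H t - ?x))"
        proof
          assume "0 \<in> closed_segment (H t - ?x) (lam *\<^sub>R (H t - ?x))"
          then obtain s where s: "0 \<le> s" "s \<le> 1" "0 = (1 - s) *\<^sub>R (H t - ?x) + s *\<^sub>R (lam *\<^sub>R (H t - ?x))"
            by (auto simp: closed_segment_def)
          then have "((1 - s) + s * lam) *\<^sub>R (H t - ?x) = 0" by (simp add: algebra_simps)
          moreover have "H t - ?x \<noteq> 0" using d0(1) d0(2)[OF clU(1)[OF z] t] by auto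
          moreover have "(1 - s) + s * lam > 0"
          proof (cases "s = 0")
            case False
            then have "s * lam > 0" using s lam by simp
            then show ?thesis using s by linarith
          qed simp
          ultimately show False by simp
        qed
      qed
      also have "\<dots> = winding_number H ?x" by (rule winding_number_offset[symmetric])
      also have "\<dots> = of_int (component_winding \<Omega> H)"
        by (rule component_winding_eq[OF pH(3) clo(4) _ xN]) (use cf(1) in \<open>simp add: H_image\<close>)
      finally show ?thesis using hz(1) dl by blast
    qed
    show "open (near_region N (d0 / 4) lam) \<and> bounded (near_region N (d0 / 4) lam) \<and>
       (\<forall>z\<in>closure (near_region N (d0 / 4) lam). shoot d (z, lam) = 0 \<longrightarrow>
          z \<in> near_region N (d0 / 4) lam \<and> (\<forall>t\<in>{0..1}. d \<le> norm (flow d z lam t)) \<and>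
          winding_number (\<lambda>t. - flow d z lam t) 0 = of_int (component_winding \<Omega> H)) \<and>
       (\<forall>\<^sub>F \<rho> in at_right 0. cube_degree \<rho> (near_region N (d0 / 4) lam) (\<lambda>z. shoot d (z, lam)) =
          unit_degree TYPE(complex \<times> complex) \<rho>)"
      using U deg zeros unfolding U_def by blast
  qed
qed

end

section \<open>Multiplicity\<close>

context forced_problem
begin

text \<open>The value at 0 gives the position; equal curves have equal Volterra terms, so the value
  at 1 gives the velocity. Distinct zeros of \<open>shoot\<close> thus count as distinct
  solutions.\<close>

lemma flow_inject:
  assumes d: "d > 0" and eq: "\<And>t. t \<in> {0..1} \<Longrightarrow> flow d z lam t = flow d z' lam t"
  shows "z = z'"
proof -
  have "fst z = fst z'" using eq[of 0] by (simp add: flow_0[OF d])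
  moreover have "volterra (\<lambda>s. cut_force q d (flow d z lam s)) 1 = volterra (\<lambda>s. cut_force q d (flow d z' lam s)) 1"
    unfolding volterra_def by (rule Henstock_Kurzweil_Integration.integral_cong) (simp add: eq)
  then have "free_data z lam 1 = free_data z' lam 1"
    using flow_eq[OF d, of 1 z lam] flow_eq[OF d, of 1 z' lam] eq[of 1] by simp
  ultimately show ?thesis by (simp add: free_data_def prod_eq_iff)
qed

text \<open>The conclusion of \<open>local_degree\<close> as a predicate, so that its data can be
  chosen for all components at once.\<close>

definition good_data :: "complex set \<Rightarrow> complex set \<Rightarrow> real \<Rightarrow> real \<Rightarrow> real \<Rightarrow> bool" where
  "good_data \<Omega> N \<eta> L \<delta> \<longleftrightarrow> N \<subseteq> \<Omega> \<and> L > 0 \<and> \<delta> > 0 \<and>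
    (\<forall>lam d. L \<le> lam \<longrightarrow> 0 < d \<longrightarrow> d \<le> \<delta> \<longrightarrow>
       open (near_region N \<eta> lam) \<and> bounded (near_region N \<eta> lam) \<and>
       (\<forall>z\<in>closure (near_region N \<eta> lam). shoot d (z, lam) = 0 \<longrightarrow>
          z \<in> near_region N \<eta> lam \<and> (\<forall>t\<in>{0..1}. d \<le> norm (flow d z lam t)) \<and>
          winding_number (\<lambda>t. - flow d z lam t) 0 = of_int (component_winding \<Omega> H)) \<and>
       (\<forall>\<^sub>F \<rho> in at_right 0. cube_degree \<rho> (near_region N \<eta> lam) (\<lambda>z. shoot d (z, lam)) =
          unit_degree TYPE(complex \<times> complex) \<rho>))"

lemma good_data_exists:
  assumes "\<Omega> \<in> bounded_components H"
  shows "\<exists>N \<eta> L \<delta>. good_data \<Omega> N \<eta> L \<delta>"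
  by (rule local_degree[OF assms]) (unfold good_data_def, blast)

text \<open>The conclusion of \<open>a_priori_bounds\<close> as a predicate, so that it can be
  handed on as a hypothesis.\<close>

definition uniform_bound :: "real \<Rightarrow> real \<Rightarrow> real \<Rightarrow> bool" where
  "uniform_bound lam c R \<longleftrightarrow> (\<forall>mu u u' u''. 0 \<le> mu \<longrightarrow> mu \<le> lam \<longrightarrow> C2_derivs u u' u'' \<longrightarrow>
     (\<forall>t\<in>{0..1}. u t \<noteq> 0) \<longrightarrow>
     (\<forall>t\<in>{0..1}. u'' t - u t /\<^sub>R (norm (u t) powr (q + 1)) = mu *\<^sub>R h t) \<longrightarrow>
     u 0 = u 1 \<longrightarrow> u' 0 = u' 1 \<longrightarrow>
     mu \<noteq> 0 \<and> (\<forall>t\<in>{0..1}. c \<le> norm (u t)) \<and> norm (u 0) \<le> R \<and> norm (u' 0) \<le> R)"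

lemma uniform_bound_exists:
  assumes "lam > 0"
  obtains c R where "c > 0" "uniform_bound lam c R"
proof (rule a_priori_bounds[OF less_imp_le[OF assms]])
  fix c R :: real
  assume c: "c > 0" and R: "\<And>mu u u' u''. \<lbrakk>0 \<le> mu; mu \<le> lam; C2_derivs u u' u'';
      \<And>t. t \<in> {0..1} \<Longrightarrow> u t \<noteq> 0;
      \<And>t. t \<in> {0..1} \<Longrightarrow> u'' t - u t /\<^sub>R (norm (u t) powr (q + 1)) = mu *\<^sub>R h t;
      u 0 = u 1; u' 0 = u' 1\<rbrakk> \<Longrightarrow>
      mu \<noteq> 0 \<and> (\<forall>t\<in>{0..1}. c \<le> norm (u t)) \<and> norm (u 0) \<le> R \<and> norm (u' 0) \<le> R"
  have "uniform_bound lam c R"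
    unfolding uniform_bound_def by (intro allI impI, rule R) auto
  then show ?thesis by (rule that[OF c])
qed

text \<open>
  Within one winding class the zeros of \<open>shoot\<close> form a separated part of the zero set, uniformly in
  the parameter, and they disappear when the forcing is switched off.
\<close>

lemma extra_periodic_datum:
  assumes lam: "lam > 0" and d: "d > 0" and dc: "2 * d \<le> c"
    and ub: "uniform_bound lam c R"
    and I: "finite I" "I \<noteq> {}" "disjoint_family_on U I"
    and U: "\<And>i. i \<in> I \<Longrightarrow> open (U i)" "\<And>i. i \<in> I \<Longrightarrow> bounded (U i)"
    and zU: "\<And>i z. i \<in> I \<Longrightarrow> z \<in> closure (U i) \<Longrightarrow> shoot d (z, lam) = 0 \<Longrightarrow>
      z \<in> U i \<and> (\<forall>t\<in>{0..1}. d \<le> norm (flow d z lam t)) \<and> winding_number (\<lambda>t. - flow d z lam t) 0 = of_int j"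
    and deg: "\<And>i. i \<in> I \<Longrightarrow> \<forall>\<^sub>F \<rho> in at_right 0. cube_degree \<rho> (U i) (\<lambda>z. shoot d (z, lam)) =
      unit_degree TYPE(complex \<times> complex) \<rho>"
  shows "\<exists>z. shoot d (z, lam) = 0 \<and> (\<forall>t\<in>{0..1}. d \<le> norm (flow d z lam t)) \<and>
    winding_number (\<lambda>t. - flow d z lam t) 0 = of_int j \<and> z \<notin> (\<Union>i\<in>I. U i)"
proof -
  \<comment> \<open>The forcing parameter is \<open>snd p * lam\<close>, so the homotopy parameter
    runs through \<open>{0..1}\<close>.\<close>
  define fl where "fl p = flow d (fst p) (snd p * lam)" for p :: "(complex \<times> complex) \<times> real"
  define f where "f p = shoot d (fst p, snd p * lam)" for p :: "(complex \<times> complex) \<times> real"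
  define Z where "Z = {p. snd p \<in> {0..1} \<and> f p = 0 \<and> (\<forall>s\<in>{0..1}. d \<le> norm (fl p s)) \<and>
    winding_number (\<lambda>s. - fl p s) 0 = of_int j}"
  \<comment> \<open>A zero whose curve avoids the disc of radius \<open>d\<close> solves the
    original equation, so the a priori bounds push its curve out to \<open>c\<close>. This gain from
    \<open>d\<close> to \<open>c \<ge> 2 * d\<close> is what separates \<open>Z\<close> from all
    other zeros.\<close>
  have genuine: "snd p \<noteq> 0 \<and> (\<forall>t\<in>{0..1}. c \<le> norm (fl p t)) \<and> norm (fst (fst p)) \<le> R \<and> norm (snd (fst p)) \<le> R"
    if p: "snd p \<in> {0..1}" "f p = 0" "\<forall>s\<in>{0..1}. d \<le> norm (fl p s)" for p
  proof -
    let ?z = "fst p" and ?mu = "snd p * lam"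
    have s0: "shoot d (?z, ?mu) = 0" using p(2) by (simp add: f_def)
    have "?mu \<noteq> 0 \<and> (\<forall>t\<in>{0..1}. c \<le> norm (flow d ?z ?mu t)) \<and> norm (flow d ?z ?mu 0) \<le> R \<and> norm (flow' d ?z ?mu 0) \<le> R"
    proof (rule ub[unfolded uniform_bound_def, rule_format, OF _ _ flow_C2[OF d]])
      show "0 \<le> ?mu" "?mu \<le> lam" using p(1) lam by (auto simp: mult_left_le_one_le)
      show "flow d ?z ?mu t \<noteq> 0" if "t \<in> {0..1}" for t using p(3) that d by (force simp: fl_def)
      show "cut_force q d (flow d ?z ?mu t) + ?mu *\<^sub>R h t - flow d ?z ?mu t /\<^sub>R (norm (flow d ?z ?mu t) powr (q + 1)) = ?mu *\<^sub>R h t"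
        if "t \<in> {0..1}" for t
        using cut_force_eq[of d "flow d ?z ?mu t"] p(3) that by (simp add: fl_def)
    qed (use shoot_zero_periodic[OF d s0] in auto)
    then show ?thesis by (auto simp: fl_def flow_0[OF d] flow'_0[OF d])
  qed
  obtain C where C: "C > 0" "\<And>z mu z' mu' t. t \<in> {0..1} \<Longrightarrow>
       norm (flow d z mu t - flow d z' mu' t) \<le> C * dist (z, mu) (z', mu')"
    by (rule flow_lipschitz[OF d]) blast
  define C' where "C' = C * (1 + lam)"
  have C': "C' > 0" using C(1) lam by (simp add: C'_def)
  have lipfl: "norm (fl p t - fl p' t) \<le> C' * dist p p'" if "t \<in> {0..1}" for p p' t
  proof -
    have "dist (fst p, snd p * lam) (fst p', snd p' * lam) \<le> dist (fst p) (fst p') + dist (snd p * lam) (snd p' * lam)"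
      unfolding dist_Pair_Pair by (rule sqrt_sum_squares_le_sum) auto
    also have "dist (snd p * lam) (snd p' * lam) = lam * dist (snd p) (snd p')"
      using lam by (simp add: dist_real_def abs_mult flip: left_diff_distrib)
    also have "dist (fst p) (fst p') + lam * dist (snd p) (snd p') \<le> dist p p' + lam * dist p p'"
      using lam by (intro add_mono mult_left_mono dist_fst_le dist_snd_le) auto
    finally have "C * dist (fst p, snd p * lam) (fst p', snd p' * lam) \<le> C * (dist p p' + lam * dist p p')"
      using C(1) by (intro mult_left_mono) auto
    then show ?thesis using C(2)[OF that, of "fst p" "snd p * lam" "fst p'" "snd p' * lam"]
      by (simp add: fl_def C'_def algebra_simps)
  qed
  \<comment> \<open>Points closer than this have curves closer than \<open>d\<close>; next to a
    curve beyond \<open>c\<close>, the neighbour stays beyond \<open>d\<close> and has the same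
    winding number around 0.\<close>
  define \<epsilon> where "\<epsilon> = d / C'"
  have \<epsilon>: "\<epsilon> > 0" using d C' by (simp add: \<epsilon>_def)
  have closed_fl: "path (\<lambda>s. - fl p s)" "pathfinish (\<lambda>s. - fl p s) = pathstart (\<lambda>s. - fl p s)" if "f p = 0" for p
    using that shoot_zero_periodic[OF d, of "fst p" "snd p * lam"]
    by (auto simp: path_def pathfinish_def pathstart_def fl_def f_def intro!: continuous_intros flow_cont[OF d])
  have sep: "p' \<in> Z" if p: "p \<in> Z" and p': "snd p' \<in> {0..1}" "f p' = 0" "dist p p' < \<epsilon>" for p p'
  proof -
    have close: "norm (fl p t - fl p' t) < d" if "t \<in> {0..1}" for t
    proof -
      have "C' * dist p p' < C' * \<epsilon>" using p'(3) C' by (intro mult_strict_left_mono) auto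
      then show ?thesis using lipfl[OF that, of p p'] C' by (simp add: \<epsilon>_def)
    qed
    have big: "c \<le> norm (fl p t)" if "t \<in> {0..1}" for t using genuine[of p] p that by (auto simp: Z_def)
    have "d \<le> norm (fl p' t)" if "t \<in> {0..1}" for t
      using close[OF that] big[OF that] dc norm_triangle_ineq2[of "fl p t" "fl p' t"] by linarith
    moreover have "winding_number (\<lambda>s. - fl p' s) 0 = winding_number (\<lambda>s. - fl p s) 0"
    proof (rule winding_number_nearby_loops_eq)
      show "norm (- fl p' t - - fl p t) < norm (- fl p t - 0)" if "t \<in> {0..1}" for t
        using close[OF that] big[OF that] dc d by simp
    qed (use closed_fl p p' in \<open>auto simp: Z_def\<close>)
    ultimately show ?thesis using p p' by (auto simp: Z_def)
  qed
  \<comment> \<open>Half of \<open>\<epsilon>\<close>, so that points of the closure of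
    \<open>W\<close> are still within \<open>\<epsilon>\<close> of \<open>Z\<close>.\<close>
  define W where "W = (\<Union>p\<in>Z. ball p (\<epsilon> / 2))"
  have W: "open W" unfolding W_def by auto
  have "norm p \<le> (R + R) + 1" if "p \<in> Z" for p
  proof -
    have "norm (fst (fst p)) \<le> R" "norm (snd (fst p)) \<le> R" "norm (snd p) \<le> 1"
      using genuine[of p] that by (auto simp: Z_def)
    then show ?thesis using norm_Pair_le[of "fst (fst p)" "snd (fst p)"] norm_Pair_le[of "fst p" "snd p"] by simp
  qed
  then obtain B where B: "\<And>p. p \<in> Z \<Longrightarrow> norm p \<le> B" by blast
  have bW: "bounded W"
  proof -
    have "norm w \<le> B + \<epsilon> / 2" if w: "w \<in> W" for w
    proof -
      obtain p where p: "p \<in> Z" "dist p w < \<epsilon> / 2" using w by (auto simp: W_def)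
      then show ?thesis using B[OF p(1)] norm_triangle_ineq2[of w p] by (simp add: dist_norm norm_minus_commute)
    qed
    then show ?thesis unfolding bounded_iff by blast
  qed
  have ZW: "Z \<subseteq> W" using \<epsilon> by (force simp: W_def)
  have clW: "p \<in> Z" if p: "p \<in> closure W" "snd p \<in> {0..1}" "f p = 0" for p
  proof -
    obtain w where w: "w \<in> W" "dist w p < \<epsilon> / 2"
      using p(1) \<epsilon> closure_approachable[of p W] by (meson half_gt_zero)
    obtain p0 where p0: "p0 \<in> Z" "dist p0 w < \<epsilon> / 2" using w(1) by (auto simp: W_def)
    have "dist p0 p < \<epsilon>" using w(2) p0(2) dist_triangle[of p0 p w] by linarith
    then show ?thesis by (rule sep[OF p0(1) p(2,3)])
  qed
  have f1: "f (z, 1) = shoot d (z, lam)" "fl (z, 1) = flow d z lam" for z by (simp_all add: f_def fl_def)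
  have "\<exists>z. (z, 1) \<in> W \<and> f (z, 1) = 0 \<and> z \<notin> (\<Union>i\<in>I. U i)"
  proof (rule cube_degree_extra_zero[OF W bW _ _ _ I U])
    show "continuous_on (UNIV \<times> {0..1}) f" unfolding f_def
      by (rule continuous_on_compose2[OF shoot_continuous[OF d, of UNIV]]) (auto intro!: continuous_intros)
    show "p \<in> W" if "p \<in> closure W \<inter> UNIV \<times> {0..1}" "f p = 0" for p
      using clW[of p] that ZW by (auto simp: mem_Times_iff)
    show "f (z, 0) \<noteq> 0" if "(z, 0) \<in> W" for z
    proof
      assume "f (z, 0) = 0"
      then have "(z, 0) \<in> Z" using clW[of "(z, 0)"] that closure_subset by auto
      then show False using genuine[of "(z, 0)"] by (auto simp: Z_def)
    qed
    show "z \<in> U i \<and> (z, 1) \<in> W" if "i \<in> I" "z \<in> closure (U i)" "f (z, 1) = 0" for i z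
    proof -
      have "(z, 1) \<in> Z" using zU[of i z] that by (simp add: Z_def f1)
      then show ?thesis using zU[of i z] that ZW by (auto simp: f1)
    qed
    show "\<forall>\<^sub>F \<rho> in at_right 0. cube_degree \<rho> (U i) (\<lambda>z. f (z, 1)) = unit_degree TYPE(complex \<times> complex) \<rho>"
      if "i \<in> I" for i using deg[OF that] by (simp add: f1)
  qed
  then obtain z where z: "(z, 1) \<in> W" "f (z, 1) = 0" "z \<notin> (\<Union>i\<in>I. U i)" by blast
  then have "(z, 1) \<in> Z" using clW[of "(z, 1)"] closure_subset by auto
  then show ?thesis using z(3) by (intro exI[of _ z]) (auto simp: Z_def f1)
qed

text \<open>The zeros \<open>z \<Omega>\<close> differ because their regions are disjoint, the zeros
  \<open>e j\<close> because of their winding numbers. If \<open>z \<Omega> = e j\<close>, then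
  \<open>\<Omega>\<close> belongs to the class \<open>j\<close>, and \<open>e j\<close> avoids the
  regions of that class.\<close>

lemma multiplicity:
  assumes fin: "finite (bounded_components H)"
  shows "\<exists>lam0>0. \<forall>lam\<ge>lam0. \<exists>d>0. \<exists>T. finite T \<and>
    card T = card (bounded_components H) + card ((\<lambda>\<Omega>. component_winding \<Omega> H) ` bounded_components H) \<and>
    (\<forall>z\<in>T. repulsive_periodic_solution q h lam (flow d z lam))"
proof -
  define BC where "BC = bounded_components H"
  have finBC: "finite BC" using fin by (simp add: BC_def)
  have "\<forall>\<Omega>\<in>BC. \<exists>x. good_data \<Omega> (fst x) (fst (snd x)) (fst (snd (snd x))) (snd (snd (snd x)))"
    using good_data_exists by (auto simp: BC_def)
  from bchoice[OF this] obtain X where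
    X: "\<forall>\<Omega>\<in>BC. good_data \<Omega> (fst (X \<Omega>)) (fst (snd (X \<Omega>))) (fst (snd (snd (X \<Omega>)))) (snd (snd (snd (X \<Omega>))))"
    by blast
  define N \<eta> L \<delta> where "N \<Omega> = fst (X \<Omega>)" and "\<eta> \<Omega> = fst (snd (X \<Omega>))"
    and "L \<Omega> = fst (snd (snd (X \<Omega>)))" and "\<delta> \<Omega> = snd (snd (snd (X \<Omega>)))" for \<Omega>
  have gd: "good_data \<Omega> (N \<Omega>) (\<eta> \<Omega>) (L \<Omega>) (\<delta> \<Omega>)" if "\<Omega> \<in> BC" for \<Omega>
    using X that by (simp add: N_def \<eta>_def L_def \<delta>_def)
  have Lpos: "L \<Omega> > 0" and \<delta>pos: "\<delta> \<Omega> > 0" and N\<Omega>: "N \<Omega> \<subseteq> \<Omega>" if "\<Omega> \<in> BC" for \<Omega>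
    using gd[OF that] by (auto simp: good_data_def)
  \<comment> \<open>The sum bounds every single \<open>L \<Omega>\<close>; the summand 1 keeps the
    threshold positive when there are no components.\<close>
  define lam0 where "lam0 = 1 + (\<Sum>\<Omega>\<in>BC. L \<Omega>)"
  have sumL: "(\<Sum>\<Omega>\<in>BC. L \<Omega>) \<ge> 0" using Lpos by (intro sum_nonneg) (auto intro: less_imp_le)
  have L_le: "L \<Omega> \<le> lam0" if "\<Omega> \<in> BC" for \<Omega>
    using member_le_sum[OF that, of L] Lpos finBC by (force simp: lam0_def)
  have "\<exists>d>0. \<exists>T. finite T \<and> card T = card BC + card ((\<lambda>\<Omega>. component_winding \<Omega> H) ` BC) \<and>
    (\<forall>z\<in>T. repulsive_periodic_solution q h lam (flow d z lam))" if lam: "lam \<ge> lam0" for lam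
  proof -
    have lam_pos: "lam > 0" using lam sumL by (simp add: lam0_def)
    obtain c R where c: "c > 0" and ub: "uniform_bound lam c R"
      by (rule uniform_bound_exists[OF lam_pos])
    \<comment> \<open>The truncation radius depends on \<open>lam\<close> through \<open>c\<close>,
      hence its place after \<open>lam\<close> in the statement; half of \<open>c\<close> leaves the
      gap that \<open>extra_periodic_datum\<close> requires.\<close>
    define d where "d = Min (insert (c / 2) (\<delta> ` BC))"
    have d: "d > 0" unfolding d_def using finBC c \<delta>pos by (subst Min_gr_iff) auto
    have dc: "2 * d \<le> c"
    proof -
      have "d \<le> c / 2" unfolding d_def using finBC by (intro Min_le) auto
      then show ?thesis by simp
    qed
    have d\<delta>: "d \<le> \<delta> \<Omega>" if "\<Omega> \<in> BC" for \<Omega> unfolding d_def using finBC that by (intro Min_le) auto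
    define U where "U \<Omega> = near_region (N \<Omega>) (\<eta> \<Omega>) lam" for \<Omega>
    define cw where "cw \<Omega> = component_winding \<Omega> H" for \<Omega>
    define wn where "wn z = winding_number (\<lambda>t. - flow d z lam t) 0" for z
    have U: "open (U \<Omega>)" "bounded (U \<Omega>)"
      "\<And>z. z \<in> closure (U \<Omega>) \<Longrightarrow> shoot d (z, lam) = 0 \<Longrightarrow>
        z \<in> U \<Omega> \<and> (\<forall>t\<in>{0..1}. d \<le> norm (flow d z lam t)) \<and> wn z = of_int (cw \<Omega>)"
      "\<forall>\<^sub>F \<rho> in at_right 0. cube_degree \<rho> (U \<Omega>) (\<lambda>z. shoot d (z, lam)) = unit_degree TYPE(complex \<times> complex) \<rho>"
      if \<Omega>: "\<Omega> \<in> BC" for \<Omega>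
    proof -
      have "L \<Omega> \<le> lam" using L_le[OF \<Omega>] lam by simp
      then show "open (U \<Omega>)" "bounded (U \<Omega>)"
        "\<And>z. z \<in> closure (U \<Omega>) \<Longrightarrow> shoot d (z, lam) = 0 \<Longrightarrow>
        z \<in> U \<Omega> \<and> (\<forall>t\<in>{0..1}. d \<le> norm (flow d z lam t)) \<and> wn z = of_int (cw \<Omega>)"
        "\<forall>\<^sub>F \<rho> in at_right 0. cube_degree \<rho> (U \<Omega>) (\<lambda>z. shoot d (z, lam)) = unit_degree TYPE(complex \<times> complex) \<rho>"
        using gd[OF \<Omega>] d d\<delta>[OF \<Omega>] unfolding good_data_def U_def cw_def wn_def by blast+
    qed
    have disj: "U \<Omega> \<inter> U \<Omega>' = {}" if "\<Omega> \<in> BC" "\<Omega>' \<in> BC" "\<Omega> \<noteq> \<Omega>'" for \<Omega> \<Omega>'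
    proof -
      have "\<Omega> \<inter> \<Omega>' = {}"
        using that components_nonoverlap[of \<Omega> "- path_image H" \<Omega>'] by (auto simp: BC_def bounded_components_def)
      then show ?thesis using N\<Omega>[OF that(1)] N\<Omega>[OF that(2)] by (auto simp: U_def near_region_def)
    qed
    have "\<forall>\<Omega>\<in>BC. \<exists>z. z \<in> U \<Omega> \<and> shoot d (z, lam) = 0"
    proof
      fix \<Omega> assume \<Omega>: "\<Omega> \<in> BC"
      have "continuous_on (closure (U \<Omega>)) (\<lambda>z. shoot d (z, lam))"
        by (rule continuous_on_compose2[OF shoot_continuous[OF d, of UNIV]]) (auto intro!: continuous_intros)
      then show "\<exists>z. z \<in> U \<Omega> \<and> shoot d (z, lam) = 0"
        using cube_degree_zero_exists[OF U(1,2)[OF \<Omega>] _ _ U(4)[OF \<Omega>]] U(3)[OF \<Omega>] by blast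
    qed
    from bchoice[OF this] obtain z where z: "\<forall>\<Omega>\<in>BC. z \<Omega> \<in> U \<Omega> \<and> shoot d (z \<Omega>, lam) = 0" by blast
    have z': "z \<Omega> \<in> U \<Omega>" "shoot d (z \<Omega>, lam) = 0" "\<forall>t\<in>{0..1}. d \<le> norm (flow d (z \<Omega>) lam t)"
      "wn (z \<Omega>) = of_int (cw \<Omega>)" if \<Omega>: "\<Omega> \<in> BC" for \<Omega>
    proof -
      show 1: "z \<Omega> \<in> U \<Omega>" "shoot d (z \<Omega>, lam) = 0" using z \<Omega> by blast+
      have "z \<Omega> \<in> closure (U \<Omega>)" using 1(1) closure_subset by blast
      from U(3)[OF \<Omega> this 1(2)] show "\<forall>t\<in>{0..1}. d \<le> norm (flow d (z \<Omega>) lam t)" "wn (z \<Omega>) = of_int (cw \<Omega>)"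
        by blast+
    qed
    have "\<forall>j\<in>cw ` BC. \<exists>z. shoot d (z, lam) = 0 \<and> (\<forall>t\<in>{0..1}. d \<le> norm (flow d z lam t)) \<and>
      wn z = of_int j \<and> z \<notin> (\<Union>\<Omega>\<in>{\<Omega> \<in> BC. cw \<Omega> = j}. U \<Omega>)"
    proof
      fix j assume "j \<in> cw ` BC"
      then have ne: "{\<Omega> \<in> BC. cw \<Omega> = j} \<noteq> {}" by auto
      show "\<exists>z. shoot d (z, lam) = 0 \<and> (\<forall>t\<in>{0..1}. d \<le> norm (flow d z lam t)) \<and>
        wn z = of_int j \<and> z \<notin> (\<Union>\<Omega>\<in>{\<Omega> \<in> BC. cw \<Omega> = j}. U \<Omega>)"
        unfolding wn_def
      proof (rule extra_periodic_datum[OF lam_pos d dc ub _ ne])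
        show "finite {\<Omega> \<in> BC. cw \<Omega> = j}" using finBC by simp
        show "disjoint_family_on U {\<Omega> \<in> BC. cw \<Omega> = j}" using disj by (auto simp: disjoint_family_on_def)
        show "y \<in> U \<Omega> \<and> (\<forall>t\<in>{0..1}. d \<le> norm (flow d y lam t)) \<and> winding_number (\<lambda>t. - flow d y lam t) 0 = of_int j"
          if "\<Omega> \<in> {\<Omega> \<in> BC. cw \<Omega> = j}" "y \<in> closure (U \<Omega>)" "shoot d (y, lam) = 0" for \<Omega> y
          using U(3)[of \<Omega> y] that by (auto simp: wn_def)
      qed (use U in auto)
    qed
    from bchoice[OF this] obtain e where e: "\<forall>j\<in>cw ` BC. shoot d (e j, lam) = 0 \<and>
      (\<forall>t\<in>{0..1}. d \<le> norm (flow d (e j) lam t)) \<and> wn (e j) = of_int j \<and> e j \<notin> (\<Union>\<Omega>\<in>{\<Omega> \<in> BC. cw \<Omega> = j}. U \<Omega>)"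
      by blast
    define T where "T = z ` BC \<union> e ` cw ` BC"
    have "inj_on z BC"
    proof (rule inj_onI)
      fix \<Omega> \<Omega>' assume \<Omega>: "\<Omega> \<in> BC" "\<Omega>' \<in> BC" "z \<Omega> = z \<Omega>'"
      then show "\<Omega> = \<Omega>'" using disj[of \<Omega> \<Omega>'] z'(1)[of \<Omega>] z'(1)[of \<Omega>'] by auto
    qed
    then have "card (z ` BC) = card BC" by (rule card_image)
    moreover have "inj_on e (cw ` BC)"
    proof (rule inj_onI)
      fix j j' assume "j \<in> cw ` BC" "j' \<in> cw ` BC" "e j = e j'"
      then have "(of_int j :: complex) = of_int j'" using e by metis
      then show "j = j'" by simp
    qed
    then have "card (e ` cw ` BC) = card (cw ` BC)" by (rule card_image)
    moreover have "z ` BC \<inter> e ` cw ` BC = {}"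
    proof -
      have "z \<Omega> \<noteq> e j" if \<Omega>: "\<Omega> \<in> BC" and j: "j \<in> cw ` BC" for \<Omega> j
      proof
        assume eq: "z \<Omega> = e j"
        then have "(of_int (cw \<Omega>) :: complex) = of_int j" using z'(4)[OF \<Omega>] e j by metis
        then have "cw \<Omega> = j" by simp
        then have "e j \<notin> U \<Omega>" using e j \<Omega> by blast
        then show False using z'(1)[OF \<Omega>] eq by simp
      qed
      then show ?thesis by blast
    qed
    ultimately have cardT: "card T = card BC + card (cw ` BC)"
      unfolding T_def using finBC by (subst card_Un_disjoint) auto
    have "repulsive_periodic_solution q h lam (flow d y lam)" if y: "y \<in> T" for y
    proof -
      have "shoot d (y, lam) = 0 \<and> (\<forall>t\<in>{0..1}. d \<le> norm (flow d y lam t))"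
        using y z'(2,3) e unfolding T_def by blast
      then show ?thesis by (intro shoot_zero_solution[OF d]) auto
    qed
    moreover have "finite T" using finBC by (simp add: T_def)
    ultimately show ?thesis using d cardT unfolding cw_def by blast
  qed
  then show ?thesis
    unfolding BC_def[symmetric] using sumL by (intro exI[of _ lam0]) (auto simp: lam0_def)
qed

end

theorem theorem2p2:
  fixes q :: real and h H H' :: "real \<Rightarrow> complex" and r s :: nat
  assumes "q \<ge> 2"
    and "continuous_on {0..1} h"
    and "integral {0..1} h = 0"
    and "C2_derivs H H' (\<lambda>t. - h t)"
    and "H 0 = H 1" and "H' 0 = H' 1"
    and "finite (bounded_components H)"
    and "r = card (bounded_components H)"
    and "s = card ((\<lambda>\<Omega>. component_winding \<Omega> H) ` bounded_components H)"
  shows "\<exists>lam0>0. \<forall>lam\<ge>lam0. \<exists>U :: nat \<Rightarrow> real \<Rightarrow> complex.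
           (\<forall>i<r + s. repulsive_periodic_solution q h lam (U i)) \<and>
           (\<forall>i<r + s. \<forall>j<r + s. i \<noteq> j \<longrightarrow> (\<exists>t\<in>{0..1}. U i t \<noteq> U j t))"
proof -
  interpret forced_problem q h H H' by unfold_locales (use assms in auto)
  obtain lam0 where lam0: "lam0 > 0" "\<forall>lam\<ge>lam0. \<exists>d>0. \<exists>T. finite T \<and> card T = r + s \<and>
      (\<forall>z\<in>T. repulsive_periodic_solution q h lam (flow d z lam))"
    using multiplicity[OF assms(7)] assms(8,9) by blast
  show ?thesis
  proof (intro exI[of _ lam0] conjI allI impI)
    fix lam assume "lam0 \<le> lam"
    then obtain d T where dT: "d > 0" "finite T" "card T = r + s"
      "\<forall>z\<in>T. repulsive_periodic_solution q h lam (flow d z lam)" using lam0(2) by blast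
    obtain e where e: "bij_betw e {0..<r + s} T" using ex_bij_betw_nat_finite[OF dT(2)] dT(3) by auto
    have mem: "e i \<in> T" if "i < r + s" for i using e that by (auto simp: bij_betw_def)
    have inj: "i = j" if "e i = e j" "i < r + s" "j < r + s" for i j
      by (rule inj_onD[OF bij_betw_imp_inj_on[OF e] that(1)]) (use that in auto)
    have "(\<forall>i<r + s. repulsive_periodic_solution q h lam (flow d (e i) lam)) \<and>
      (\<forall>i<r + s. \<forall>j<r + s. i \<noteq> j \<longrightarrow> (\<exists>t\<in>{0..1}. flow d (e i) lam t \<noteq> flow d (e j) lam t))"
      using mem dT(4) inj flow_inject[OF dT(1)] by blast
    then show "\<exists>U :: nat \<Rightarrow> real \<Rightarrow> complex.
           (\<forall>i<r + s. repulsive_periodic_solution q h lam (U i)) \<and>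
           (\<forall>i<r + s. \<forall>j<r + s. i \<noteq> j \<longrightarrow> (\<exists>t\<in>{0..1}. U i t \<noteq> U j t))"
      by (intro exI[of _ "\<lambda>i. flow d (e i) lam"])
  qed (rule lam0(1))
qed

end
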